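(* Let $1\le k\le d$ and $n\ge1$ be integers, and let $x_1,\ldots,x_n$ be deterministic vectors in $\mathbb{R}^d$. Define $\sigma>0$ by $\frac1n\sum_{i=1}^n|x_i|^2=\sigma^2d$, and let $B:=\sup_{\xi\in\mathbb{S}^{d-1}}\frac1n\sum_{i=1}^n\langle\xi,x_i\rangle^2$. Let $Z=(Z_1,\ldots,Z_k)$ be a standard normal random vector in $\mathbb{R}^k$. For $\theta=(\theta_1,\ldots,\theta_k)\in\mathfrak{W}_{d,k}$, let $$d_{BL}(X_\theta,\sigma Z)=\sup_{\|f\|_1\le1}\left|\frac1n\sum_{i=1}^nf\left(\langle x_i,\theta_1\rangle,\ldots,\langle x_i,\theta_k\rangle\right)-\mathbb{E}f(\sigma Z_1,\ldots,\sigma Z_k)\right|;$$ that is, the conditional bounded-Lipschitz distance from $X_\theta$ to $\sigma Z$, conditioned on $\theta$, where $X_\theta$ is distributed (given $\theta$) according to $\mu_{n,d,k}^\theta:=\frac1n\sum_{i=1}^n\delta_{(\langle\theta_1,x_i\rangle,\ldots,\langle\theta_k,x_i\rangle)}$. Then for every $\epsilon>2\pi\sqrt{\frac{B}{d}}$ and $\theta$ a random point of $\mathfrak{W}_{d,k}$ distributed according to Haar measure, $$\mathbb{P}\left[\big|d_{BL}(X_\theta,\sigma Z)-\mathbb{E}\,d_{BL}(X_\theta,\sigma Z)\big|>\epsilon\right]\le\sqrt{\frac{\pi}{2}}\,e^{-\frac{d\epsilon^2}{32B}}.$$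
   Context: $|\cdot|$ denotes the Euclidean norm, $\mathbb{S}^{d-1}$ the unit sphere of $\mathbb{R}^d$, and $\delta_y$ the unit point mass at $y$. The Stiefel manifold is $\mathfrak{W}_{d,k}=\{\theta=(\theta_1,\ldots,\theta_k):\theta_i\in\mathbb{R}^d,\ \langle\theta_i,\theta_j\rangle=\delta_{ij}\text{ for all }1\le i,j\le k\}$; Haar measure on it is the unique rotation-invariant probability measure. For $f:\mathbb{R}^k\to\mathbb{R}$, $\|f\|_1:=\max\left\{\|f\|_\infty,\ \sup_{x\ne y}\frac{|f(x)-f(y)|}{|x-y|}\right\}$. The outer probability and expectation are over the random point $\theta$. *)

theory Defs
  imports "HOL-Probability.Probability"
begin

definition stiefel :: "(real ^ 'd ^ 'k) set" where
  "stiefel = {\<theta>. \<forall>i j. \<theta> $ i \<bullet> \<theta> $ j = (if i = j then 1 else 0)}"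

definition rotate_frame :: "(real ^ 'd \<Rightarrow> real ^ 'd) \<Rightarrow> real ^ 'd ^ 'k \<Rightarrow> real ^ 'd ^ 'k" where
  "rotate_frame U \<theta> = (\<chi> j. U (\<theta> $ j))"

(* Invariance is under the full orthogonal group O(d): for k = d the group SO(d) does not act
   transitively on the Stiefel manifold, and invariance under it would not determine the measure. *)
definition is_stiefel_haar :: "(real ^ 'd ^ 'k) measure \<Rightarrow> bool" where
  "is_stiefel_haar \<mu> \<longleftrightarrow>
     prob_space \<mu> \<and>
     sets \<mu> = sets (restrict_space borel stiefel) \<and>
     (\<forall>U. orthogonal_transformation U \<longrightarrow> distr \<mu> \<mu> (rotate_frame U) = \<mu>)"

definition std_normal_vector :: "'a measure \<Rightarrow> ('a \<Rightarrow> real ^ 'k) \<Rightarrow> bool" where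
  "std_normal_vector M Z \<longleftrightarrow>
     prob_space M \<and>
     prob_space.indep_vars M (\<lambda>_. borel) (\<lambda>j \<omega>. Z \<omega> $ j) UNIV \<and>
     (\<forall>j. distributed M lborel (\<lambda>\<omega>. Z \<omega> $ j) std_normal_density)"

(* Extended-real valued, so that unbounded or non-Lipschitz functions have norm infinity. *)
definition bl_norm :: "(real ^ 'k \<Rightarrow> real) \<Rightarrow> ereal" where
  "bl_norm f =
     max (SUP x. ereal \<bar>f x\<bar>)
         (SUP (x, y) \<in> {(x, y). x \<noteq> y}. ereal (\<bar>f x - f y\<bar> / norm (x - y)))"

definition frame_coords :: "real ^ 'd ^ 'k \<Rightarrow> real ^ 'd \<Rightarrow> real ^ 'k" where
  "frame_coords \<theta> v = (\<chi> j. v \<bullet> \<theta> $ j)"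

(* Distance between the law of W under M and the uniform distribution on the (possibly repeated)
   points frame_coords \<theta> (x 1), ..., frame_coords \<theta> (x n). *)
definition proj_bl_dist ::
    "nat \<Rightarrow> (nat \<Rightarrow> real ^ 'd) \<Rightarrow> 'a measure \<Rightarrow> ('a \<Rightarrow> real ^ 'k) \<Rightarrow> real ^ 'd ^ 'k \<Rightarrow> real" where
  "proj_bl_dist n x M W \<theta> =
     (SUP f \<in> {f. bl_norm f \<le> 1}.
        \<bar>1 / real n * (\<Sum>i = 1..n. f (frame_coords \<theta> (x i))) - (\<integral>\<omega>. f (W \<omega>) \<partial>M)\<bar>)"

lemma bl_norm_le_1_iff:
  "bl_norm f \<le> 1 \<longleftrightarrow> (\<forall>x. \<bar>f x\<bar> \<le> 1) \<and> (\<forall>x y. \<bar>f x - f y\<bar> \<le> norm (x - y))"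
proof -
  have "\<bar>f x - f y\<bar> / norm (x - y) \<le> 1 \<longleftrightarrow> \<bar>f x - f y\<bar> \<le> norm (x - y)" if "x \<noteq> y" for x y
    using that by (simp add: divide_le_eq)
  then have "(\<forall>x y. x \<noteq> y \<longrightarrow> \<bar>f x - f y\<bar> / norm (x - y) \<le> 1) \<longleftrightarrow>
             (\<forall>x y. \<bar>f x - f y\<bar> \<le> norm (x - y))"
    by (metis abs_zero diff_self norm_ge_zero)
  then show ?thesis
    by (auto simp: bl_norm_def SUP_le_iff one_ereal_def)
qed

(* The real-valued supremum defining the distance is therefore a genuine one. *)
lemma proj_bl_dist_bdd_above:
  fixes \<theta> :: "real ^ 'd ^ 'k" and W :: "'a \<Rightarrow> real ^ 'k"
  assumes "n \<ge> 1" "prob_space M"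
  shows "bdd_above ((\<lambda>f. \<bar>1 / real n * (\<Sum>i = 1..n. f (frame_coords \<theta> (x i)))
                           - (\<integral>\<omega>. f (W \<omega>) \<partial>M)\<bar>) ` {f. bl_norm f \<le> 1})"
proof (rule bdd_aboveI2)
  fix f :: "real ^ 'k \<Rightarrow> real" assume "f \<in> {f. bl_norm f \<le> 1}"
  then have f: "\<bar>f z\<bar> \<le> 1" for z by (simp add: bl_norm_le_1_iff)
  interpret prob_space M by fact
  have "\<bar>\<Sum>i = 1..n. f (frame_coords \<theta> (x i))\<bar> \<le> (\<Sum>i = 1..n. 1)"
    by (rule order_trans[OF sum_abs]) (intro sum_mono f)
  then have 1: "\<bar>1 / real n * (\<Sum>i = 1..n. f (frame_coords \<theta> (x i)))\<bar> \<le> 1"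
    using assms(1) by (simp add: abs_mult divide_le_eq)
  have 2: "\<bar>\<integral>\<omega>. f (W \<omega>) \<partial>M\<bar> \<le> 1"
  proof (cases "integrable M (\<lambda>\<omega>. f (W \<omega>))")
    case True
    have "\<bar>\<integral>\<omega>. f (W \<omega>) \<partial>M\<bar> \<le> (\<integral>\<omega>. \<bar>f (W \<omega>)\<bar> \<partial>M)"
      by (rule integral_abs_bound)
    also have "\<dots> \<le> (\<integral>\<omega>. 1 \<partial>M)"
      using True by (intro integral_mono) (auto intro: f)
    finally show ?thesis by (simp add: prob_space)
  qed (simp add: not_integrable_integral_eq)
  from 1 2 show "\<bar>1 / real n * (\<Sum>i = 1..n. f (frame_coords \<theta> (x i))) - (\<integral>\<omega>. f (W \<omega>) \<partial>M)\<bar> \<le> 2"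
    by linarith
qed

end

theory Submission
  imports Defs "HOL-Real_Asymp.Real_Asymp"
begin

text \<open>
  The distance is a function F of the frame with two properties. It is Lipschitz with constant
  sqrt B for the Euclidean norm on all k by d matrices (Cauchy-Schwarz and the definition of B,
  proj_bl_dist_lipschitz), and it satisfies F (U \<theta>) = F \<theta> for every orthogonal k by k matrix U
  (proj_bl_dist_frame_invariant), because composing a test function with a rotation changes neither
  its norm nor its Gaussian expectation. So F is a function of the span of the frame only. For every
  function of this kind with Lipschitz constant L, haar_concentration gives
  P(|F - E F| > \<epsilon>) \<le> 2 exp (- d \<epsilon>^2 / (2 \<pi>^2 L^2)), and since 2 \<pi>^2 < 32 the excess of the exponent
  absorbs the difference between 2 and sqrt (\<pi>/2) as soon as \<epsilon> > 2 \<pi> sqrt (B/d) (tail_constants).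
  Invariance under U is essential: for k = d the Stiefel manifold has two components, and a Lipschitz
  function without it can take different values on them.

  Concentration is proved in the manner of Maurey and Pisier, with a path in the Grassmannian in
  place of a rotation between two Gaussian vectors. By Jensen it suffices to bound
  E exp (t (F (\<theta>1 Q) - F (\<theta>0 Q))) for two fixed frames and a Haar distributed Q in O(d)
  (frame_increment_bound). After a change of frame inside each span, the rows of \<theta>1 are
  cos \<phi>_i a_i + sin \<phi>_i b_i, where the a_i are the rows of \<theta>0, the b_i with nonzero \<phi>_i are orthonormal
  and orthogonal to all a_i, and the principal angles \<phi>_i lie in [0, \<pi>/2] (principal_angles). Divide the path
  s \<mapsto> cos (s \<phi>_i) a_i + sin (s \<phi>_i) b_i into N equal steps. Each step is the image of the first one under
  an orthogonal matrix, which Q absorbs; so Jensen, applied to the mean of the N rescaled increments,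
  leaves only the first step. As N grows it becomes t times the inner product of the gradient of F at
  \<theta>0 Q with a velocity whose singular values are the \<phi>_i, hence at most \<pi>/2.

  It remains to bound E exp (a . Y), where Y is the gradient expressed in the moving frame. The law of
  Y is invariant under O(k) x O(d-k), hence E exp (a . Y) is a convex function of the matrix a that
  depends only on the singular values of a and increases with them. For k = d there is nothing to
  bound. For k < d, replace a by a multiple \<tau> of a matrix G of independent random signs: on the one hand the mean of exp (\<tau> G . Y) is at most
  exp (\<tau>^2 |Y|^2 / 2) whatever Y is, on the other hand the mean singular value of G is on average
  at least sqrt d / 2, by a comparison of its second and fourth moments. Convexity and symmetry
  replace the singular values of \<tau> G by their mean, and mgf_bound follows.

  Two devices make this elementary. A Lipschitz function need not be differentiable; its
  inf-convolution with a parabola is semiconcave, still invariant and uniformly close, and a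
  measurable choice of approximate supergradients serves as gradient, since an upper bound on the
  increments is all that is used (inf_convolution_supergradient). Haar measure on O(d) is built by
  orthonormalising independent uniform points of the unit ball, one row at a time
  (exists_random_orthonormal_rows).
\<close>

section \<open>Orthogonal matrices and singular values\<close>

lemma orthogonal_matrix_iff_rows:
  fixes R :: "real^'n^'n"
  shows "orthogonal_matrix R \<longleftrightarrow> (\<forall>i j. R $ i \<bullet> R $ j = (if i = j then 1 else 0))"
proof -
  have "orthogonal_matrix R \<longleftrightarrow> R ** transpose R = mat 1"
    by (metis orthogonal_matrix orthogonal_matrix_transpose transpose_transpose)
  also have "\<dots> \<longleftrightarrow> (\<forall>i j. R $ i \<bullet> R $ j = (if i = j then 1 else 0))"
    by (simp add: matrix_mult_transpose_dot_row vec_eq_iff mat_def row_def)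
  finally show ?thesis .
qed

lemma matrix_mult_row: "(A ** Q) $ i = A $ i v* Q" for A :: "real^'n^'m" and Q :: "real^'p^'n"
  by (simp add: matrix_matrix_mult_def vector_matrix_mult_def vec_eq_iff mult.commute)

lemma linear_vector_matrix_mult: "linear (\<lambda>x. x v* R)" for R :: "real^'n^'m"
  using matrix_vector_mul_linear[of "transpose R"] by simp

lemma linear_matrix_mult_right: "linear (\<lambda>A::real^'n^'m. A ** R)"
  by (rule linearI)
     (simp_all add: matrix_matrix_mult_def vec_eq_iff distrib_right sum.distrib sum_distrib_left mult.assoc)

lemma linear_matrix_mult_left: "linear (\<lambda>A::real^'n^'m. S ** A)" for S :: "real^'m^'p"
  by (rule linearI)
     (simp_all add: matrix_matrix_mult_def vec_eq_iff distrib_left sum.distrib sum_distrib_left mult.left_commute)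

lemma inner_vector_matrix_mult:
  "x \<bullet> (y v* Q) = (x v* transpose Q) \<bullet> y" for x y :: "real^_"
  by (metis dot_lmul_matrix inner_commute transpose_matrix_vector transpose_transpose)

lemma inner_matrix_mult_right:
  fixes A :: "real^'p^'m" and B :: "real^'n^'m"
  shows "A \<bullet> (B ** Q) = (A ** transpose Q) \<bullet> B"
proof -
  have "A $ i \<bullet> (B ** Q) $ i = (A ** transpose Q) $ i \<bullet> B $ i" for i
    by (simp only: matrix_mult_row inner_vector_matrix_mult)
  then show ?thesis by (simp add: inner_vec_def[of A] inner_vec_def[of "A ** transpose Q"])
qed

lemma inner_transpose:
  fixes A B :: "real^'n^'m"
  shows "transpose A \<bullet> transpose B = A \<bullet> B"
  by (simp add: inner_vec_def transpose_def) (rule sum.swap)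

lemma inner_matrix_mult_left:
  fixes A :: "real^'p^'m" and B :: "real^'p^'n"
  shows "A \<bullet> (S ** B) = (transpose S ** A) \<bullet> B"
proof -
  have "A \<bullet> (S ** B) = transpose A \<bullet> (transpose B ** transpose S)"
    by (metis inner_transpose matrix_transpose_mul)
  also have "\<dots> = transpose (transpose S ** A) \<bullet> transpose B"
    by (simp add: inner_matrix_mult_right matrix_transpose_mul)
  finally show ?thesis by (simp add: inner_transpose)
qed

lemma orthogonal_matrix_cancel:
  assumes "orthogonal_matrix (R::real^'n^'n)"
  shows "A ** R ** transpose R = A" "A ** transpose R ** R = A"
    "R ** (transpose R ** B) = B" "transpose R ** (R ** B) = B"
  using assms
  by (simp_all add: matrix_mul_assoc[symmetric] orthogonal_matrix_def)
     (simp_all add: matrix_mul_assoc orthogonal_matrix_def)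

lemma norm_mult_orthogonal_right:
  fixes A :: "real^'n^'m"
  assumes "orthogonal_matrix (Q::real^'n^'n)"
  shows "norm (A ** Q) = norm A"
  by (simp add: norm_eq_sqrt_inner inner_matrix_mult_right orthogonal_matrix_cancel assms)

lemma norm_mult_orthogonal_left:
  fixes A :: "real^'n^'m"
  assumes "orthogonal_matrix (S::real^'m^'m)"
  shows "norm (S ** A) = norm A"
  by (simp add: norm_eq_sqrt_inner inner_matrix_mult_left orthogonal_matrix_cancel assms)

lemma abs_matrix_entry_le_norm: "\<bar>Y $ i $ b\<bar> \<le> norm Y" for Y :: "real^'n^'m"
  using Finite_Cartesian_Product.norm_nth_le[of Y i] component_le_norm_cart[of "Y $ i" b] by linarith

text \<open>
  While A is not the whole index type, the rows chosen so far span a proper subspace, and a unit vector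
  orthogonal to it can be added.
\<close>

lemma complete_orthonormal_rows:
  fixes v :: "'n \<Rightarrow> real^'n"
  assumes "\<And>a b. a \<in> A \<Longrightarrow> b \<in> A \<Longrightarrow> v a \<bullet> v b = (if a = b then 1 else 0)"
  shows "\<exists>R. orthogonal_matrix R \<and> (\<forall>a\<in>A. R $ a = v a)"
  using assms
proof (induction "card (- A)" arbitrary: A v)
  case 0
  then have "A = UNIV" by (metis Compl_empty_eq card_0_eq double_complement finite_code)
  then have "orthogonal_matrix (\<chi> a. v a)"
    using 0 by (simp add: orthogonal_matrix_iff_rows)
  then show ?case by (intro exI[of _ "\<chi> a. v a"]) simp
next
  case (Suc m)
  then have "- A \<noteq> {}" by (metis card.empty old.nat.distinct(1))
  then obtain c where c: "c \<notin> A" by blast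
  have "card A < CARD('n)"
    using c by (metis UNIV_I finite_code psubsetI psubset_card_mono subset_UNIV)
  moreover have "dim (v ` A) \<le> card (v ` A)" by (rule dim_le_card) (auto intro: span_base)
  moreover have "card (v ` A) \<le> card A" by (rule card_image_le) simp
  ultimately have "dim (v ` A) < DIM(real^'n)" by simp
  then obtain u where u: "u \<noteq> 0" "\<And>y. y \<in> span (v ` A) \<Longrightarrow> orthogonal u y"
    by (metis orthogonal_to_subspace_exists)
  define v' where "v' = v(c := u /\<^sub>R norm u)"
  have uv: "u \<bullet> v a = 0" "v a \<bullet> u = 0" if "a \<in> A" for a
    using u(2)[of "v a"] that by (auto simp: span_base orthogonal_def inner_commute)
  have "m = card (- insert c A)"
    using Suc(2) c by (simp add: Compl_insert)
  moreover have "v' a \<bullet> v' b = (if a = b then 1 else 0)" if "a \<in> insert c A" "b \<in> insert c A" for a b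
    using that Suc(3) c uv u(1)
    by (auto simp: v'_def dot_square_norm[of u] power2_eq_square field_simps)
  ultimately obtain R where "orthogonal_matrix R" "\<forall>a\<in>insert c A. R $ a = v' a"
    using Suc(1) by blast
  then show ?case using c by (intro exI[of _ R]) (auto simp: v'_def)
qed

lemma dim_orthogonal_in_subspace:
  fixes e :: "'a::euclidean_space"
  assumes "subspace E" "e \<in> E" "e \<noteq> 0"
  shows "dim {x \<in> E. e \<bullet> x = 0} = dim E - 1"
proof -
  have "dim {y \<in> span E. \<forall>x \<in> span {e}. orthogonal x y} + dim (span {e}) = dim (span E)"
    using assms by (intro dim_subspace_orthogonal_to_vectors subspace_span span_mono) simp
  moreover have "span E = E" using assms by (simp add: span_eq_iff)
  moreover have "{y \<in> E. \<forall>x \<in> span {e}. orthogonal x y} = {x \<in> E. e \<bullet> x = 0}"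
    by (auto simp: span_singleton orthogonal_def)
  moreover have "dim (span {e}) = 1" using assms by (simp add: dim_insert)
  ultimately show ?thesis by simp
qed

text \<open>
  If g were nonzero on a vector x orthogonal to the maximiser e, then a small rotation of e in the plane of
  e and x would increase g.
\<close>

lemma linear_form_vanishes_off_maximizer:
  fixes g :: "'a::euclidean_space \<Rightarrow> real"
  assumes g: "linear g" and E: "subspace E" and e: "e \<in> E" "norm e = 1"
    and max: "\<And>u. u \<in> E \<Longrightarrow> norm u = 1 \<Longrightarrow> g u \<le> g e"
    and x: "x \<in> E" "e \<bullet> x = 0"
  shows "g x = 0"
proof (rule ccontr)
  assume nz: "g x \<noteq> 0"
  then have "x \<noteq> 0" using linear_0[OF g] by auto
  define x' where "x' = x /\<^sub>R norm x"
  define r where "r = g x'"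
  define S where "S = g e"
  have x': "x' \<in> E" "e \<bullet> x' = 0" "norm x' = 1"
    using x E \<open>x \<noteq> 0\<close> by (auto simp: x'_def subspace_scale)
  have "r \<noteq> 0" using nz \<open>x \<noteq> 0\<close> by (simp add: r_def x'_def linear_scale[OF g])
  then have S: "S * S < S * S + r * r" "0 < S * S + r * r"
    by (simp_all add: sum_squares_gt_zero_iff) (metis not_square_less_zero linorder_neqE mult_eq_0_iff)
  \<comment> \<open>The direction in the plane of e and x' in which g is largest.\<close>
  define z where "z = S *\<^sub>R e + r *\<^sub>R x'"
  have nz: "norm z = sqrt (S * S + r * r)"
    using e x' by (simp add: z_def norm_eq_sqrt_inner inner_add_left inner_add_right inner_commute norm_eq_1)
  then have "norm z \<noteq> 0" using S(2) by (metis less_irrefl real_sqrt_gt_zero)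
  then have "g (z /\<^sub>R norm z) \<le> S"
    unfolding S_def using e x' E by (intro max) (auto simp: z_def subspace_scale subspace_add)
  moreover have "g z = S * S + r * r"
    by (simp add: z_def linear_add[OF g] linear_scale[OF g] S_def r_def)
  ultimately have "(S * S + r * r) / sqrt (S * S + r * r) \<le> S"
    by (simp add: linear_scale[OF g] nz divide_inverse mult.commute)
  moreover have "(S * S + r * r) / sqrt (S * S + r * r) = sqrt (S * S + r * r)"
    using S by (simp add: real_div_sqrt)
  moreover have "S < sqrt (S * S + r * r)"
    using S by (intro real_less_rsqrt) (simp add: power2_eq_square)
  ultimately show False by linarith
qed

lemma unit_sphere_of_subspace:
  fixes E :: "'a::euclidean_space set"
  assumes "subspace E" "dim E > 0"
  shows "E \<inter> sphere 0 1 \<noteq> {}" "compact (E \<inter> sphere 0 1)"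
proof -
  have "\<not> E \<subseteq> {0}" using assms(2) dim_eq_0[of E] by linarith
  then obtain x where x: "x \<in> E" "x \<noteq> 0" by auto
  then have "x /\<^sub>R norm x \<in> E \<inter> sphere 0 1" using assms by (simp add: subspace_scale)
  then show "E \<inter> sphere 0 1 \<noteq> {}" by blast
  show "compact (E \<inter> sphere 0 1)"
    by (intro closed_Int_compact closed_subspace assms) simp
qed

text \<open>
  Two subspaces are allowed because the decomposition is applied both to the inner product between the
  spans of two frames, where it yields principal angles, and to a matrix restricted to the orthogonal
  complement of a frame. The proof is by deflation: at unit vectors e and h that maximise the form, it
  vanishes between e and the complement of h, and between the complement of e and h.
\<close>

lemma singular_value_decomposition:
  fixes A :: "'a::euclidean_space \<Rightarrow> 'b::euclidean_space"
  assumes A: "linear A" and E: "subspace E" and H: "subspace H" and n: "n = min (dim E) (dim H)"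
  shows "\<exists>e h s. (\<forall>i<n. e i \<in> E \<and> h i \<in> H \<and> 0 \<le> (s i :: real)) \<and>
      (\<forall>i<n. \<forall>j<n. e i \<bullet> e j = (if i = j then 1 else 0) \<and> h i \<bullet> h j = (if i = j then 1 else 0)) \<and>
      (\<forall>x\<in>E. \<forall>y\<in>H. A x \<bullet> y = (\<Sum>i<n. s i * (e i \<bullet> x) * (h i \<bullet> y)))"
  using E H n
proof (induction n arbitrary: E H)
  case 0
  then have "dim E = 0 \<or> dim H = 0" by linarith
  then have "E \<subseteq> {0} \<or> H \<subseteq> {0}" by (simp only: dim_eq_0)
  then have "A x \<bullet> y = 0" if "x \<in> E" "y \<in> H" for x y
    using that linear_0[OF A] by auto
  then show ?case by auto
next
  case (Suc n)
  let ?K = "(E \<inter> sphere 0 1) \<times> (H \<inter> sphere 0 1)"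
  have "dim E > 0" "dim H > 0" using Suc.prems(3) by linarith+
  then have K: "compact ?K" "?K \<noteq> {}"
    using unit_sphere_of_subspace[of E] unit_sphere_of_subspace[of H] Suc.prems(1,2)
    by (blast intro: compact_Times)+
  have cont: "continuous_on ?K (\<lambda>z. A (fst z) \<bullet> snd z)"
    by (intro continuous_intros linear_continuous_on_compose[OF _ A])
  obtain e h where eh: "e \<in> E" "norm e = 1" "h \<in> H" "norm h = 1"
    and max: "\<And>x y. x \<in> E \<Longrightarrow> norm x = 1 \<Longrightarrow> y \<in> H \<Longrightarrow> norm y = 1 \<Longrightarrow> A x \<bullet> y \<le> A e \<bullet> h"
    using continuous_attains_sup[OF K cont] by fastforce
  define S where "S = A e \<bullet> h"
  have S0: "S \<ge> 0"
    using max[of "- e" h] eh Suc.prems by (simp add: S_def linear_neg[OF A] subspace_neg)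
  have E0: "A x \<bullet> h = 0" if x: "x \<in> E" "e \<bullet> x = 0" for x
  proof (rule linear_form_vanishes_off_maximizer[of "\<lambda>x. A x \<bullet> h" E e x])
    show "linear (\<lambda>x. A x \<bullet> h)"
      by (rule linearI) (simp_all add: linear_add[OF A] linear_scale[OF A] inner_add_left)
  qed (use x eh Suc.prems max in auto)
  have H0: "A e \<bullet> y = 0" if y: "y \<in> H" "h \<bullet> y = 0" for y
  proof (rule linear_form_vanishes_off_maximizer[of "\<lambda>y. A e \<bullet> y" H h y])
    show "linear (\<lambda>y. A e \<bullet> y)" by (rule linearI) (simp_all add: inner_add_right)
  qed (use y eh Suc.prems max in auto)
  define E' where "E' = {x \<in> E. e \<bullet> x = 0}"
  define H' where "H' = {x \<in> H. h \<bullet> x = 0}"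
  have sub: "subspace E'" "subspace H'"
    unfolding E'_def H'_def using Suc.prems
    by (auto simp: subspace_def inner_add_right)
  have "dim E' = dim E - 1" "dim H' = dim H - 1"
    unfolding E'_def H'_def
    by (rule dim_orthogonal_in_subspace; use eh Suc.prems in force)+
  then have "n = min (dim E') (dim H')" using Suc.prems(3) by linarith
  from Suc.IH[OF sub this] obtain e' h' s' where
    IH: "\<And>i. i < n \<Longrightarrow> e' i \<in> E' \<and> h' i \<in> H' \<and> 0 \<le> (s' i :: real)"
     "\<And>i j. i < n \<Longrightarrow> j < n \<Longrightarrow> e' i \<bullet> e' j = (if i = j then 1 else 0) \<and> h' i \<bullet> h' j = (if i = j then 1 else 0)"
     "\<And>x y. x \<in> E' \<Longrightarrow> y \<in> H' \<Longrightarrow> A x \<bullet> y = (\<Sum>i<n. s' i * (e' i \<bullet> x) * (h' i \<bullet> y))"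
    by blast
  have orth: "e \<bullet> e' i = 0" "h \<bullet> h' i = 0" "e' i \<bullet> e = 0" "h' i \<bullet> h = 0" "e' i \<in> E" "h' i \<in> H" if "i < n" for i
    using IH(1)[OF that] by (auto simp: E'_def H'_def inner_commute)
  have dec: "A x \<bullet> y = (\<Sum>i<n. s' i * (e' i \<bullet> x) * (h' i \<bullet> y)) + S * (e \<bullet> x) * (h \<bullet> y)"
    if "x \<in> E" "y \<in> H" for x y
  proof -
    define x' where "x' = x - (e \<bullet> x) *\<^sub>R e"
    define y' where "y' = y - (h \<bullet> y) *\<^sub>R h"
    have x': "x' \<in> E'" "y' \<in> H'"
      using that eh Suc.prems
      by (auto simp: E'_def H'_def x'_def y'_def subspace_diff subspace_scale inner_diff_right norm_eq_1)
    have "e' i \<bullet> x' = e' i \<bullet> x" "h' i \<bullet> y' = h' i \<bullet> y" if "i < n" for i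
      using orth[OF that] by (simp_all add: x'_def y'_def inner_diff_right)
    then have 1: "A x' \<bullet> y' = (\<Sum>i<n. s' i * (e' i \<bullet> x) * (h' i \<bullet> y))"
      using IH(3)[OF x'] by simp
    have z: "A x' \<bullet> h = 0" "A e \<bullet> y' = 0"
      using E0 H0 x' by (auto simp: E'_def H'_def)
    have "A x \<bullet> y = A (x' + (e \<bullet> x) *\<^sub>R e) \<bullet> (y' + (h \<bullet> y) *\<^sub>R h)"
      by (simp add: x'_def y'_def)
    also have "\<dots> = A x' \<bullet> y' + S * (e \<bullet> x) * (h \<bullet> y)"
      using z by (simp add: linear_add[OF A] linear_scale[OF A] inner_add_left inner_add_right S_def)
    finally show ?thesis using 1 by simp
  qed
  have "e \<bullet> e = 1" "h \<bullet> h = 1" using eh by (auto simp: norm_eq_1)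
  show ?case
    apply (rule exI[of _ "e'(n := e)"], rule exI[of _ "h'(n := h)"], rule exI[of _ "s'(n := S)"])
    using orth IH(1,2) eh S0 dec \<open>e \<bullet> e = 1\<close> \<open>h \<bullet> h = 1\<close>
    by (auto simp: less_Suc_eq)
qed

section \<open>Rotation invariance of Lebesgue measure and Haar measure on the orthogonal group\<close>

lemma borel_measurable_vecI:
  fixes f :: "'a \<Rightarrow> ('b::euclidean_space)^'n"
  assumes "\<And>i. (\<lambda>z. f z $ i) \<in> borel_measurable M"
  shows "f \<in> borel_measurable M"
proof (rule iffD2[OF borel_measurable_euclidean_space], rule ballI)
  fix b :: "'b^'n" assume "b \<in> Basis"
  then obtain i u where b: "b = axis i u" unfolding Basis_vec_def by blast
  have "(\<lambda>z. f z $ i \<bullet> u) \<in> borel_measurable M"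
    using borel_measurable_inner[OF assms[of i] borel_measurable_const[of u M]] .
  then show "(\<lambda>z. f z \<bullet> b) \<in> borel_measurable M"
    unfolding b inner_axis .
qed

lemma borel_measurable_vec_nth [measurable (raw)]:
  fixes f :: "'a \<Rightarrow> ('b::euclidean_space)^'n"
  assumes "f \<in> borel_measurable M"
  shows "(\<lambda>z. f z $ i) \<in> borel_measurable M"
  by (rule borel_measurable_continuous_on[where f = "\<lambda>x. x $ i", OF _ assms]) (intro continuous_intros)

text \<open>
  The uniqueness argument for Haar measure, for the two translation invariant integrals
  g \<mapsto> \<integral> g (f x) dx and g \<mapsto> \<integral> g x dx. Fubini and translations show that they are proportional; the
  unit ball, which f preserves, shows that the factor is 1.
\<close>

lemma nn_integral_lborel_orthogonal:
  fixes f :: "'a::euclidean_space \<Rightarrow> 'a" and g :: "'a \<Rightarrow> ennreal"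
  assumes f: "orthogonal_transformation f" and [measurable]: "g \<in> borel_measurable borel"
  shows "(\<integral>\<^sup>+x. g (f x) \<partial>lborel) = (\<integral>\<^sup>+x. g x \<partial>lborel)"
proof -
  interpret lborel_pair: pair_sigma_finite "lborel :: 'a measure" "lborel :: 'a measure" ..
  have "linear f" using f by (rule orthogonal_transformation_linear)
  then have [measurable]: "f \<in> borel_measurable borel"
    by (intro borel_measurable_continuous_onI linear_continuous_on) (simp add: linear_conv_bounded_linear)
  obtain f' where f': "f (f' x) = x" for x
    using orthogonal_transformation_surj[OF f] by (metis surj_def)
  have trans: "(\<integral>\<^sup>+x. u (x + c) \<partial>lborel) = (\<integral>\<^sup>+x. u x \<partial>lborel)"
    if [measurable]: "u \<in> borel_measurable borel" for u :: "'a \<Rightarrow> ennreal" and c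
    by (subst (2) lborel_distr_plus[of c, symmetric]) (simp add: nn_integral_distr add.commute)
  define h :: "'a \<Rightarrow> ennreal" where "h = indicator (ball 0 1)"
  have [measurable]: "h \<in> borel_measurable borel"
    unfolding h_def by (intro borel_measurable_indicator borel_open) simp
  have h: "h (- x) = h x" "h (f x) = h x" for x
    using f by (auto simp: h_def indicator_def orthogonal_transformation)
  have fin: "(\<integral>\<^sup>+x. h x \<partial>lborel) = emeasure lborel (ball 0 1 :: 'a set)" by (simp add: h_def)
  have h0: "(\<integral>\<^sup>+x. h x \<partial>lborel) \<noteq> 0" "(\<integral>\<^sup>+x. h x \<partial>lborel) \<noteq> \<infinity>"
    unfolding fin using emeasure_lborel_ball_finite[of "0::'a" 1] content_ball_pos[of 1 "0::'a"]
    by (auto simp: measure_def)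
  have "(\<integral>\<^sup>+x. g x \<partial>lborel) * (\<integral>\<^sup>+y. h y \<partial>lborel)
      = (\<integral>\<^sup>+x. g x * (\<integral>\<^sup>+y. h (f y) \<partial>lborel) \<partial>lborel)"
    by (simp add: h nn_integral_multc)
  also have "\<dots> = (\<integral>\<^sup>+x. (\<integral>\<^sup>+y. g x * h (f y - x) \<partial>lborel) \<partial>lborel)"
  proof (rule nn_integral_cong)
    fix x
    have "(\<integral>\<^sup>+y. h (f y - x) \<partial>lborel) = (\<integral>\<^sup>+y. h (f (y + f' x) - x) \<partial>lborel)"
      by (subst trans[of "\<lambda>y. h (f y - x)" "f' x"]) simp_all
    then show "g x * (\<integral>\<^sup>+y. h (f y) \<partial>lborel) = (\<integral>\<^sup>+y. g x * h (f y - x) \<partial>lborel)"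
      by (simp add: nn_integral_cmult linear_add[OF \<open>linear f\<close>] f')
  qed
  also have "\<dots> = (\<integral>\<^sup>+y. (\<integral>\<^sup>+x. g x * h (f y - x) \<partial>lborel) \<partial>lborel)"
    by (rule lborel_pair.Fubini') simp
  also have "\<dots> = (\<integral>\<^sup>+y. (\<integral>\<^sup>+x. g (x + f y) * h x \<partial>lborel) \<partial>lborel)"
  proof (rule nn_integral_cong)
    fix y
    have "(\<integral>\<^sup>+x. g x * h (f y - x) \<partial>lborel) = (\<integral>\<^sup>+x. g (x + f y) * h (f y - (x + f y)) \<partial>lborel)"
      by (subst trans[of "\<lambda>x. g x * h (f y - x)" "f y"]) simp_all
    then show "(\<integral>\<^sup>+x. g x * h (f y - x) \<partial>lborel) = (\<integral>\<^sup>+x. g (x + f y) * h x \<partial>lborel)"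
      by (simp add: h)
  qed
  also have "\<dots> = (\<integral>\<^sup>+x. (\<integral>\<^sup>+y. g (x + f y) * h x \<partial>lborel) \<partial>lborel)"
    by (rule lborel_pair.Fubini') simp
  also have "\<dots> = (\<integral>\<^sup>+x. (\<integral>\<^sup>+y. g (f y) \<partial>lborel) * h x \<partial>lborel)"
  proof (rule nn_integral_cong)
    fix x
    have "(\<integral>\<^sup>+y. g (x + f y) \<partial>lborel) = (\<integral>\<^sup>+y. g (f (y + f' x)) \<partial>lborel)"
      by (simp add: linear_add[OF \<open>linear f\<close>] f' add.commute)
    also have "\<dots> = (\<integral>\<^sup>+y. g (f y) \<partial>lborel)"
      by (rule trans[of "\<lambda>y. g (f y)"]) simp
    finally show "(\<integral>\<^sup>+y. g (x + f y) * h x \<partial>lborel) = (\<integral>\<^sup>+y. g (f y) \<partial>lborel) * h x"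
      by (simp add: nn_integral_multc)
  qed
  also have "\<dots> = (\<integral>\<^sup>+y. g (f y) \<partial>lborel) * (\<integral>\<^sup>+y. h y \<partial>lborel)"
    by (simp add: nn_integral_cmult)
  finally have "(\<integral>\<^sup>+x. g x \<partial>lborel) * (\<integral>\<^sup>+y. h y \<partial>lborel)
      / (\<integral>\<^sup>+y. h y \<partial>lborel) = (\<integral>\<^sup>+y. g (f y) \<partial>lborel) * (\<integral>\<^sup>+y. h y \<partial>lborel) / (\<integral>\<^sup>+y. h y \<partial>lborel)"
    by (rule arg_cong)
  then show ?thesis
    using h0 by (simp add: ennreal_mult_divide_eq)
qed

lemma distr_density_lborel_orthogonal:
  fixes f :: "'a::euclidean_space \<Rightarrow> 'a"
  assumes f: "orthogonal_transformation f" and [measurable]: "\<phi> \<in> borel_measurable borel"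
    and inv: "\<And>x. \<phi> (f x) = \<phi> x"
  shows "distr (density lborel \<phi>) borel f = density lborel \<phi>"
proof (rule measure_eqI)
  have "linear f" using f by (rule orthogonal_transformation_linear)
  then have [measurable]: "f \<in> borel_measurable borel"
    by (intro borel_measurable_continuous_onI linear_continuous_on) (simp add: linear_conv_bounded_linear)
  fix A assume "A \<in> sets (distr (density lborel \<phi>) borel f)"
  then have [measurable]: "A \<in> sets borel" by simp
  have "emeasure (distr (density lborel \<phi>) borel f) A = (\<integral>\<^sup>+x. \<phi> (f x) * indicator A (f x) \<partial>lborel)"
    using measurable_sets_borel[of f borel A]
    by (subst emeasure_distr)
       (auto simp: emeasure_density inv intro!: nn_integral_cong split: split_indicator)
  also have "\<dots> = (\<integral>\<^sup>+x. \<phi> x * indicator A x \<partial>lborel)"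
    by (rule nn_integral_lborel_orthogonal[OF f, of "\<lambda>x. \<phi> x * indicator A x"]) simp
  finally show "emeasure (distr (density lborel \<phi>) borel f) A = emeasure (density lborel \<phi>) A"
    by (simp add: emeasure_density)
qed simp

lemma inner_orthogonal_matrix:
  assumes "orthogonal_matrix (R :: real^'n^'n)"
  shows "(x v* R) \<bullet> (y v* R) = x \<bullet> y"
proof -
  have "(x v* R) \<bullet> (y v* R) = (x v* (R ** transpose R)) \<bullet> y"
    by (simp only: inner_vector_matrix_mult vector_matrix_mul_assoc)
  then show ?thesis using assms by (simp add: orthogonal_matrix_def)
qed

lemma orthogonal_transformation_vector_matrix_mult:
  assumes "orthogonal_matrix (R :: real^'n^'n)"
  shows "orthogonal_transformation (\<lambda>x. x v* R)"
  unfolding orthogonal_transformation_def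
  using assms by (simp add: inner_orthogonal_matrix linear_vector_matrix_mult)

lemma borel_measurable_matrix_mult [measurable (raw)]:
  fixes A :: "'a \<Rightarrow> real^'n^'m" and B :: "'a \<Rightarrow> real^'p^'n"
  assumes [measurable]: "A \<in> borel_measurable M" "B \<in> borel_measurable M"
  shows "(\<lambda>x. A x ** B x) \<in> borel_measurable M"
  unfolding matrix_matrix_mult_def
  by (intro borel_measurable_vecI) simp

lemma borel_measurable_transpose [measurable (raw)]:
  fixes A :: "'a \<Rightarrow> real^'n^'m"
  assumes [measurable]: "A \<in> borel_measurable M"
  shows "(\<lambda>x. transpose (A x)) \<in> borel_measurable M"
  unfolding transpose_def
  by (intro borel_measurable_vecI) simp

text \<open>
  The inductive step fills row c with the normalised component, orthogonal to the rows already chosen,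
  of an independent uniform point of the unit ball. Gram-Schmidt commutes with rotations, so
  invariance is inherited; the component vanishes only on a subspace of smaller dimension, hence
  almost never.
\<close>

lemma exists_random_orthonormal_rows:
  fixes J :: "'n::finite set"
  shows "\<exists>N :: (real^'n^'n) measure. prob_space N \<and> sets N = sets borel \<and>
      (AE w in N. \<forall>i\<in>J. \<forall>j\<in>J. w $ i \<bullet> w $ j = (if i = j then 1 else 0)) \<and>
      (\<forall>R. orthogonal_matrix R \<longrightarrow> distr N borel (\<lambda>w. w ** R) = N)"
  using finite[of J]
proof (induction J rule: finite_induct)
  case empty
  show ?case
    by (intro exI[of _ "return borel 0"])
       (auto intro!: prob_space_return simp: distr_return)
next
  case (insert c J)
  then obtain N :: "(real^'n^'n) measure" where N: "prob_space N" and [measurable_cong]: "sets N = sets borel"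
    and on: "AE w in N. \<forall>i\<in>J. \<forall>j\<in>J. w $ i \<bullet> w $ j = (if i = j then 1 else 0)"
    and inv: "\<And>R. orthogonal_matrix R \<Longrightarrow> distr N borel (\<lambda>w. w ** R) = N"
    by blast
  define b where "b = emeasure lborel (ball 0 1 :: (real^'n) set)"
  have b: "b \<noteq> 0" "b \<noteq> \<infinity>"
    unfolding b_def using emeasure_lborel_ball_finite[of "0::real^'n" 1] content_ball_pos[of 1 "0::real^'n"]
    by (auto simp: measure_def)
  define \<nu> :: "(real^'n) measure" where "\<nu> = uniform_measure lborel (ball 0 1)"
  have sets_\<nu> [measurable_cong]: "sets \<nu> = sets borel" by (simp add: \<nu>_def)
  have P\<nu>: "prob_space \<nu>" unfolding \<nu>_def using b by (intro prob_space_uniform_measure) (auto simp: b_def)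
  interpret N: prob_space N by fact
  interpret \<nu>: prob_space \<nu> by fact
  interpret NV: pair_prob_space N \<nu> ..
  have inv\<nu>: "distr \<nu> borel (\<lambda>g. g v* R) = \<nu>" if R: "orthogonal_matrix R" for R
    unfolding \<nu>_def uniform_measure_def
  proof (rule distr_density_lborel_orthogonal)
    show f: "orthogonal_transformation (\<lambda>g. g v* R)"
      by (rule orthogonal_transformation_vector_matrix_mult[OF R])
    show "indicator (ball 0 1) (g v* R) / emeasure lborel (ball 0 1 :: (real^'n) set)
        = indicator (ball 0 1) g / emeasure lborel (ball 0 1 :: (real^'n) set)" for g
      using f by (auto simp: indicator_def orthogonal_transformation)
    show "(\<lambda>g. indicator (ball 0 1) g / emeasure lborel (ball 0 1 :: (real^'n) set))
        \<in> borel_measurable borel"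
      unfolding divide_ennreal_def
      by (intro borel_measurable_times_ennreal borel_measurable_indicator borel_measurable_const borel_open open_ball)
  qed
  define res :: "real^'n^'n \<Rightarrow> real^'n \<Rightarrow> real^'n"
    where "res w g = g - (\<Sum>j\<in>J. (g \<bullet> w $ j) *\<^sub>R w $ j)" for w g
  define upd :: "real^'n^'n \<Rightarrow> real^'n \<Rightarrow> real^'n^'n"
    where "upd w g = (\<chi> i. if i = c then res w g /\<^sub>R norm (res w g) else w $ i)" for w g
  have [measurable]: "(\<lambda>z. res (fst z) (snd z)) \<in> borel_measurable (borel \<Otimes>\<^sub>M borel)"
    unfolding res_def by measurable
  have [measurable]: "(\<lambda>z. upd (fst z) (snd z)) \<in> borel_measurable (borel \<Otimes>\<^sub>M borel)"
    unfolding upd_def by (intro borel_measurable_vecI) simp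
  have upd_meas: "(\<lambda>z. upd (fst z) (snd z)) \<in> borel_measurable (N \<Otimes>\<^sub>M \<nu>)"
    by measurable
  define N' where "N' = distr (N \<Otimes>\<^sub>M \<nu>) borel (\<lambda>z. upd (fst z) (snd z))"
  have "prob_space N'"
    unfolding N'_def by (rule NV.prob_space_distr) (rule upd_meas)
  moreover have "sets N' = sets borel" by (simp add: N'_def)
  moreover have "AE w in N'. \<forall>i\<in>insert c J. \<forall>j\<in>insert c J. w $ i \<bullet> w $ j = (if i = j then 1 else 0)"
  proof -
    have "AE g in \<nu>. res w g \<noteq> 0" for w
    proof -
      have "dim (span ((\<lambda>j. w $ j) ` J)) \<le> card J"
        using dim_le_card[of "(\<lambda>j. w $ j) ` J" "(\<lambda>j. w $ j) ` J"] card_image_le[OF insert.hyps(1), of "\<lambda>j. w $ j"]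
          insert.hyps(1) span_superset by fastforce
      also have "card J < CARD('n)"
        using insert.hyps(2) by (metis UNIV_I finite_code psubsetI psubset_card_mono subset_UNIV)
      finally have "negligible (span ((\<lambda>j. w $ j) ` J))"
        by (intro negligible_lowdim) simp
      then have "AE g in lborel. g \<notin> span ((\<lambda>j. w $ j) ` J)"
        by (intro AE_not_in) (simp add: negligible_iff_null_sets null_sets_completion_iff)
      then have "AE g in lborel. res w g \<noteq> 0"
      proof (rule AE_mp, intro AE_I2 impI notI)
        fix g assume g: "g \<notin> span ((\<lambda>j. w $ j) ` J)" "res w g = 0"
        then have "g = (\<Sum>j\<in>J. (g \<bullet> w $ j) *\<^sub>R w $ j)" by (simp add: res_def)
        moreover have "(\<Sum>j\<in>J. (g \<bullet> w $ j) *\<^sub>R w $ j) \<in> span ((\<lambda>j. w $ j) ` J)"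
          by (intro span_sum span_scale span_base) auto
        ultimately show False using g by simp
      qed
      then show ?thesis
        unfolding \<nu>_def by (intro AE_uniform_measureI) auto
    qed
    then have "AE z in N \<Otimes>\<^sub>M \<nu>. 0 < norm (res (fst z) (snd z))"
    proof (intro NV.AE_pair_measure)
      show "{z \<in> space (N \<Otimes>\<^sub>M \<nu>). 0 < norm (res (fst z) (snd z))} \<in> sets (N \<Otimes>\<^sub>M \<nu>)"
        unfolding res_def by measurable
    qed simp
    moreover have "AE z in N \<Otimes>\<^sub>M \<nu>. \<forall>i\<in>J. \<forall>j\<in>J. fst z $ i \<bullet> fst z $ j = (if i = j then 1 else 0)"
      by (rule NV.AE_pair_measure) (measurable, use on in auto)
    ultimately have "AE z in N \<Otimes>\<^sub>M \<nu>. \<forall>i\<in>insert c J. \<forall>j\<in>insert c J.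
        upd (fst z) (snd z) $ i \<bullet> upd (fst z) (snd z) $ j = (if i = j then 1 else 0)"
    proof eventually_elim
      case (elim z)
      obtain w g where z: "z = (w, g)" by (cases z)
      have r: "res w g \<bullet> w $ i = 0" if "i \<in> J" for i
      proof -
        have "(\<Sum>j\<in>J. (g \<bullet> w $ j) * (w $ j \<bullet> w $ i)) = (\<Sum>j\<in>J. if j = i then g \<bullet> w $ i else 0)"
          using elim(2) that by (intro sum.cong) (auto simp: z)
        then show ?thesis
          using that insert.hyps(1) by (simp add: res_def inner_diff_left inner_sum_left)
      qed
      have "inverse (norm (res w g)) * (inverse (norm (res w g)) * (res w g \<bullet> res w g)) = 1"
        using elim(1) by (simp add: z dot_square_norm power2_eq_square field_simps)
      moreover have "c \<notin> J" by fact
      ultimately show ?case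
        using elim(2) r by (auto simp: z upd_def inner_commute)
    qed
    then show ?thesis
      unfolding N'_def by (subst AE_distr_iff) simp_all
  qed
  moreover have "distr N' borel (\<lambda>w. w ** R) = N'" if R: "orthogonal_matrix R" for R
  proof -
    have "res (w ** R) (g v* R) = res w g v* R" for w g
      unfolding res_def matrix_mult_row inner_orthogonal_matrix[OF R]
      by (simp add: linear_diff[OF linear_vector_matrix_mult] linear_sum[OF linear_vector_matrix_mult]
          linear_scale[OF linear_vector_matrix_mult])
    moreover have "norm (x v* R) = norm x" for x
      using orthogonal_transformation_vector_matrix_mult[OF R] by (simp add: orthogonal_transformation)
    ultimately have eq: "upd (w ** R) (g v* R) = upd w g ** R" for w g
      unfolding vec_eq_iff[of "upd (w ** R) (g v* R)" for w g]
      by (simp add: upd_def matrix_mult_row linear_scale[OF linear_vector_matrix_mult])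
    have mR [measurable]: "(\<lambda>g. g v* R) \<in> borel_measurable borel"
      using orthogonal_transformation_linear[OF orthogonal_transformation_vector_matrix_mult[OF R]]
      by (intro borel_measurable_continuous_onI linear_continuous_on) (simp add: linear_conv_bounded_linear)
    have "N \<Otimes>\<^sub>M \<nu> = distr N borel (\<lambda>w. w ** R) \<Otimes>\<^sub>M distr \<nu> borel (\<lambda>g. g v* R)"
      by (simp add: inv inv\<nu> R)
    also have "\<dots> = distr (N \<Otimes>\<^sub>M \<nu>) (borel \<Otimes>\<^sub>M borel) (\<lambda>(w, g). (w ** R, g v* R))"
      by (rule pair_measure_distr) (auto simp: inv\<nu> R \<nu>.sigma_finite_measure_axioms)
    finally have NV: "N \<Otimes>\<^sub>M \<nu> = distr (N \<Otimes>\<^sub>M \<nu>) (borel \<Otimes>\<^sub>M borel) (\<lambda>(w, g). (w ** R, g v* R))" .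
    have "N' = distr (distr (N \<Otimes>\<^sub>M \<nu>) (borel \<Otimes>\<^sub>M borel) (\<lambda>(w, g). (w ** R, g v* R))) borel (\<lambda>z. upd (fst z) (snd z))"
      unfolding N'_def by (subst NV) simp
    also have "\<dots> = distr (N \<Otimes>\<^sub>M \<nu>) borel (\<lambda>z. upd (fst z) (snd z) ** R)"
      by (subst distr_distr) (auto simp: comp_def case_prod_beta eq)
    also have "\<dots> = distr N' borel (\<lambda>w. w ** R)"
      unfolding N'_def by (subst distr_distr) (auto simp: comp_def)
    finally show ?thesis by simp
  qed
  ultimately show ?case by blast
qed

lemma exists_right_invariant_orthogonal:
  "\<exists>N :: (real^'n^'n) measure. prob_space N \<and> sets N = sets borel \<and>
      (AE w in N. orthogonal_matrix w) \<and>
      (\<forall>R. orthogonal_matrix R \<longrightarrow> distr N borel (\<lambda>w. w ** R) = N)"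
  using exists_random_orthonormal_rows[of "UNIV :: 'n set"]
  by (simp add: orthogonal_matrix_iff_rows)

lemma exists_left_invariant_orthogonal:
  "\<exists>N :: (real^'n^'n) measure. prob_space N \<and> sets N = sets borel \<and>
      (AE w in N. orthogonal_matrix w) \<and>
      (\<forall>R. orthogonal_matrix R \<longrightarrow> distr N borel (\<lambda>w. R ** w) = N)"
proof -
  obtain N :: "(real^'n^'n) measure" where N: "prob_space N" and [measurable_cong]: "sets N = sets borel"
    and o: "AE w in N. orthogonal_matrix w"
    and inv: "\<And>R. orthogonal_matrix R \<Longrightarrow> distr N borel (\<lambda>w. w ** R) = N"
    using exists_right_invariant_orthogonal by blast
  interpret prob_space N by fact
  define N' where "N' = distr N borel transpose"
  have "prob_space N'" unfolding N'_def by (rule prob_space_distr) simp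
  moreover have "AE w in N'. orthogonal_matrix w"
    unfolding N'_def orthogonal_matrix_def using o
    by (subst AE_distr_iff) (auto simp: orthogonal_matrix_def)
  moreover have "distr N' borel (\<lambda>w. R ** w) = N'" if "orthogonal_matrix R" for R
  proof -
    have "N' = distr (distr N borel (\<lambda>w. w ** transpose R)) borel transpose"
      using that by (simp add: N'_def inv)
    also have "\<dots> = distr N' borel (\<lambda>w. R ** w)"
      unfolding N'_def by (simp add: distr_distr comp_def matrix_transpose_mul)
    finally show ?thesis by simp
  qed
  ultimately show ?thesis by (intro exI[of _ N']) (simp add: N'_def)
qed

section \<open>Regularisation of Lipschitz functions by inf-convolution\<close>

definition inf_convolution :: "real \<Rightarrow> ('a::euclidean_space \<Rightarrow> real) \<Rightarrow> 'a \<Rightarrow> real" where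
  "inf_convolution h F x = (INF y. F y + (norm (x - y))\<^sup>2 / (2 * h))"

context
  fixes F :: "'a::euclidean_space \<Rightarrow> real" and L h :: real
  assumes h: "h > 0" and L: "L \<ge> 0" and lip: "\<And>x y. \<bar>F x - F y\<bar> \<le> L * norm (x - y)"
begin

text \<open>
  Completing the square in |x - y|: moving from x to y can lower F by L |x - y| at most, and the parabola
  charges for the distance. This makes the infimum finite and close to F.
\<close>

lemma inf_convolution_lower_term: "F x - L\<^sup>2 * h / 2 \<le> F y + (norm (x - y))\<^sup>2 / (2 * h)"
proof -
  have "0 \<le> (norm (x - y) - L * h)\<^sup>2 / (2 * h)" using h by simp
  also have "\<dots> = (norm (x - y))\<^sup>2 / (2 * h) - L * norm (x - y) + L\<^sup>2 * h / 2"
    using h unfolding power2_diff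
    by (simp add: diff_divide_distrib add_divide_distrib power_mult_distrib) (simp add: power2_eq_square)
  finally show ?thesis using lip[of x y] by linarith
qed

lemma inf_convolution_bdd: "bdd_below (range (\<lambda>y. F y + (norm (x - y))\<^sup>2 / (2 * h)))"
  using inf_convolution_lower_term by (intro bdd_belowI2)

lemma inf_convolution_le_term: "inf_convolution h F x \<le> F y + (norm (x - y))\<^sup>2 / (2 * h)"
  unfolding inf_convolution_def by (rule cINF_lower[OF inf_convolution_bdd]) simp

lemma inf_convolution_le: "inf_convolution h F x \<le> F x"
  using inf_convolution_le_term[of x x] by simp

lemma inf_convolution_ge: "F x - L\<^sup>2 * h / 2 \<le> inf_convolution h F x"
  unfolding inf_convolution_def by (rule cINF_greatest[OF UNIV_not_empty]) (rule inf_convolution_lower_term)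

lemma inf_convolution_lipschitz: "\<bar>inf_convolution h F x - inf_convolution h F y\<bar> \<le> L * norm (x - y)"
proof -
  have *: "inf_convolution h F x - L * norm (x - y) \<le> inf_convolution h F y" for x y
    unfolding inf_convolution_def[of _ _ y]
  proof (rule cINF_greatest[OF UNIV_not_empty])
    fix z
    have "inf_convolution h F x \<le> F (z + (x - y)) + (norm (x - (z + (x - y))))\<^sup>2 / (2 * h)"
      by (rule inf_convolution_le_term)
    moreover have "F (z + (x - y)) \<le> F z + L * norm (x - y)"
      using lip[of "z + (x - y)" z] by (simp add: abs_le_iff)
    ultimately show "inf_convolution h F x - L * norm (x - y) \<le> F z + (norm (y - z))\<^sup>2 / (2 * h)"
      by (simp add: algebra_simps)
  qed
  show ?thesis using *[of x y] *[of y x] by (simp add: abs_le_iff norm_minus_commute)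
qed

lemma inf_convolution_continuous: "continuous_on S (inf_convolution h F)"
proof (cases "L = 0")
  case True
  then have "inf_convolution h F x = inf_convolution h F y" for x y
    using inf_convolution_lipschitz[of x y] by simp
  then have "inf_convolution h F = (\<lambda>_. inf_convolution h F 0)" by blast
  then show ?thesis by (metis continuous_on_const)
next
  case False
  then have "L-lipschitz_on S (inf_convolution h F)"
    using L inf_convolution_lipschitz by (intro lipschitz_onI) (auto simp: dist_norm)
  then show ?thesis by (rule lipschitz_on_continuous_on)
qed

lemma inf_convolution_invariant:
  assumes T: "orthogonal_transformation T" and inv: "\<And>x. F (T x) = F x"
  shows "inf_convolution h F (T x) = inf_convolution h F x"
proof -
  have "norm (T x - T y) = norm (x - y)" for y
    using T by (simp add: orthogonal_transformation_isometry dist_norm)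
  then have "(\<lambda>y. F y + (norm (T x - y))\<^sup>2 / (2 * h)) \<circ> T = (\<lambda>y. F y + (norm (x - y))\<^sup>2 / (2 * h))"
    by (simp only: inv comp_def)
  then have "range (\<lambda>y. F y + (norm (T x - y))\<^sup>2 / (2 * h)) = range (\<lambda>y. F y + (norm (x - y))\<^sup>2 / (2 * h))"
    using orthogonal_transformation_surj[OF T] image_comp[of "\<lambda>y. F y + (norm (T x - y))\<^sup>2 / (2 * h)" T UNIV]
    by simp
  then show ?thesis by (simp only: inf_convolution_def)
qed

text \<open>
  If y nearly attains the infimum at x, then the parabola centred at y, shifted by F y, lies above the
  inf-convolution everywhere and nearly touches it at x; its gradient (x - y) / h is the approximate
  supergradient. An exact minimiser would give the clean bound L for the norm, but a measurable
  choice is easy only from a countable dense set, which costs the error \<delta>.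
\<close>

lemma inf_convolution_supergradient:
  assumes \<delta>: "\<delta> > 0"
  shows "\<exists>p \<in> borel_measurable borel. (\<forall>x. norm (p x) \<le> L + \<delta>) \<and>
    (\<forall>x y. inf_convolution h F y
        \<le> inf_convolution h F x + p x \<bullet> (y - x) + (norm (y - x))\<^sup>2 / (2 * h) + \<delta>)"
proof -
  let ?G = "inf_convolution h F"
  \<comment> \<open>The step - s p with s = 2 h \<theta> would beat the Lipschitz bound if |p| exceeded L + \<delta>; \<eta> is the resulting tolerance.\<close>
  define \<theta> where "\<theta> = \<delta> / (2 * (L + \<delta>))"
  have \<theta>: "\<theta> > 0" "\<theta> < 1" "(L + \<delta>) * (1 - \<theta>) = L + \<delta> / 2"
    using \<delta> L by (auto simp: \<theta>_def field_simps)
  define \<eta> where "\<eta> = min \<delta> (h * \<theta> * (L + \<delta>) * \<delta> / 2)"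
  have \<eta>: "\<eta> > 0" "\<eta> \<le> \<delta>" "\<eta> / (2 * h * \<theta>) \<le> (L + \<delta>) * \<delta> / 4"
  proof -
    have pos: "h * \<theta> * (L + \<delta>) * \<delta> / 2 > 0" using \<delta> L \<theta>(1) h by simp
    then show "\<eta> > 0" "\<eta> \<le> \<delta>" using \<delta> by (auto simp: \<eta>_def)
    have "\<eta> \<le> h * \<theta> * (L + \<delta>) * \<delta> / 2" by (simp add: \<eta>_def)
    also have "\<dots> = ((L + \<delta>) * \<delta> / 4) * (2 * h * \<theta>)" by simp
    finally have "\<eta> \<le> ((L + \<delta>) * \<delta> / 4) * (2 * h * \<theta>)" .
    then show "\<eta> / (2 * h * \<theta>) \<le> (L + \<delta>) * \<delta> / 4" using \<theta>(1) h by (subst pos_divide_le_eq) simp_all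
  qed
  obtain D :: "'a set" where D: "countable D" "\<And>X. open X \<Longrightarrow> X \<noteq> {} \<Longrightarrow> \<exists>d\<in>D. d \<in> X"
    using countable_dense_setE by metis
  then have "D \<noteq> {}" by (metis empty_iff open_UNIV UNIV_not_empty)
  define r where "r = from_nat_into D"
  let ?P = "\<lambda>n x. F (r n) + (norm (x - r n))\<^sup>2 / (2 * h) < ?G x + \<eta>"
  have contF: "continuous_on S F" for S
  proof -
    have "L-lipschitz_on S F" using L lip by (intro lipschitz_onI) (auto simp: dist_norm)
    then show ?thesis by (rule lipschitz_on_continuous_on)
  qed
  have ex: "\<exists>n. ?P n x" for x
  proof -
    have "\<exists>y. F y + (norm (x - y))\<^sup>2 / (2 * h) < ?G x + \<eta>"
    proof (rule ccontr)
      assume "\<not> ?thesis"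
      then have "?G x + \<eta> \<le> ?G x"
        unfolding inf_convolution_def by (intro cINF_greatest[OF UNIV_not_empty]) (auto simp: not_less)
      then show False using \<eta> by simp
    qed
    then have ne: "{y. F y + (norm (x - y))\<^sup>2 / (2 * h) < ?G x + \<eta>} \<noteq> {}" by blast
    have "open {y. F y + (norm (x - y))\<^sup>2 / (2 * h) < ?G x + \<eta>}"
      using h by (intro open_Collect_less continuous_intros contF) auto
    from D(2)[OF this ne] obtain d where "d \<in> D" "F d + (norm (x - d))\<^sup>2 / (2 * h) < ?G x + \<eta>"
      by blast
    then show ?thesis
      unfolding r_def using from_nat_into_surj[OF D(1)] by metis
  qed
  define n where "n x = (LEAST n. ?P n x)" for x
  have n: "?P (n x) x" for x unfolding n_def using ex by (rule LeastI_ex)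
  define p where "p x = (x - r (n x)) /\<^sub>R h" for x
  have [measurable]: "?G \<in> borel_measurable borel"
    by (intro borel_measurable_continuous_onI inf_convolution_continuous)
  have "n \<in> measurable borel (count_space UNIV)"
    unfolding n_def by measurable
  then have [measurable]: "(\<lambda>x. r (n x)) \<in> borel_measurable borel"
    by (rule measurable_compose) simp
  have pm: "p \<in> borel_measurable borel" unfolding p_def by measurable
  have super: "?G y \<le> ?G x + p x \<bullet> (y - x) + (norm (y - x))\<^sup>2 / (2 * h) + \<eta>" for x y
  proof -
    have "?G y \<le> F (r (n x)) + (norm (y - r (n x)))\<^sup>2 / (2 * h)" by (rule inf_convolution_le_term)
    also have "(norm (y - r (n x)))\<^sup>2 / (2 * h)
        = (norm (x - r (n x)))\<^sup>2 / (2 * h) + p x \<bullet> (y - x) + (norm (y - x))\<^sup>2 / (2 * h)"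
      using h by (simp add: p_def power2_norm_eq_inner inner_simps field_simps inner_commute)
    finally show ?thesis using n[of x] by linarith
  qed
  have "norm (p x) \<le> L + \<delta>" for x
  proof (rule ccontr)
    assume big: "\<not> norm (p x) \<le> L + \<delta>"
    define s where "s = 2 * h * \<theta>"
    have s: "s > 0" using h \<theta> by (simp add: s_def)
    have "?G x - L * (s * norm (p x)) \<le> ?G (x - s *\<^sub>R p x)"
      using inf_convolution_lipschitz[of x "x - s *\<^sub>R p x"] s by (simp add: abs_le_iff)
    also have "\<dots> \<le> ?G x - s * (norm (p x))\<^sup>2 + s\<^sup>2 * (norm (p x))\<^sup>2 / (2 * h) + \<eta>"
      using super[of "x - s *\<^sub>R p x" x] s by (simp add: power2_norm_eq_inner power_mult_distrib)
    also have "s\<^sup>2 * (norm (p x))\<^sup>2 / (2 * h) = s * (\<theta> * (norm (p x))\<^sup>2)"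
      using h by (simp add: s_def power2_eq_square)
    finally have "s * (norm (p x) * (norm (p x) * (1 - \<theta>) - L)) \<le> \<eta>"
      by (simp add: algebra_simps power2_eq_square)
    then have 1: "norm (p x) * (norm (p x) * (1 - \<theta>) - L) \<le> (L + \<delta>) * \<delta> / 4"
      using \<eta>(3) s unfolding s_def[symmetric] by (metis order_trans pos_le_divide_eq mult.commute)
    have "L + \<delta> / 2 \<le> norm (p x) * (1 - \<theta>)"
      unfolding \<theta>(3)[symmetric] using big \<theta> by (intro mult_right_mono) auto
    then have "(L + \<delta>) * (\<delta> / 2) \<le> norm (p x) * (norm (p x) * (1 - \<theta>) - L)"
      using big \<delta> L by (intro mult_mono) auto
    moreover have "(L + \<delta>) * \<delta> > 0" using \<delta> L by simp
    ultimately show False using 1 by linarith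
  qed
  moreover have "?G y \<le> ?G x + p x \<bullet> (y - x) + (norm (y - x))\<^sup>2 / (2 * h) + \<delta>" for x y
    using super[of y x] \<eta>(2) by linarith
  ultimately show ?thesis using pm by blast
qed

end

section \<open>Random sign matrices\<close>

text \<open>
  Hoeffding's lemma for a random sign.
\<close>

lemma cosh_le_exp_half_square: "exp x + exp (- x) \<le> 2 * exp (x\<^sup>2 / 2)" for x :: real
proof -
  have *: "exp y + exp (- y) \<le> 2 * exp (y\<^sup>2 / 2)" if "y \<ge> 0" for y :: real
  proof -
    have "- (2 * y) * (1/2) + ln (1 + (1/2) * (exp (2 * y) - 1)) \<le> (2 * y)\<^sup>2 / 8"
      using that by (intro Hoeffdings_lemma_aux) auto
    then have "ln ((1 + exp (2 * y)) / 2) \<le> y\<^sup>2 / 2 + y" by (simp add: field_simps power2_eq_square)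
    moreover have "(1 + exp (2 * y)) / 2 > 0" by (simp add: add_pos_pos)
    ultimately have "(1 + exp (2 * y)) / 2 \<le> exp (y\<^sup>2 / 2 + y)"
      by (metis exp_le_cancel_iff exp_ln)
    then have "(1 + exp (2 * y)) * exp (- y) \<le> 2 * exp (y\<^sup>2 / 2 + y) * exp (- y)"
      by (intro mult_right_mono) auto
    then show ?thesis by (simp add: algebra_simps mult_exp_exp)
  qed
  show ?thesis using *[of x] *[of "- x"] by (cases "x \<ge> 0") (auto simp: add.commute)
qed

text \<open>
  The columns in D will be the coordinates orthogonal to a standard frame.
\<close>

definition sign_matrix :: "'d::finite set \<Rightarrow> ('k \<times> 'd \<Rightarrow> bool) \<Rightarrow> real^'d^'k" where
  "sign_matrix D \<epsilon> = (\<chi> i b. if b \<in> D then if \<epsilon> (i, b) then 1 else - 1 else 0)"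

text \<open>
  The sum over all sign patterns factorises into hyperbolic cosines, one for each entry.
\<close>

lemma sign_matrix_exp_sum:
  fixes Y :: "real^'d^'k" and D :: "'d::finite set"
  shows "(\<Sum>\<epsilon>\<in>UNIV. exp (\<tau> * (sign_matrix D \<epsilon> \<bullet> Y)))
    \<le> real CARD('k \<times> 'd \<Rightarrow> bool) * exp (\<tau>\<^sup>2 * (norm Y)\<^sup>2 / 2)"
proof -
  define f where "f p c = exp (\<tau> * (if snd p \<in> D then (if c then 1 else - 1) * Y $ fst p $ snd p else 0))"
    for p :: "'k \<times> 'd" and c :: bool
  have sumprod: "(\<Sum>p\<in>UNIV. g p) = (\<Sum>i\<in>UNIV. \<Sum>b\<in>UNIV. g (i, b))" for g :: "'k \<times> 'd \<Rightarrow> real"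
    by (simp add: sum.cartesian_product)
  have "exp (\<tau> * (sign_matrix D \<epsilon> \<bullet> Y)) = (\<Prod>p\<in>UNIV. f p (\<epsilon> p))" for \<epsilon>
    by (simp add: f_def exp_sum[symmetric] sumprod inner_vec_def sign_matrix_def sum_distrib_left
        if_distrib[of "\<lambda>u. u * _"] cong: if_cong)
  then have "(\<Sum>\<epsilon>\<in>UNIV. exp (\<tau> * (sign_matrix D \<epsilon> \<bullet> Y))) = (\<Prod>p\<in>UNIV. \<Sum>c\<in>UNIV. f p c)"
    by (subst prod_sum_PiE) auto
  also have "\<dots> \<le> (\<Prod>p\<in>UNIV. 2 * exp (\<tau>\<^sup>2 * (Y $ fst p $ snd p)\<^sup>2 / 2))"
  proof (rule prod_mono)
    fix p :: "'k \<times> 'd"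
    show "0 \<le> (\<Sum>c\<in>UNIV. f p c) \<and> (\<Sum>c\<in>UNIV. f p c) \<le> 2 * exp (\<tau>\<^sup>2 * (Y $ fst p $ snd p)\<^sup>2 / 2)"
      using cosh_le_exp_half_square[of "\<tau> * Y $ fst p $ snd p"]
      by (auto simp: UNIV_bool f_def power_mult_distrib intro!: add_nonneg_nonneg)
  qed
  also have "\<dots> = 2 ^ CARD('k \<times> 'd) * exp (\<Sum>p\<in>(UNIV :: ('k \<times> 'd) set). \<tau>\<^sup>2 * (Y $ fst p $ snd p)\<^sup>2 / 2)"
    by (simp add: prod.distrib exp_sum)
  also have "(\<Sum>p\<in>(UNIV :: ('k \<times> 'd) set). \<tau>\<^sup>2 * (Y $ fst p $ snd p)\<^sup>2 / 2) = \<tau>\<^sup>2 * (norm Y)\<^sup>2 / 2"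
  proof -
    have "(norm Y)\<^sup>2 = (\<Sum>i\<in>UNIV. \<Sum>b\<in>UNIV. (Y $ i $ b)\<^sup>2)"
      by (simp only: power2_norm_eq_inner) (simp add: inner_vec_def power2_eq_square)
    then show ?thesis by (simp add: sumprod sum_distrib_left sum_divide_distrib)
  qed
  finally show ?thesis by (simp add: card_fun)
qed

lemma sign_matrix_norm:
  fixes D :: "'d::finite set"
  shows "(norm (sign_matrix D \<epsilon> :: real^'d^'k))\<^sup>2 = real (CARD('k) * card D)"
proof -
  have "(norm (sign_matrix D \<epsilon> :: real^'d^'k))\<^sup>2 = (\<Sum>i\<in>(UNIV::'k set). \<Sum>b\<in>(UNIV::'d set). if b \<in> D then 1 else 0)"
    unfolding power2_norm_eq_inner inner_vec_def
    by (intro sum.cong) (auto simp: sign_matrix_def)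
  then show ?thesis by (simp add: sum.If_cases)
qed

text \<open>
  The squared norm of the Gram matrix is a sum of products of entries at the corners (i,b), (i',b),
  (i,b'), (i',b') of a rectangle. If the corners are distinct, the product averages to zero; otherwise it
  is a product of squares, and there are k |D| (k + |D| - 1) degenerate rectangles.
\<close>

lemma sign_matrix_gram_sum:
  fixes D :: "'d::finite set"
  shows "(\<Sum>\<epsilon>\<in>UNIV. (norm (sign_matrix D \<epsilon> ** transpose (sign_matrix D \<epsilon> :: real^'d^'k)))\<^sup>2)
    \<le> real CARD('k \<times> 'd \<Rightarrow> bool) * (real CARD('k) * card D * (real CARD('k) + card D - 1))"
proof -
  let ?C = "real CARD('k \<times> 'd \<Rightarrow> bool)"
  define G where "G \<epsilon> = (sign_matrix D \<epsilon> :: real^'d^'k)" for \<epsilon>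
  define t where "t i i' b b' = (\<Sum>\<epsilon>\<in>UNIV. G \<epsilon> $ i $ b * G \<epsilon> $ i' $ b * (G \<epsilon> $ i $ b' * G \<epsilon> $ i' $ b'))" for i i' b b'
  have Gz: "G \<epsilon> $ i $ b = 0" if "b \<notin> D" for \<epsilon> i b using that by (simp add: G_def sign_matrix_def)
  have t: "t i i' b b' \<le> ?C * ((if i = i' then 1 else 0) + (if b = b' then 1 else 0)
      - (if i = i' then 1 else 0) * (if b = b' then 1 else 0))"
    if "b \<in> D" "b' \<in> D" for i i' b b'
  proof (cases "i = i' \<or> b = b'")
    case True
    have "t i i' b b' \<le> (\<Sum>\<epsilon>\<in>(UNIV::('k \<times> 'd \<Rightarrow> bool) set). 1)"
      unfolding t_def G_def sign_matrix_def by (rule sum_mono) auto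
    then show ?thesis using True by auto
  next
    case False
    \<comment> \<open>Reversing the sign at one corner of the rectangle reverses the sign of the product.\<close>
    define flip where "flip \<epsilon> = \<epsilon>((i, b) := \<not> \<epsilon> (i, b))" for \<epsilon> :: "'k \<times> 'd \<Rightarrow> bool"
    have ff: "flip (flip \<epsilon>) = \<epsilon>" for \<epsilon> by (simp add: flip_def)
    have "t i i' b b' = (\<Sum>\<epsilon>\<in>UNIV. G (flip \<epsilon>) $ i $ b * G (flip \<epsilon>) $ i' $ b * (G (flip \<epsilon>) $ i $ b' * G (flip \<epsilon>) $ i' $ b'))"
      unfolding t_def by (rule sum.reindex_bij_witness[of _ flip flip]) (auto simp: ff)
    also have "\<dots> = (\<Sum>\<epsilon>\<in>UNIV. - (G \<epsilon> $ i $ b * G \<epsilon> $ i' $ b * (G \<epsilon> $ i $ b' * G \<epsilon> $ i' $ b')))"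
      using False by (intro sum.cong) (auto simp: G_def sign_matrix_def flip_def)
    finally have "t i i' b b' = - t i i' b b'" by (simp add: t_def sum_negf)
    then show ?thesis using False by simp
  qed
  have "(norm (G \<epsilon> ** transpose (G \<epsilon>)))\<^sup>2
      = (\<Sum>i\<in>UNIV. \<Sum>i'\<in>UNIV. \<Sum>b\<in>D. \<Sum>b'\<in>D. G \<epsilon> $ i $ b * G \<epsilon> $ i' $ b * (G \<epsilon> $ i $ b' * G \<epsilon> $ i' $ b'))" for \<epsilon>
  proof -
    have "(G \<epsilon> ** transpose (G \<epsilon>)) $ i $ i' = (\<Sum>b\<in>D. G \<epsilon> $ i $ b * G \<epsilon> $ i' $ b)" for i i'
      unfolding matrix_matrix_mult_def transpose_def
      by (simp, rule sum.mono_neutral_right) (auto simp: Gz)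
    then show ?thesis
      by (simp add: power2_norm_eq_inner inner_vec_def sum_product)
  qed
  then have "(\<Sum>\<epsilon>\<in>UNIV. (norm (G \<epsilon> ** transpose (G \<epsilon>)))\<^sup>2)
    = (\<Sum>i\<in>UNIV. \<Sum>i'\<in>UNIV. \<Sum>b\<in>D. \<Sum>b'\<in>D. t i i' b b')"
    unfolding t_def by (simp add: sum.swap[of _ _ "UNIV :: ('k \<times> 'd \<Rightarrow> bool) set"])
  also have "\<dots> \<le> (\<Sum>i\<in>(UNIV::'k set). \<Sum>i'\<in>(UNIV::'k set). \<Sum>b\<in>D. \<Sum>b'\<in>D.
      ?C * ((if i = i' then 1 else 0) + (if b = b' then 1 else 0)
      - (if i = i' then 1 else 0) * (if b = b' then 1 else 0)))"
    by (intro sum_mono t)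
  also have "\<dots> = ?C * (real CARD('k) * card D * (real CARD('k) + card D - 1))"
    by (simp add: sum_distrib_left[symmetric] sum.distrib sum_subtractf sum_distrib_right[symmetric] algebra_simps)
  finally show ?thesis by (simp add: G_def)
qed

section \<open>Frames, their orthogonal complements and principal angles\<close>

definition coordinate_frame :: "('k::finite \<Rightarrow> 'd::finite) \<Rightarrow> real^'d^'k" where
  "coordinate_frame \<iota> = (\<chi> i. axis (\<iota> i) 1)"

definition partial_diagonal :: "'k::finite set \<Rightarrow> ('k \<Rightarrow> 'd::finite) \<Rightarrow> ('k \<Rightarrow> real) \<Rightarrow> real^'d^'k" where
  "partial_diagonal J \<rho> s = (\<chi> i b. if i \<in> J \<and> b = \<rho> i then s i else 0)"

lemma coordinate_frame_mult: "(coordinate_frame \<iota> ** R) $ i = R $ \<iota> i"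
proof -
  have "(coordinate_frame \<iota> ** R) $ i $ b = R $ \<iota> i $ b" for b
    by (simp add: coordinate_frame_def matrix_matrix_mult_def axis_def if_distrib[of "\<lambda>u. u * _"] cong: if_cong)
  then show ?thesis by (simp add: vec_eq_iff)
qed

lemma inner_partial_diagonal:
  "partial_diagonal J \<rho> s \<bullet> Y = (\<Sum>i\<in>J. s i * Y $ i $ \<rho> i)"
proof -
  have "(\<Sum>b\<in>UNIV. (if i \<in> J \<and> b = \<rho> i then s i else 0) * Y $ i $ b) = (if i \<in> J then s i * Y $ i $ \<rho> i else 0)" for i
    by (cases "i \<in> J") (simp_all add: if_distrib[of "\<lambda>u. u * _"] cong: if_cong)
  then show ?thesis
    by (simp add: inner_vec_def partial_diagonal_def sum.If_cases)
qed

lemma norm_partial_diagonal: "(norm (partial_diagonal J \<rho> s))\<^sup>2 = (\<Sum>i\<in>J. (s i)\<^sup>2)"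
  unfolding power2_norm_eq_inner inner_partial_diagonal
  by (intro sum.cong) (auto simp: partial_diagonal_def power2_eq_square)

lemma norm_partial_diagonal_gram:
  fixes \<rho> :: "'k::finite \<Rightarrow> 'd::finite"
  assumes "inj_on \<rho> J"
  shows "(norm (partial_diagonal J \<rho> s ** transpose (partial_diagonal J \<rho> s)))\<^sup>2 = (\<Sum>i\<in>J. (s i) ^ 4)"
proof -
  let ?P = "partial_diagonal J \<rho> s"
  have "(?P ** transpose ?P) $ i $ j = (if i \<in> J \<and> j = i then (s i)\<^sup>2 else 0)" for i j
  proof -
    have "(?P ** transpose ?P) $ i $ j = (\<Sum>b\<in>UNIV. if b = \<rho> i then (if i \<in> J \<and> j \<in> J \<and> \<rho> i = \<rho> j then s i * s j else 0) else 0)"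
      unfolding matrix_matrix_mult_def transpose_def partial_diagonal_def
      by (simp only: vec_lambda_beta, intro sum.cong) auto
    then show ?thesis using assms by (auto simp: power2_eq_square dest: inj_onD)
  qed
  then have "?P ** transpose ?P = partial_diagonal J (\<lambda>i. i) (\<lambda>i. (s i)\<^sup>2)"
    by (simp add: vec_eq_iff partial_diagonal_def)
  then show ?thesis by (simp add: norm_partial_diagonal)
qed

lemma complete_frame_pair:
  fixes \<iota> \<rho> :: "'k::finite \<Rightarrow> 'd::finite" and a f :: "'k \<Rightarrow> real^'d"
  assumes \<iota>: "inj \<iota>" and \<rho>: "inj_on \<rho> J" "\<rho> ` J \<inter> range \<iota> = {}"
    and aa: "\<And>i j. a i \<bullet> a j = (if i = j then 1 else 0)"
    and af: "\<And>i j. j \<in> J \<Longrightarrow> a i \<bullet> f j = 0"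
    and ff: "\<And>i j. i \<in> J \<Longrightarrow> j \<in> J \<Longrightarrow> f i \<bullet> f j = (if i = j then 1 else 0)"
  obtains R where "orthogonal_matrix R" "\<And>i. R $ \<iota> i = a i" "\<And>i. i \<in> J \<Longrightarrow> R $ \<rho> i = f i"
proof -
  define v where "v b = (if b \<in> range \<iota> then a (inv \<iota> b) else f (inv_into J \<rho> b))" for b
  have v_\<iota>: "v (\<iota> i) = a i" for i using \<iota> by (simp add: v_def)
  have v_\<rho>: "v (\<rho> i) = f i" if "i \<in> J" for i
    using \<rho> that by (auto simp: v_def inv_into_f_f disjoint_iff)
  have fa: "f j \<bullet> a i = 0" if "j \<in> J" for i j using af[OF that] by (simp add: inner_commute)
  have ne: "\<rho> j \<noteq> \<iota> i" "\<iota> i \<noteq> \<rho> j" if "j \<in> J" for i j using \<rho>(2) that by blast+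
  have "v b \<bullet> v c = (if b = c then 1 else 0)" if "b \<in> range \<iota> \<union> \<rho> ` J" "c \<in> range \<iota> \<union> \<rho> ` J" for b c
    using that \<iota> \<rho>(1) by (auto simp: v_\<iota> v_\<rho> aa af fa ff ne inj_eq inj_on_eq_iff)
  then obtain R where "orthogonal_matrix R" "\<And>b. b \<in> range \<iota> \<union> \<rho> ` J \<Longrightarrow> R $ b = v b"
    using complete_orthonormal_rows[of "range \<iota> \<union> \<rho> ` J" v] by blast
  then show ?thesis by (intro that[of R]) (auto simp: v_\<iota> v_\<rho>)
qed

text \<open>
  The orthogonal matrices S and R that diagonalise G are coupled: R must act on the coordinates of the
  frame as S does, and on their complement it diagonalises G. Such pairs are precisely the symmetries in
  frame_invariant_matrix below, so the lemma says that an invariant function of matrices that vanish on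
  the frame coordinates depends only on singular values. J indexes the singular values and \<rho> the
  complementary axes on which they are placed.
\<close>

lemma diagonalize_off_frame:
  fixes \<iota> :: "'k::finite \<Rightarrow> 'd::finite" and G :: "real^'d^'k"
  assumes \<iota>: "inj \<iota>" and \<rho>: "inj_on \<rho> J" "\<rho> ` J \<inter> range \<iota> = {}"
    and J: "card J = min CARD('k) (CARD('d) - CARD('k))"
    and G: "\<And>i b. b \<in> range \<iota> \<Longrightarrow> G $ i $ b = 0"
  obtains s S R where "\<And>i. i \<in> J \<Longrightarrow> 0 \<le> s i" "orthogonal_matrix S" "orthogonal_matrix R"
    "S ** coordinate_frame \<iota> = coordinate_frame \<iota> ** R"
    "S ** G ** transpose R = partial_diagonal J \<rho> s"
proof -
  let ?H = "{y :: real^'d. \<forall>b\<in>range \<iota>. y $ b = 0}"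
  have H: "subspace ?H" by (auto simp: subspace_def)
  have cD: "card (- range \<iota>) = CARD('d) - CARD('k)"
    using \<iota> by (simp add: Compl_eq_Diff_UNIV card_Diff_subset card_image)
  have "dim ?H = card (- range \<iota>)"
  proof -
    have "dim {y :: real^'d. \<forall>i. i \<notin> - range \<iota> \<longrightarrow> y $ i = 0} = card (- range \<iota>)"
      using dim_substandard_cart[of "- range \<iota>", where 'a = real] by (simp only: dim_vec_eq)
    moreover have "?H = {y :: real^'d. \<forall>i. i \<notin> - range \<iota> \<longrightarrow> y $ i = 0}" by auto
    ultimately show ?thesis by simp
  qed
  then have m: "card J = min (dim (UNIV :: (real^'k) set)) (dim ?H)"
    using J cD by (simp add: dim_UNIV)
  obtain e h s where svd: "\<forall>i<card J. e i \<in> UNIV \<and> h i \<in> ?H \<and> 0 \<le> (s i :: real)"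
    "\<forall>i<card J. \<forall>j<card J. e i \<bullet> e j = (if i = j then 1 else 0) \<and> h i \<bullet> h j = (if i = j then 1 else 0)"
    "\<forall>x\<in>UNIV. \<forall>y\<in>?H. (x v* G) \<bullet> y = (\<Sum>i<card J. s i * (e i \<bullet> x) * (h i \<bullet> y))"
    using singular_value_decomposition[OF linear_vector_matrix_mult subspace_UNIV H m, of G]
    by (elim exE conjE) (rule that)
  have e: "h i \<in> ?H" "0 \<le> s i" if "i < card J" for i using svd(1) that by blast+
  have on: "e i \<bullet> e j = (if i = j then 1 else 0)" "h i \<bullet> h j = (if i = j then 1 else 0)"
    if "i < card J" "j < card J" for i j using svd(2) that by blast+
  have dec: "(x v* G) \<bullet> y = (\<Sum>i<card J. s i * (e i \<bullet> x) * (h i \<bullet> y))" if "y \<in> ?H" for x y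
    using svd(3) that by blast
  obtain q where q: "bij_betw q J {..<card J}"
    using ex_bij_betw_finite_nat[of J] by (auto simp: atLeast0LessThan)
  then have q_lt: "q i < card J" if "i \<in> J" for i using that by (auto simp: bij_betw_def)
  have q_eq: "q i = q j \<longleftrightarrow> i = j" if "i \<in> J" "j \<in> J" for i j
    using q that by (auto simp: bij_betw_def inj_on_def)
  have "\<exists>S. orthogonal_matrix S \<and> (\<forall>i\<in>J. S $ i = e (q i))"
    by (rule complete_orthonormal_rows) (simp add: on q_lt q_eq)
  then obtain S where S: "orthogonal_matrix S" "\<And>i. i \<in> J \<Longrightarrow> S $ i = e (q i)" by blast
  have row: "(S ** coordinate_frame \<iota>) $ i $ b = (if b \<in> range \<iota> then S $ i $ inv \<iota> b else 0)" for i b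
  proof -
    have "(S ** coordinate_frame \<iota>) $ i $ b = (\<Sum>j\<in>UNIV. if \<iota> j = b then S $ i $ j else 0)"
      by (simp add: matrix_matrix_mult_def coordinate_frame_def axis_def if_distrib[of "\<lambda>u. _ * u"] eq_commute cong: if_cong)
    also have "\<dots> = (if b \<in> range \<iota> then S $ i $ inv \<iota> b else 0)"
    proof (cases "b \<in> range \<iota>")
      case True
      then obtain j where "b = \<iota> j" by auto
      then show ?thesis using \<iota> by (simp add: inj_eq)
    next
      case False
      then have "\<iota> j \<noteq> b" for j by auto
      then show ?thesis using False by simp
    qed
    finally show ?thesis .
  qed
  have aa: "(S ** coordinate_frame \<iota>) $ i \<bullet> (S ** coordinate_frame \<iota>) $ j = (if i = j then 1 else 0)" for i j
  proof -
    have "(S ** coordinate_frame \<iota>) $ i \<bullet> (S ** coordinate_frame \<iota>) $ j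
        = (\<Sum>b\<in>range \<iota>. S $ i $ inv \<iota> b * S $ j $ inv \<iota> b)"
      unfolding inner_vec_def by (rule sum.mono_neutral_cong_right) (auto simp: row)
    also have "\<dots> = (\<Sum>l\<in>UNIV. S $ i $ l * S $ j $ l)"
      using \<iota> by (subst sum.reindex) simp_all
    also have "\<dots> = S $ i \<bullet> S $ j" by (simp add: inner_vec_def)
    finally show ?thesis using S(1) by (simp add: orthogonal_matrix_iff_rows)
  qed
  have af: "(S ** coordinate_frame \<iota>) $ i \<bullet> h (q j) = 0" if "j \<in> J" for i j
    using e[OF q_lt[OF that]] unfolding inner_vec_def
    by (intro sum.neutral) (auto simp: row)
  have ff: "h (q i) \<bullet> h (q j) = (if i = j then 1 else 0)" if "i \<in> J" "j \<in> J" for i j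
    using that by (simp add: on q_lt q_eq)
  obtain R where R: "orthogonal_matrix R" "\<And>i. R $ \<iota> i = (S ** coordinate_frame \<iota>) $ i"
      "\<And>i. i \<in> J \<Longrightarrow> R $ \<rho> i = h (q i)"
    using complete_frame_pair[OF \<iota> \<rho> aa af ff] by metis
  have "S ** coordinate_frame \<iota> = coordinate_frame \<iota> ** R"
    by (intro iffD2[OF vec_eq_iff]) (simp add: coordinate_frame_mult R)
  moreover have "S ** G ** transpose R = partial_diagonal J \<rho> (s \<circ> q)"
  proof -
    have Gij: "G $ i $ b = (\<Sum>l\<in>J. s (q l) * S $ l $ i * R $ \<rho> l $ b)" for i b
    proof -
      have reidx: "(\<Sum>l<card J. g l) = (\<Sum>l\<in>J. g (q l))" for g :: "nat \<Rightarrow> real"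
        by (rule sum.reindex_bij_betw[OF q, symmetric])
      show ?thesis
      proof (cases "b \<in> range \<iota>")
        case True
        then have "R $ \<rho> l $ b = 0" if "l \<in> J" for l
          using e[OF q_lt[OF that]] that by (auto simp: R)
        then show ?thesis using True by (simp add: G)
      next
        case False
        then have ax: "axis b 1 \<in> ?H" by (auto simp: axis_def)
        have "axis i 1 v* G = G $ i"
          by (simp add: vec_eq_iff vector_matrix_mult_def axis_def if_distrib[of "\<lambda>u. u * _"] cong: if_cong)
        then have "G $ i $ b = (axis i 1 v* G) \<bullet> axis b 1" by (simp add: inner_axis)
        also have "\<dots> = (\<Sum>l<card J. s l * e l $ i * h l $ b)"
          unfolding dec[OF ax] by (simp add: inner_axis)
        also have "\<dots> = (\<Sum>l\<in>J. s (q l) * S $ l $ i * R $ \<rho> l $ b)"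
          unfolding reidx by (intro sum.cong) (auto simp: S R)
        finally show ?thesis .
      qed
    qed
    have "(S ** G ** transpose R) $ i $ b = (\<Sum>l\<in>J. s (q l) * (S $ i \<bullet> S $ l) * (R $ \<rho> l \<bullet> R $ b))" for i b
    proof -
      have "(S ** G ** transpose R) $ i $ b = (\<Sum>b'\<in>UNIV. (\<Sum>i'\<in>UNIV. S $ i $ i' * G $ i' $ b') * R $ b $ b')"
        by (simp add: matrix_matrix_mult_def transpose_def)
      also have "\<dots> = (\<Sum>b'\<in>UNIV. \<Sum>i'\<in>UNIV. \<Sum>l\<in>J. s (q l) * (S $ i $ i' * S $ l $ i') * (R $ \<rho> l $ b' * R $ b $ b'))"
        unfolding Gij by (simp add: sum_distrib_left sum_distrib_right mult_ac)
      also have "\<dots> = (\<Sum>l\<in>J. \<Sum>b'\<in>UNIV. \<Sum>i'\<in>UNIV. s (q l) * (S $ i $ i' * S $ l $ i') * (R $ \<rho> l $ b' * R $ b $ b'))"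
        by (simp add: sum.swap[of _ J])
      also have "\<dots> = (\<Sum>l\<in>J. s (q l) * (S $ i \<bullet> S $ l) * (R $ \<rho> l \<bullet> R $ b))"
        by (simp add: inner_vec_def sum_distrib_left sum_distrib_right mult_ac)
          (rule sum.cong[OF refl], rule sum.swap)
      finally show ?thesis .
    qed
    moreover have "(\<Sum>l\<in>J. s (q l) * (S $ i \<bullet> S $ l) * (R $ \<rho> l \<bullet> R $ b)) = (if i \<in> J \<and> b = \<rho> i then s (q i) else 0)" for i b
    proof -
      have "(\<Sum>l\<in>J. s (q l) * (S $ i \<bullet> S $ l) * (R $ \<rho> l \<bullet> R $ b)) = (\<Sum>l\<in>J. if l = i then (if b = \<rho> i then s (q i) else 0) else 0)"
        using S(1) R(1) by (intro sum.cong) (auto simp: orthogonal_matrix_iff_rows)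
      then show ?thesis by simp
    qed
    ultimately show ?thesis by (simp add: vec_eq_iff partial_diagonal_def)
  qed
  moreover have "0 \<le> (s \<circ> q) i" if "i \<in> J" for i using e[OF q_lt[OF that]] by simp
  ultimately show ?thesis using that S(1) R(1) by blast
qed

definition rotated_frame :: "('k::finite \<Rightarrow> 'd::finite) \<Rightarrow> ('k \<Rightarrow> 'd) \<Rightarrow> ('k \<Rightarrow> real) \<Rightarrow> real^'d^'k" where
  "rotated_frame \<iota> \<rho> \<phi> = (\<chi> i. cos (\<phi> i) *\<^sub>R axis (\<iota> i) 1 + sin (\<phi> i) *\<^sub>R axis (\<rho> i) 1)"

lemma rotated_frame_0: "rotated_frame \<iota> \<rho> (\<lambda>_. 0) = coordinate_frame \<iota>"
  by (simp add: rotated_frame_def coordinate_frame_def)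

text \<open>
  Adding angles is a rotation by \<psi> i in each of the planes spanned by the axes \<iota> i and \<rho> i. All steps of
  the path of frames are therefore congruent.
\<close>

lemma rotated_frame_rotate:
  fixes \<iota> \<rho> :: "'k::finite \<Rightarrow> 'd::finite"
  assumes \<iota>: "inj \<iota>" and \<rho>: "inj_on \<rho> J" "\<rho> ` J \<inter> range \<iota> = {}"
    and \<psi>: "\<And>i. i \<notin> J \<Longrightarrow> \<psi> i = 0"
  obtains R where "orthogonal_matrix R"
    "\<And>\<phi>. (\<And>i. i \<notin> J \<Longrightarrow> \<phi> i = 0) \<Longrightarrow> rotated_frame \<iota> \<rho> \<phi> ** R = rotated_frame \<iota> \<rho> (\<lambda>i. \<phi> i + \<psi> i)"
proof -
  let ?a = "\<lambda>i. cos (\<psi> i) *\<^sub>R axis (\<iota> i) 1 + sin (\<psi> i) *\<^sub>R axis (\<rho> i) 1 :: real^'d"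
  let ?f = "\<lambda>i. cos (\<psi> i) *\<^sub>R axis (\<rho> i) 1 - sin (\<psi> i) *\<^sub>R axis (\<iota> i) 1 :: real^'d"
  have ne: "\<rho> j \<noteq> \<iota> i" "\<iota> i \<noteq> \<rho> j" if "j \<in> J" for i j using \<rho>(2) that by blast+
  have s: "sin (\<psi> i) = 0" "cos (\<psi> i) = 1" if "i \<notin> J" for i using \<psi>[OF that] by auto
  have aa: "?a i \<bullet> ?a j = (if i = j then 1 else 0)" for i j
    using \<iota> \<rho>(1) ne s sin_cos_squared_add3[of "\<psi> i"]
    by (cases "i \<in> J"; cases "j \<in> J")
       (auto simp: inner_add_left inner_add_right inner_axis_axis inj_eq inj_on_eq_iff power2_eq_square)
  have af: "?a i \<bullet> ?f j = 0" if "j \<in> J" for i j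
    using \<iota> \<rho>(1) ne s that
    by (cases "i \<in> J") (auto simp: inner_add_left inner_diff_right inner_axis_axis inj_eq inj_on_eq_iff)
  have ff: "?f i \<bullet> ?f j = (if i = j then 1 else 0)" if "i \<in> J" "j \<in> J" for i j
    using \<iota> \<rho>(1) ne that sin_cos_squared_add3[of "\<psi> i"]
    by (auto simp: inner_diff_left inner_diff_right inner_axis_axis inj_eq inj_on_eq_iff power2_eq_square)
  obtain R where R: "orthogonal_matrix R" "\<And>i. R $ \<iota> i = ?a i" "\<And>i. i \<in> J \<Longrightarrow> R $ \<rho> i = ?f i"
    using complete_frame_pair[OF \<iota> \<rho> aa af ff] by metis
  have axR: "axis b 1 v* R = R $ b" for b
    by (simp add: vec_eq_iff vector_matrix_mult_def axis_def if_distrib[of "\<lambda>u. u * _"] cong: if_cong)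
  have "rotated_frame \<iota> \<rho> \<phi> ** R = rotated_frame \<iota> \<rho> (\<lambda>i. \<phi> i + \<psi> i)" if \<phi>: "\<And>i. i \<notin> J \<Longrightarrow> \<phi> i = 0" for \<phi>
  proof (rule iffD2[OF vec_eq_iff], rule allI)
    fix i
    have "(rotated_frame \<iota> \<rho> \<phi> ** R) $ i = cos (\<phi> i) *\<^sub>R R $ \<iota> i + sin (\<phi> i) *\<^sub>R R $ \<rho> i"
      by (simp add: matrix_mult_row rotated_frame_def linear_add[OF linear_vector_matrix_mult]
          linear_scale[OF linear_vector_matrix_mult] axR)
    also have "\<dots> = rotated_frame \<iota> \<rho> (\<lambda>i. \<phi> i + \<psi> i) $ i"
    proof (cases "i \<in> J")
      case True
      then show ?thesis by (simp add: R rotated_frame_def cos_add sin_add algebra_simps)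
    next
      case False
      then show ?thesis using \<phi>[OF False] by (simp add: R rotated_frame_def)
    qed
    finally show "(rotated_frame \<iota> \<rho> \<phi> ** R) $ i = rotated_frame \<iota> \<rho> (\<lambda>i. \<phi> i + \<psi> i) $ i" .
  qed
  with R(1) show ?thesis by (rule that)
qed

lemma orthonormal_family_card_le:
  fixes u :: "'i \<Rightarrow> 'a::euclidean_space"
  assumes "finite I" "\<And>a b. a \<in> I \<Longrightarrow> b \<in> I \<Longrightarrow> u a \<bullet> u b = (if a = b then 1 else 0)"
  shows "card I \<le> DIM('a)"
proof -
  have "inj_on u I" using assms(2) by (intro inj_onI) (metis zero_neq_one)
  have "u a \<noteq> 0" if "a \<in> I" for a using assms(2)[OF that that] by auto
  then have "independent (u ` I)"
    using assms by (intro pairwise_orthogonal_independent) (auto simp: pairwise_def orthogonal_def)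
  then have "card (u ` I) \<le> DIM('a)" using independent_bound by blast
  then show ?thesis using \<open>inj_on u I\<close> by (simp add: card_image)
qed

lemma stiefel_mult_left:
  assumes "orthogonal_matrix S" "\<theta> \<in> stiefel"
  shows "S ** \<theta> \<in> stiefel"
proof -
  have *: "\<theta> ** transpose \<theta> = mat 1 \<longleftrightarrow> \<theta> \<in> stiefel" for \<theta> :: "real^'d^'k"
    by (simp add: matrix_mult_transpose_dot_row vec_eq_iff mat_def row_def stiefel_def)
  have "(S ** \<theta>) ** transpose (S ** \<theta>) = S ** (\<theta> ** transpose \<theta>) ** transpose S"
    by (simp add: matrix_transpose_mul matrix_mul_assoc)
  also have "\<dots> = mat 1" using assms *[of \<theta>] by (simp add: orthogonal_matrix_def)
  finally show ?thesis using * by blast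
qed

text \<open>
  The matrices S0 and S1 choose the principal vectors in the two spans. The bound on the number of nonzero angles holds because the principal
  vectors of the first frame and the directions in which they move are orthonormal together.
\<close>

lemma principal_angles:
  fixes \<iota> :: "'k::finite \<Rightarrow> 'd::finite" and \<theta>0 \<theta>1 :: "real^'d^'k"
  assumes \<iota>: "inj \<iota>" and \<theta>: "\<theta>0 \<in> stiefel" "\<theta>1 \<in> stiefel"
  obtains S0 S1 R J \<rho> \<phi> where "orthogonal_matrix S0" "orthogonal_matrix S1" "orthogonal_matrix R"
    "inj_on \<rho> J" "\<rho> ` J \<inter> range \<iota> = {}" "card J = min CARD('k) (CARD('d) - CARD('k))"
    "\<And>i. 0 \<le> \<phi> i" "\<And>i. \<phi> i \<le> pi / 2" "\<And>i. i \<notin> J \<Longrightarrow> \<phi> i = 0"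
    "S0 ** \<theta>0 ** R = coordinate_frame \<iota>" "S1 ** \<theta>1 ** R = rotated_frame \<iota> \<rho> \<phi>"
proof -
  let ?k = "CARD('k)"
  have k: "?k = min (dim (UNIV :: (real^'k) set)) (dim (UNIV :: (real^'k) set))"
    by (simp add: dim_UNIV)
  obtain e h s where svd: "\<forall>i<?k. e i \<in> UNIV \<and> h i \<in> UNIV \<and> 0 \<le> (s i :: real)"
    "\<forall>i<?k. \<forall>j<?k. e i \<bullet> e j = (if i = j then 1 else 0) \<and> h i \<bullet> h j = (if i = j then 1 else 0)"
    "\<forall>x\<in>UNIV. \<forall>y\<in>UNIV. (x v* (\<theta>0 ** transpose \<theta>1)) \<bullet> y = (\<Sum>i<?k. s i * (e i \<bullet> x) * (h i \<bullet> y))"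
    using singular_value_decomposition[OF linear_vector_matrix_mult subspace_UNIV subspace_UNIV k, of "\<theta>0 ** transpose \<theta>1"]
    by (elim exE conjE) (rule that)
  obtain q :: "'k \<Rightarrow> nat" where q: "bij_betw q UNIV {..<?k}"
    using ex_bij_betw_finite_nat[of "UNIV :: 'k set"] by (auto simp: atLeast0LessThan)
  then have q_lt: "q i < ?k" for i by (auto simp: bij_betw_def)
  have q_eq: "q i = q j \<longleftrightarrow> i = j" for i j
    using q by (auto simp: bij_betw_def inj_eq)
  define S0 :: "real^'k^'k" where "S0 = (\<chi> i. e (q i))"
  define S1 :: "real^'k^'k" where "S1 = (\<chi> i. h (q i))"
  define \<sigma> where "\<sigma> i = s (q i)" for i
  have S: "orthogonal_matrix S0" "orthogonal_matrix S1"
    using svd(2) q_lt q_eq by (simp_all add: orthogonal_matrix_iff_rows S0_def S1_def)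
  define a where "a = S0 ** \<theta>0"
  define b where "b = S1 ** \<theta>1"
  have aS: "a $ i \<bullet> a $ j = (if i = j then 1 else 0)" and bS: "b $ i \<bullet> b $ j = (if i = j then 1 else 0)" for i j
    using stiefel_mult_left[OF S(1) \<theta>(1)] stiefel_mult_left[OF S(2) \<theta>(2)]
    by (auto simp: a_def b_def stiefel_def)
  have ab: "a $ i \<bullet> b $ j = (if i = j then \<sigma> i else 0)" for i j
  proof -
    have "a $ i \<bullet> b $ j = (e (q i) v* \<theta>0) \<bullet> (h (q j) v* \<theta>1)"
      by (simp add: a_def b_def matrix_mult_row S0_def S1_def)
    also have "\<dots> = (e (q i) v* (\<theta>0 ** transpose \<theta>1)) \<bullet> h (q j)"
      by (simp only: inner_vector_matrix_mult vector_matrix_mul_assoc)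
    also have "\<dots> = (\<Sum>l<?k. s l * (e l \<bullet> e (q i)) * (h l \<bullet> h (q j)))"
      using svd(3) by blast
    also have "\<dots> = (\<Sum>l<?k. if l = q i then (if i = j then \<sigma> i else 0) else 0)"
      using svd(2) q_lt q_eq by (intro sum.cong) (auto simp: \<sigma>_def)
    also have "\<dots> = (if i = j then \<sigma> i else 0)" using q_lt by simp
    finally show ?thesis .
  qed
  then have ba: "b $ i \<bullet> a $ j = (if i = j then \<sigma> i else 0)" for i j
    using ab[of j i] by (auto simp: inner_commute)
  have \<sigma>0: "0 \<le> \<sigma> i" for i using svd(1) q_lt by (simp add: \<sigma>_def)
  have n1: "norm (a $ i) = 1" "norm (b $ i) = 1" for i
    using aS[of i i] bS[of i i] by (simp_all add: norm_eq_1)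
  have \<sigma>1: "\<sigma> i \<le> 1" for i
    using norm_cauchy_schwarz[of "a $ i" "b $ i"] by (simp add: ab n1)
  define \<phi> where "\<phi> i = arccos (\<sigma> i)" for i
  have \<phi>: "0 \<le> \<phi> i" "\<phi> i \<le> pi / 2" "cos (\<phi> i) = \<sigma> i" for i
    using \<sigma>0[of i] \<sigma>1[of i] arccos_le_pi2[OF \<sigma>0[of i] \<sigma>1[of i]] by (auto simp: \<phi>_def arccos_lbound cos_arccos)
  define J0 where "J0 = {i. \<phi> i \<noteq> 0}"
  have sin: "sin (\<phi> i) > 0" if "i \<in> J0" for i
    using \<phi>[of i] that pi_half_less_two by (intro sin_gt_zero) (auto simp: J0_def less_le)
  have sc: "sin (\<phi> i) * sin (\<phi> i) = 1 - \<sigma> i * \<sigma> i" for i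
    using sin_cos_squared_add3[of "\<phi> i"] \<phi>(3)[of i] by (simp add: algebra_simps)
  define f where "f i = (b $ i - \<sigma> i *\<^sub>R a $ i) /\<^sub>R sin (\<phi> i)" for i
  have af: "a $ i \<bullet> f j = 0" for i j
    by (simp add: f_def inner_diff_right ab aS)
  have ff: "f i \<bullet> f j = (if i = j then 1 else 0)" if "i \<in> J0" "j \<in> J0" for i j
  proof -
    have "(b $ i - \<sigma> i *\<^sub>R a $ i) \<bullet> (b $ j - \<sigma> j *\<^sub>R a $ j) = (if i = j then 1 - \<sigma> i * \<sigma> i else 0)"
      by (simp add: inner_diff_left inner_diff_right ab ba aS bS)
    moreover have "inverse (sin (\<phi> j)) * (inverse (sin (\<phi> j)) * (sin (\<phi> j) * sin (\<phi> j))) = 1"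
      using sin[OF that(2)] by (simp add: field_simps)
    ultimately show ?thesis
      by (simp add: f_def sc[symmetric])
  qed
  have "card ((UNIV :: 'k set) <+> J0) \<le> DIM(real^'d)"
    by (rule orthonormal_family_card_le[where u = "\<lambda>z. case z of Inl i \<Rightarrow> a $ i | Inr i \<Rightarrow> f i"])
       (auto simp: aS af ff inner_commute[of "f _" "a $ _"] split: if_splits)
  then have "card J0 \<le> min ?k (CARD('d) - ?k)"
    by (simp add: card_Plus card_mono)
  then obtain J where J: "J0 \<subseteq> J" "card J = min ?k (CARD('d) - ?k)"
    using exists_subset_between[of J0 "min ?k (CARD('d) - ?k)" "UNIV :: 'k set"] by auto
  have "card (- range \<iota>) = CARD('d) - ?k"
    using \<iota> by (simp add: Compl_eq_Diff_UNIV card_Diff_subset card_image)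
  then have "card J \<le> card (- range \<iota>)" using J(2) by simp
  then obtain \<rho> where \<rho>: "\<rho> ` J \<subseteq> - range \<iota>" "inj_on \<rho> J"
    using card_le_inj[of J "- range \<iota>"] by auto
  have \<rho>0: "inj_on \<rho> J0" "\<rho> ` J0 \<inter> range \<iota> = {}" using \<rho> J(1) by (auto intro: inj_on_subset)
  obtain R where R: "orthogonal_matrix R" "\<And>i. R $ \<iota> i = a $ i" "\<And>i. i \<in> J0 \<Longrightarrow> R $ \<rho> i = f i"
    by (rule complete_frame_pair[OF \<iota> \<rho>0, where a = "\<lambda>i. a $ i" and f = f],
        rule aS, rule af, rule ff, assumption, assumption, rule that)
  have row: "R $ c v* transpose R = axis c 1" for c
  proof -
    have "axis c 1 v* R = R $ c"
      by (simp add: vec_eq_iff vector_matrix_mult_def axis_def if_distrib[of "\<lambda>u. u * _"] cong: if_cong)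
    then have "R $ c v* transpose R = axis c 1 v* (R ** transpose R)"
      by (metis vector_matrix_mul_assoc)
    then show ?thesis using R(1) by (simp add: orthogonal_matrix_def)
  qed
  have "S0 ** \<theta>0 ** transpose R = coordinate_frame \<iota>"
    unfolding a_def[symmetric]
    by (rule iffD2[OF vec_eq_iff]) (simp add: matrix_mult_row coordinate_frame_def R(2)[symmetric] row del: vector_transpose_matrix)
  moreover have "S1 ** \<theta>1 ** transpose R = rotated_frame \<iota> \<rho> \<phi>"
    unfolding b_def[symmetric]
  proof (rule iffD2[OF vec_eq_iff], rule allI)
    fix i
    have "b $ i = \<sigma> i *\<^sub>R R $ \<iota> i + sin (\<phi> i) *\<^sub>R R $ \<rho> i"
    proof (cases "i \<in> J0")
      case True
      then show ?thesis using sin[OF True] by (simp add: R f_def)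
    next
      case False
      then have "\<phi> i = 0" by (simp add: J0_def)
      moreover from this have "\<sigma> i = 1" using \<phi>(3)[of i] by simp
      moreover have "b $ i = a $ i"
      proof -
        have "(b $ i - a $ i) \<bullet> (b $ i - a $ i) = 0"
          using \<open>\<sigma> i = 1\<close> by (simp add: inner_diff_left inner_diff_right ab ba aS bS)
        then show ?thesis by simp
      qed
      ultimately show ?thesis by (simp add: R)
    qed
    then show "(b ** transpose R) $ i = rotated_frame \<iota> \<rho> \<phi> $ i"
      by (simp add: matrix_mult_row rotated_frame_def linear_add[OF linear_vector_matrix_mult]
          linear_scale[OF linear_vector_matrix_mult] row \<phi>(3) del: vector_transpose_matrix)
  qed
  moreover have "\<phi> i = 0" if "i \<notin> J" for i using J(1) that by (auto simp: J0_def)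
  moreover have "\<rho> ` J \<inter> range \<iota> = {}" using \<rho>(1) by blast
  ultimately show ?thesis
    using S R(1) \<rho>(2) J(2) \<phi>(1,2) by (intro that[of S0 S1 "transpose R" \<rho> J \<phi>]) auto
qed

section \<open>Exponential moments of matrices with a rotation invariant law\<close>

text \<open>
  A random k by d matrix whose law is invariant under the pairs (S, R) that fix the standard frame. The index
  set J and the injection \<rho> name a full set of diagonal positions off the frame.
\<close>

locale frame_invariant_matrix = prob_space \<nu> for \<nu> :: "(real^'d::finite^'k::finite) measure" +
  fixes \<iota> :: "'k \<Rightarrow> 'd" and J :: "'k set" and \<rho> :: "'k \<Rightarrow> 'd" and r :: real
  assumes \<iota>: "inj \<iota>" and \<rho>: "inj_on \<rho> J" "\<rho> ` J \<inter> range \<iota> = {}"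
    and J: "card J = min CARD('k) (CARD('d) - CARD('k))"
    and sets_eq [measurable_cong]: "sets \<nu> = sets borel"
    and bound: "AE Y in \<nu>. norm Y \<le> r"
    and invariant: "\<And>S R. orthogonal_matrix S \<Longrightarrow> orthogonal_matrix R \<Longrightarrow>
        S ** coordinate_frame \<iota> = coordinate_frame \<iota> ** R \<Longrightarrow>
        distr \<nu> borel (\<lambda>Y. transpose S ** Y ** R) = \<nu>"
begin

lemma integral_invariant:
  fixes g :: "real^'d^'k \<Rightarrow> real"
  assumes "orthogonal_matrix S" "orthogonal_matrix R"
    "S ** coordinate_frame \<iota> = coordinate_frame \<iota> ** R" and [measurable]: "g \<in> borel_measurable borel"
  shows "(\<integral>Y. g (transpose S ** Y ** R) \<partial>\<nu>) = (\<integral>Y. g Y \<partial>\<nu>)"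
proof -
  have "(\<integral>Y. g Y \<partial>\<nu>) = (\<integral>Y. g Y \<partial>distr \<nu> borel (\<lambda>Y. transpose S ** Y ** R))"
    by (simp add: invariant assms)
  also have "\<dots> = (\<integral>Y. g (transpose S ** Y ** R) \<partial>\<nu>)"
    by (subst integral_distr) simp_all
  finally show ?thesis by simp
qed

definition entry_sum :: "('k \<Rightarrow> real) \<Rightarrow> real^'d^'k \<Rightarrow> real" where
  "entry_sum a Y = (\<Sum>i\<in>J. a i * Y $ i $ \<rho> i)"

lemma entry_sum_measurable [measurable]: "entry_sum a \<in> borel_measurable borel"
  unfolding entry_sum_def by measurable

lemma entry_sum_bound: "norm Y \<le> r \<Longrightarrow> \<bar>entry_sum a Y\<bar> \<le> (\<Sum>i\<in>J. \<bar>a i\<bar> * r)"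
  unfolding entry_sum_def
  by (rule order_trans[OF sum_abs], rule sum_mono)
     (auto simp: abs_mult intro!: mult_left_mono order_trans[OF abs_matrix_entry_le_norm])

lemma integrable_exp_entry_sum: "integrable \<nu> (\<lambda>Y. exp (entry_sum a Y))"
proof (rule integrable_const_bound)
  show "AE Y in \<nu>. norm (exp (entry_sum a Y)) \<le> exp (\<Sum>i\<in>J. \<bar>a i\<bar> * r)"
    using bound by eventually_elim (use entry_sum_bound[of _ a] in \<open>force simp: abs_le_iff\<close>)
qed simp

lemma integrable_entry_exp: "integrable \<nu> (\<lambda>Y. Y $ i $ b * exp (entry_sum a Y))"
proof (rule integrable_const_bound)
  show "AE Y in \<nu>. norm (Y $ i $ b * exp (entry_sum a Y)) \<le> r * exp (\<Sum>i\<in>J. \<bar>a i\<bar> * r)"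
    using bound
  proof eventually_elim
    case (elim Y)
    have "\<bar>Y $ i $ b\<bar> \<le> r" using abs_matrix_entry_le_norm[of Y i b] elim by linarith
    moreover have "exp (entry_sum a Y) \<le> exp (\<Sum>i\<in>J. \<bar>a i\<bar> * r)"
      using entry_sum_bound[OF elim, of a] by (simp add: abs_le_iff)
    ultimately show ?case by (auto simp: abs_mult intro!: mult_mono)
  qed
qed simp

definition mgf :: "('k \<Rightarrow> real) \<Rightarrow> real" where
  "mgf a = (\<integral>Y. exp (entry_sum a Y) \<partial>\<nu>)"

definition mgf_deriv :: "('k \<Rightarrow> real) \<Rightarrow> 'k \<Rightarrow> real" where
  "mgf_deriv a i = (\<integral>Y. Y $ i $ \<rho> i * exp (entry_sum a Y) \<partial>\<nu>)"

text \<open>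
  Convexity, from exp v \<ge> exp u (1 + v - u) under the integral.
\<close>

lemma mgf_tangent: "mgf a + (\<Sum>i\<in>J. (b i - a i) * mgf_deriv a i) \<le> mgf b"
proof -
  have "mgf a + (\<Sum>i\<in>J. (b i - a i) * mgf_deriv a i)
      = (\<integral>Y. exp (entry_sum a Y) + (\<Sum>i\<in>J. (b i - a i) * (Y $ i $ \<rho> i * exp (entry_sum a Y))) \<partial>\<nu>)"
    unfolding mgf_def mgf_deriv_def
    by (subst Bochner_Integration.integral_add, auto intro!: integrable_exp_entry_sum integrable_entry_exp)
       (subst Bochner_Integration.integral_sum, auto intro!: integrable_entry_exp)
  also have "\<dots> \<le> mgf b"
    unfolding mgf_def
  proof (rule integral_mono)
    fix Y
    have "exp (entry_sum a Y) + (\<Sum>i\<in>J. (b i - a i) * (Y $ i $ \<rho> i * exp (entry_sum a Y))) = exp (entry_sum a Y) * (1 + (entry_sum b Y - entry_sum a Y))"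
      unfolding entry_sum_def sum_subtractf[symmetric]
      by (simp add: sum_distrib_left sum_distrib_right algebra_simps)
    also have "\<dots> \<le> exp (entry_sum a Y) * exp (entry_sum b Y - entry_sum a Y)"
      by (intro mult_left_mono exp_ge_add_one_self) simp
    also have "\<dots> = exp (entry_sum b Y)" by (simp add: exp_diff)
    finally show "exp (entry_sum a Y) + (\<Sum>i\<in>J. (b i - a i) * (Y $ i $ \<rho> i * exp (entry_sum a Y))) \<le> exp (entry_sum b Y)" .
  qed (auto intro!: integrable_exp_entry_sum integrable_entry_exp Bochner_Integration.integrable_add
      Bochner_Integration.integrable_sum)
  finally show ?thesis .
qed

text \<open>
  Reversing the sign of the axis \<rho> i is a symmetry that reverses only the entry at (i, \<rho> i). Averaging
  over it turns the integrand into y (exp (a y) - exp (- a y)) times a positive factor.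
\<close>

lemma mgf_deriv_nonneg:
  assumes i: "i \<in> J" and a: "a i \<ge> 0"
  shows "0 \<le> mgf_deriv a i"
proof -
  define R :: "real^'d^'d" where "R = (\<chi> b. if b = \<rho> i then - axis b 1 else axis b 1)"
  have R: "orthogonal_matrix R"
    by (auto simp: orthogonal_matrix_iff_rows R_def inner_axis_axis)
  have "\<iota> l \<noteq> \<rho> i" for l using \<rho>(2) i by blast
  then have "(coordinate_frame \<iota> ** R) $ l = coordinate_frame \<iota> $ l" for l
    by (simp add: coordinate_frame_mult) (simp add: R_def coordinate_frame_def)
  then have "mat 1 ** coordinate_frame \<iota> = coordinate_frame \<iota> ** R"
    unfolding matrix_mul_lid by (intro iffD2[OF vec_eq_iff]) simp
  note inv = integral_invariant[OF orthogonal_matrix_id R this]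
  have YR: "(Y ** R) $ j $ b = (if b = \<rho> i then - Y $ j $ b else Y $ j $ b)" for Y :: "real^'d^'k" and j b
  proof -
    have "(Y ** R) $ j $ b = (\<Sum>c\<in>UNIV. if c = b then (if b = \<rho> i then - Y $ j $ b else Y $ j $ b) else 0)"
      by (simp only: matrix_matrix_mult_def vec_lambda_beta, intro sum.cong) (auto simp: R_def axis_def)
    then show ?thesis by simp
  qed
  have ZR: "entry_sum a (Y ** R) = entry_sum a Y - 2 * (a i * Y $ i $ \<rho> i)" for Y
  proof -
    have "entry_sum a (Y ** R) = (\<Sum>j\<in>J. a j * Y $ j $ \<rho> j - (if j = i then 2 * (a i * Y $ i $ \<rho> i) else 0))"
      unfolding entry_sum_def YR using \<rho>(1) i by (intro sum.cong) (auto simp: inj_on_eq_iff)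
    then show ?thesis using i by (simp add: sum_subtractf entry_sum_def)
  qed
  have "mgf_deriv a i = (\<integral>Y. (Y ** R) $ i $ \<rho> i * exp (entry_sum a (Y ** R)) \<partial>\<nu>)"
    unfolding mgf_deriv_def using inv[of "\<lambda>Y. Y $ i $ \<rho> i * exp (entry_sum a Y)"] by simp
  then have "2 * mgf_deriv a i = (\<integral>Y. Y $ i $ \<rho> i * exp (entry_sum a Y) \<partial>\<nu>) + (\<integral>Y. (Y ** R) $ i $ \<rho> i * exp (entry_sum a (Y ** R)) \<partial>\<nu>)"
    by (simp add: mgf_deriv_def)
  also have "\<dots> = (\<integral>Y. Y $ i $ \<rho> i * exp (entry_sum a Y) + (Y ** R) $ i $ \<rho> i * exp (entry_sum a (Y ** R)) \<partial>\<nu>)"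
  proof (rule Bochner_Integration.integral_add[symmetric])
    have "integrable \<nu> (\<lambda>Y. - (Y $ i $ \<rho> i * exp (entry_sum (\<lambda>j. if j = i then - a j else a j) Y)))"
      by (intro integrable_minus integrable_entry_exp)
    moreover have "entry_sum (\<lambda>j. if j = i then - a j else a j) Y = entry_sum a (Y ** R)" for Y
    proof -
      have "entry_sum (\<lambda>j. if j = i then - a j else a j) Y = (\<Sum>j\<in>J. a j * Y $ j $ \<rho> j - (if j = i then 2 * (a i * Y $ i $ \<rho> i) else 0))"
        unfolding entry_sum_def by (intro sum.cong) auto
      then show ?thesis using i by (simp add: sum_subtractf ZR) (simp add: entry_sum_def)
    qed
    ultimately show "integrable \<nu> (\<lambda>Y. (Y ** R) $ i $ \<rho> i * exp (entry_sum a (Y ** R)))"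
      by (simp add: YR)
  qed (rule integrable_entry_exp)
  also have "\<dots> \<ge> 0"
  proof (rule integral_nonneg_AE, rule AE_I2)
    fix Y :: "real^'d^'k"
    have "0 \<le> Y $ i $ \<rho> i * (exp (entry_sum a Y) - exp (entry_sum a (Y ** R)))"
    proof (cases "Y $ i $ \<rho> i \<ge> 0")
      case True
      then have "exp (entry_sum a (Y ** R)) \<le> exp (entry_sum a Y)" using a by (simp add: ZR)
      then show ?thesis using True by simp
    next
      case False
      then have "a i * Y $ i $ \<rho> i \<le> 0" using a by (simp add: mult_nonneg_nonpos)
      then have "exp (entry_sum a Y) \<le> exp (entry_sum a (Y ** R))" by (simp add: ZR)
      then show ?thesis using False by (simp add: mult_nonpos_nonpos)
    qed
    then show "0 \<le> Y $ i $ \<rho> i * exp (entry_sum a Y) + (Y ** R) $ i $ \<rho> i * exp (entry_sum a (Y ** R))"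
      by (simp add: YR algebra_simps)
  qed
  finally show ?thesis by simp
qed

text \<open>
  Exchanging i with j, together with the corresponding frame and complementary axes, is a symmetry that
  fixes the constant vector x.
\<close>

lemma mgf_deriv_swap:
  assumes ij: "i \<in> J" "j \<in> J"
  shows "mgf_deriv (\<lambda>_. x) i = mgf_deriv (\<lambda>_. x) j"
proof -
  define \<sigma> where "\<sigma> = Transposition.transpose i j"
  define \<tau> where "\<tau> = Transposition.transpose (\<iota> i) (\<iota> j) \<circ> Transposition.transpose (\<rho> i) (\<rho> j)"
  have ne: "\<rho> i \<notin> range \<iota>" "\<rho> j \<notin> range \<iota>" using \<rho>(2) ij by auto
  then have ne': "\<rho> i \<noteq> \<iota> l" "\<rho> j \<noteq> \<iota> l" "\<iota> l \<noteq> \<rho> i" "\<iota> l \<noteq> \<rho> j" for l by (metis rangeI)+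
  have \<tau>\<iota>: "\<tau> (\<iota> l) = \<iota> (\<sigma> l)" for l
    using ne' \<iota> by (auto simp: \<tau>_def \<sigma>_def Transposition.transpose_def inj_eq)
  have \<tau>\<rho>: "\<tau> (\<rho> l) = \<rho> (\<sigma> l)" if "l \<in> J" for l
  proof -
    have "\<rho> l \<noteq> \<iota> i" "\<rho> l \<noteq> \<iota> j" using that \<rho>(2) by blast+
    then show ?thesis
      using ne' that ij \<rho>(1) by (auto simp: \<tau>_def \<sigma>_def Transposition.transpose_def inj_on_eq_iff)
  qed
  have \<tau>\<tau>: "\<tau> (\<tau> b) = b" for b
    using ne' by (auto simp: \<tau>_def Transposition.transpose_def)
  have \<sigma>\<sigma>: "\<sigma> (\<sigma> l) = l" for l by (simp add: \<sigma>_def)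
  have \<sigma>J: "\<sigma> l \<in> J \<longleftrightarrow> l \<in> J" for l using ij by (auto simp: \<sigma>_def Transposition.transpose_def)
  define S :: "real^'k^'k" where "S = (\<chi> l. axis (\<sigma> l) 1)"
  define R :: "real^'d^'d" where "R = (\<chi> b. axis (\<tau> b) 1)"
  have inj: "inj \<sigma>" "inj \<tau>" by (metis injI \<sigma>\<sigma>, metis injI \<tau>\<tau>)
  have S: "orthogonal_matrix S" and R: "orthogonal_matrix R"
    using inj by (auto simp: orthogonal_matrix_iff_rows S_def R_def inner_axis_axis inj_eq)
  have frame: "S ** coordinate_frame \<iota> = coordinate_frame \<iota> ** R"
  proof -
    have "(S ** coordinate_frame \<iota>) $ l = coordinate_frame \<iota> $ \<sigma> l" for l
      by (simp add: matrix_mult_row S_def vec_eq_iff vector_matrix_mult_def axis_def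
          if_distrib[of "\<lambda>u. u * _"] cong: if_cong)
    moreover have "(coordinate_frame \<iota> ** R) $ l = coordinate_frame \<iota> $ \<sigma> l" for l
      unfolding coordinate_frame_mult by (simp add: R_def coordinate_frame_def \<tau>\<iota>)
    ultimately show ?thesis by (intro iffD2[OF vec_eq_iff]) simp
  qed
  have YR: "(transpose S ** Y ** R) $ l $ b = Y $ \<sigma> l $ \<tau> b" for Y :: "real^'d^'k" and l b
  proof -
    have "(transpose S ** Y) $ l $ c = (\<Sum>m\<in>UNIV. if m = \<sigma> l then Y $ \<sigma> l $ c else 0)" for c
      using \<sigma>\<sigma> by (simp only: matrix_matrix_mult_def transpose_def vec_lambda_beta, intro sum.cong)
        (auto simp: S_def axis_def)
    moreover have "(A ** R) $ l $ b = (\<Sum>c\<in>UNIV. if c = \<tau> b then A $ l $ \<tau> b else 0)" for A :: "real^'d^'k"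
      using \<tau>\<tau> by (simp only: matrix_matrix_mult_def vec_lambda_beta, intro sum.cong)
        (auto simp: R_def axis_def)
    ultimately show ?thesis by simp
  qed
  have Zinv: "entry_sum (\<lambda>_. x) (transpose S ** Y ** R) = entry_sum (\<lambda>_. x) Y" for Y
    unfolding entry_sum_def YR
    by (rule sum.reindex_bij_witness[of _ \<sigma> \<sigma>]) (auto simp: \<sigma>\<sigma> \<sigma>J \<tau>\<rho>)
  have "\<sigma> i = j" by (simp add: \<sigma>_def)
  then have "mgf_deriv (\<lambda>_. x) j = (\<integral>Y. (transpose S ** Y ** R) $ i $ \<rho> i * exp (entry_sum (\<lambda>_. x) (transpose S ** Y ** R)) \<partial>\<nu>)"
    unfolding mgf_deriv_def Zinv YR using \<tau>\<rho>[OF ij(1)] by simp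
  also have "\<dots> = mgf_deriv (\<lambda>_. x) i"
    unfolding mgf_deriv_def by (rule integral_invariant[OF S R frame, of "\<lambda>Y. Y $ i $ \<rho> i * exp (entry_sum (\<lambda>_. x) Y)"]) simp
  finally show ?thesis by simp
qed

text \<open>
  By invariance G may be diagonalised, with singular values s. The tangent at the constant vector x has all its slopes
  equal, so only the sum of the s i enters, and this is bounded below by the second and fourth moments,
  which are polynomials in G.
\<close>

lemma sign_matrix_mgf_lower_bound:
  fixes \<epsilon> :: "'k \<times> 'd \<Rightarrow> bool"
  assumes "\<tau> \<ge> 0" "\<alpha> > 0" and i0: "i0 \<in> J" and x: "x \<ge> 0"
  defines "G \<equiv> sign_matrix (- range \<iota>) \<epsilon> :: real^'d^'k"
  shows "mgf (\<lambda>_. x) + mgf_deriv (\<lambda>_. x) i0 * (\<tau> * (3 / (2 * \<alpha>) * (norm G)\<^sup>2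
      - (norm (G ** transpose G))\<^sup>2 / (2 * \<alpha> ^ 3)) - real (card J) * x)
    \<le> (\<integral>Y. exp (\<tau> * (G \<bullet> Y)) \<partial>\<nu>)"
proof -
  have Gz: "G $ i $ b = 0" if "b \<in> range \<iota>" for i b
    using that by (simp add: G_def sign_matrix_def)
  obtain s S R where s: "\<And>i. i \<in> J \<Longrightarrow> 0 \<le> s i"
    and S: "orthogonal_matrix S" and R: "orthogonal_matrix R"
    and frame: "S ** coordinate_frame \<iota> = coordinate_frame \<iota> ** R"
    and G: "S ** G ** transpose R = partial_diagonal J \<rho> s"
    by (rule diagonalize_off_frame[OF \<iota> \<rho> J Gz], assumption, rule that)
  have nG: "(norm G)\<^sup>2 = (\<Sum>i\<in>J. (s i)\<^sup>2)"
    unfolding norm_partial_diagonal[symmetric, of s J \<rho>] G[symmetric]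
    by (simp add: norm_mult_orthogonal_left norm_mult_orthogonal_right S R)
  have "S ** G ** transpose R ** transpose (S ** G ** transpose R) = S ** (G ** transpose G) ** transpose S"
    by (simp add: matrix_transpose_mul matrix_mul_assoc orthogonal_matrix_cancel R)
  then have nGG: "(norm (G ** transpose G))\<^sup>2 = (\<Sum>i\<in>J. (s i) ^ 4)"
    unfolding norm_partial_diagonal_gram[OF \<rho>(1), symmetric] G[symmetric]
    by (simp add: norm_mult_orthogonal_left norm_mult_orthogonal_right S)
  have "3 / (2 * \<alpha>) * (s i)\<^sup>2 - (s i) ^ 4 / (2 * \<alpha> ^ 3) \<le> s i" if "i \<in> J" for i
  proof -
    define u where "u = s i / \<alpha>"
    have u: "u \<ge> 0" "s i = \<alpha> * u" using s[OF that] \<open>\<alpha> > 0\<close> by (auto simp: u_def)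
    \<comment> \<open>The polynomial (3/2) u^2 - u^4/2 touches the identity at u = 1 and lies below it for u \<ge> 0.\<close>
    have "0 \<le> u * ((u - 1)\<^sup>2 * (u + 2)) / 2" using u by simp
    also have "\<dots> = u - (3 / 2 * u\<^sup>2 - u ^ 4 / 2)"
      by (simp add: power2_eq_square power4_eq_xxxx field_simps)
    finally have "\<alpha> * (3 / 2 * u\<^sup>2 - u ^ 4 / 2) \<le> \<alpha> * u" using \<open>\<alpha> > 0\<close> by simp
    moreover have "3 / (2 * \<alpha>) * (s i)\<^sup>2 - (s i) ^ 4 / (2 * \<alpha> ^ 3) = \<alpha> * (3 / 2 * u\<^sup>2 - u ^ 4 / 2)"
      using \<open>\<alpha> > 0\<close> unfolding u(2) by (simp add: field_simps power2_eq_square power4_eq_xxxx power3_eq_cube)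
    ultimately show ?thesis by (simp add: u(2))
  qed
  then have "(\<Sum>i\<in>J. 3 / (2 * \<alpha>) * (s i)\<^sup>2 - (s i) ^ 4 / (2 * \<alpha> ^ 3)) \<le> (\<Sum>i\<in>J. s i)"
    by (rule sum_mono)
  then have nuc: "3 / (2 * \<alpha>) * (norm G)\<^sup>2 - (norm (G ** transpose G))\<^sup>2 / (2 * \<alpha> ^ 3) \<le> (\<Sum>i\<in>J. s i)"
    by (simp add: nG nGG sum_subtractf sum_distrib_left sum_divide_distrib)
  have "(\<integral>Y. exp (\<tau> * (G \<bullet> Y)) \<partial>\<nu>) = (\<integral>Y. exp (\<tau> * (G \<bullet> (transpose S ** Y ** R))) \<partial>\<nu>)"
    by (rule integral_invariant[OF S R frame, of "\<lambda>Y. exp (\<tau> * (G \<bullet> Y))", symmetric]) simp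
  also have "\<dots> = (\<integral>Y. exp (\<tau> * ((S ** G ** transpose R) \<bullet> Y)) \<partial>\<nu>)"
  proof -
    have "G \<bullet> (transpose S ** Y ** R) = (S ** G ** transpose R) \<bullet> Y" for Y
      using inner_matrix_mult_right[of G "transpose S ** Y" R]
        inner_matrix_mult_left[of "G ** transpose R" "transpose S" Y]
      by (simp add: matrix_mul_assoc)
    then show ?thesis by simp
  qed
  also have "\<dots> = mgf (\<lambda>i. \<tau> * s i)"
    unfolding G inner_partial_diagonal by (simp add: mgf_def entry_sum_def sum_distrib_left mult.assoc)
  finally have eq: "(\<integral>Y. exp (\<tau> * (G \<bullet> Y)) \<partial>\<nu>) = mgf (\<lambda>i. \<tau> * s i)" .
  have "(\<Sum>i\<in>J. (\<tau> * s i - x) * mgf_deriv (\<lambda>_. x) i) = (\<Sum>i\<in>J. (\<tau> * s i - x) * mgf_deriv (\<lambda>_. x) i0)"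
    by (intro sum.cong refl arg_cong[where f = "\<lambda>v. _ * v"] mgf_deriv_swap i0)
  also have "\<dots> = mgf_deriv (\<lambda>_. x) i0 * (\<tau> * (\<Sum>i\<in>J. s i) - real (card J) * x)"
    by (simp add: sum_distrib_right[symmetric] sum_subtractf sum_distrib_left[symmetric])
  finally have "mgf (\<lambda>_. x) + mgf_deriv (\<lambda>_. x) i0 * (\<tau> * (\<Sum>i\<in>J. s i) - real (card J) * x)
      \<le> (\<integral>Y. exp (\<tau> * (G \<bullet> Y)) \<partial>\<nu>)"
    using mgf_tangent[of "\<lambda>_. x" "\<lambda>i. \<tau> * s i"] unfolding eq by linarith
  moreover have "mgf_deriv (\<lambda>_. x) i0 * (\<tau> * (3 / (2 * \<alpha>) * (norm G)\<^sup>2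
      - (norm (G ** transpose G))\<^sup>2 / (2 * \<alpha> ^ 3)) - real (card J) * x)
    \<le> mgf_deriv (\<lambda>_. x) i0 * (\<tau> * (\<Sum>i\<in>J. s i) - real (card J) * x)"
    using nuc \<open>\<tau> \<ge> 0\<close> i0 x by (intro mult_left_mono diff_right_mono mgf_deriv_nonneg) auto
  ultimately show ?thesis by linarith
qed

text \<open>
  The coefficients a i are raised to their common upper bound x, by monotonicity; then the lower bound for
  the mean over sign matrices, in which \<tau> is chosen such that the linear term is nonnegative, is
  compared with the upper bound exp (\<tau>^2 r^2 / 2). The larger of k and d - k is at least d/2, whence the d in the
  denominator.
\<close>

lemma mgf_bound:
  assumes a: "\<And>i. i \<in> J \<Longrightarrow> 0 \<le> a i" "\<And>i. i \<in> J \<Longrightarrow> a i \<le> x" and x: "x \<ge> 0"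
  shows "(\<integral>Y. exp (\<Sum>i\<in>J. a i * Y $ i $ \<rho> i) \<partial>\<nu>) \<le> exp (2 * x\<^sup>2 * r\<^sup>2 / CARD('d))"
proof (cases "J = {}")
  case True
  then show ?thesis by (simp add: prob_space)
next
  case False
  then obtain i0 where i0: "i0 \<in> J" by blast
  let ?k = "CARD('k)" and ?d = "CARD('d)"
  let ?C = "real CARD('k \<times> 'd \<Rightarrow> bool)"
  let ?G = "\<lambda>\<epsilon>. sign_matrix (- range \<iota>) \<epsilon> :: real^'d^'k"
  have C: "?C > 0" by (simp add: card_fun)
  have m: "card J > 0" using False by (simp add: card_gt_0_iff)
  then have kd: "?k < ?d" using J by linarith
  have k1: "?k > 0" by simp
  have cD: "card (- range \<iota>) = ?d - ?k"
    using \<iota> by (simp add: Compl_eq_Diff_UNIV card_Diff_subset card_image)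
  define N where "N = max ?k (?d - ?k)"
  have mN: "real ?k * real (?d - ?k) = real (card J) * real N"
    unfolding N_def J of_nat_mult[symmetric] by (cases "?k \<le> ?d - ?k") (auto simp: min_def max_def)
  have N: "2 * real N \<ge> ?d" "real N > 0" using kd unfolding N_def by linarith+
  \<comment> \<open>This \<alpha> maximises the lower bound for the mean sum of singular values.\<close>
  define \<alpha> where "\<alpha> = sqrt (real ?d - 1)"
  have \<alpha>: "\<alpha> > 0" "\<alpha>\<^sup>2 = real ?d - 1" using kd k1 unfolding \<alpha>_def by (auto simp del: zero_less_card_finite)
  \<comment> \<open>With this \<tau> the mean singular value of \<tau> G is at least x on average over the signs.\<close>
  define \<tau> where "\<tau> = x * \<alpha> / N"
  have \<tau>: "\<tau> \<ge> 0" using x \<alpha> N by (simp add: \<tau>_def)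
  define w where "w = mgf_deriv (\<lambda>_. x) i0"
  have w: "w \<ge> 0" unfolding w_def using i0 x by (rule mgf_deriv_nonneg)
  have "mgf a + (\<Sum>i\<in>J. (x - a i) * mgf_deriv a i) \<le> mgf (\<lambda>_. x)" by (rule mgf_tangent)
  moreover have "0 \<le> (\<Sum>i\<in>J. (x - a i) * mgf_deriv a i)"
    using a by (intro sum_nonneg mult_nonneg_nonneg mgf_deriv_nonneg) auto
  ultimately have 1: "mgf a \<le> mgf (\<lambda>_. x)" by linarith
  have int: "integrable \<nu> (\<lambda>Y. exp (\<tau> * (?G \<epsilon> \<bullet> Y)))" for \<epsilon>
  proof (rule integrable_const_bound)
    show "AE Y in \<nu>. norm (exp (\<tau> * (?G \<epsilon> \<bullet> Y))) \<le> exp (\<tau> * (norm (?G \<epsilon>) * r))"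
      using bound
    proof eventually_elim
      case (elim Y)
      have "?G \<epsilon> \<bullet> Y \<le> norm (?G \<epsilon>) * norm Y" by (rule norm_cauchy_schwarz)
      also have "\<dots> \<le> norm (?G \<epsilon>) * r" using elim by (intro mult_left_mono) auto
      finally show ?case using \<tau> by (simp add: mult_left_mono)
    qed
  qed simp
  have "?C * mgf (\<lambda>_. x) = (\<Sum>\<epsilon>\<in>(UNIV :: ('k \<times> 'd \<Rightarrow> bool) set). mgf (\<lambda>_. x))" by simp
  also have "\<dots> \<le> (\<Sum>\<epsilon>\<in>UNIV. mgf (\<lambda>_. x) + w * (\<tau> * (3 / (2 * \<alpha>) * (norm (?G \<epsilon>))\<^sup>2
      - (norm (?G \<epsilon> ** transpose (?G \<epsilon>)))\<^sup>2 / (2 * \<alpha> ^ 3)) - real (card J) * x))"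
  proof -
    have "(\<Sum>\<epsilon>\<in>UNIV. \<tau> * (3 / (2 * \<alpha>) * (norm (?G \<epsilon>))\<^sup>2
        - (norm (?G \<epsilon> ** transpose (?G \<epsilon>)))\<^sup>2 / (2 * \<alpha> ^ 3)) - real (card J) * x)
      = \<tau> * (3 / (2 * \<alpha>) * (?C * (real ?k * real (?d - ?k)))
        - (\<Sum>\<epsilon>\<in>UNIV. (norm (?G \<epsilon> ** transpose (?G \<epsilon>)))\<^sup>2) / (2 * \<alpha> ^ 3)) - ?C * (real (card J) * x)"
      unfolding sign_matrix_norm cD
      by (simp add: sum_subtractf sum_distrib_left[symmetric] sum_divide_distrib[symmetric])
    moreover have "\<dots> \<ge> \<tau> * (3 / (2 * \<alpha>) * (?C * (real ?k * real (?d - ?k)))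
        - ?C * (real ?k * real (?d - ?k) * (real ?d - 1)) / (2 * \<alpha> ^ 3)) - ?C * (real (card J) * x)"
    proof -
      have "(\<Sum>\<epsilon>\<in>UNIV. (norm (?G \<epsilon> ** transpose (?G \<epsilon>)))\<^sup>2)
          \<le> ?C * (real ?k * real (?d - ?k) * (real ?d - 1))"
        using sign_matrix_gram_sum[of "- range \<iota>", where 'k = 'k] kd unfolding cD by (simp add: of_nat_diff)
      then show ?thesis
        using \<tau> \<alpha>(1) by (intro diff_right_mono mult_left_mono diff_left_mono divide_right_mono) auto
    qed
    moreover have "\<tau> * (3 / (2 * \<alpha>) * (?C * (real ?k * real (?d - ?k)))
        - ?C * (real ?k * real (?d - ?k) * (real ?d - 1)) / (2 * \<alpha> ^ 3)) - ?C * (real (card J) * x) = 0"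
    proof -
      have "?C * (real ?k * real (?d - ?k) * (real ?d - 1)) / (2 * \<alpha> ^ 3) = ?C * (card J * N) / (2 * \<alpha>)"
        unfolding mN \<alpha>(2)[symmetric] using \<alpha>(1) by (simp add: power2_eq_square power3_eq_cube)
      moreover have "3 / (2 * \<alpha>) * u - u / (2 * \<alpha>) = u / \<alpha>" for u
        using \<alpha>(1) by (simp add: field_simps)
      moreover have "\<tau> * (?C * (card J * N) / \<alpha>) = ?C * (real (card J) * x)"
        using \<alpha>(1) N(2) by (simp add: \<tau>_def)
      ultimately show ?thesis unfolding mN by (simp add: mult.commute mult.left_commute)
    qed
    ultimately have "0 \<le> (\<Sum>\<epsilon>\<in>UNIV. \<tau> * (3 / (2 * \<alpha>) * (norm (?G \<epsilon>))\<^sup>2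
        - (norm (?G \<epsilon> ** transpose (?G \<epsilon>)))\<^sup>2 / (2 * \<alpha> ^ 3)) - real (card J) * x)"
      by linarith
    then show ?thesis using w by (simp add: sum.distrib sum_distrib_left[symmetric])
  qed
  also have "\<dots> \<le> (\<Sum>\<epsilon>\<in>UNIV. \<integral>Y. exp (\<tau> * (?G \<epsilon> \<bullet> Y)) \<partial>\<nu>)"
    unfolding w_def by (intro sum_mono sign_matrix_mgf_lower_bound \<tau> \<alpha>(1) i0 x)
  also have "\<dots> = (\<integral>Y. (\<Sum>\<epsilon>\<in>UNIV. exp (\<tau> * (?G \<epsilon> \<bullet> Y))) \<partial>\<nu>)"
    by (rule Bochner_Integration.integral_sum[symmetric]) (rule int)
  also have "\<dots> \<le> (\<integral>Y. ?C * exp (\<tau>\<^sup>2 * r\<^sup>2 / 2) \<partial>\<nu>)"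
  proof (rule integral_mono_AE[OF Bochner_Integration.integrable_sum[OF int]])
    show "AE Y in \<nu>. (\<Sum>\<epsilon>\<in>UNIV. exp (\<tau> * (?G \<epsilon> \<bullet> Y))) \<le> ?C * exp (\<tau>\<^sup>2 * r\<^sup>2 / 2)"
      using bound
    proof eventually_elim
      case (elim Y)
      have "(\<Sum>\<epsilon>\<in>UNIV. exp (\<tau> * (?G \<epsilon> \<bullet> Y))) \<le> ?C * exp (\<tau>\<^sup>2 * (norm Y)\<^sup>2 / 2)"
        by (rule sign_matrix_exp_sum)
      also have "\<dots> \<le> ?C * exp (\<tau>\<^sup>2 * r\<^sup>2 / 2)"
        using elim by (intro mult_left_mono) (auto intro!: mult_left_mono power_mono divide_right_mono)
      finally show ?case .
    qed
  qed simp
  also have "\<dots> = ?C * exp (\<tau>\<^sup>2 * r\<^sup>2 / 2)" by (simp add: prob_space)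
  finally have 2: "mgf (\<lambda>_. x) \<le> exp (\<tau>\<^sup>2 * r\<^sup>2 / 2)" using C by simp
  have "\<tau>\<^sup>2 \<le> 4 * x\<^sup>2 / ?d"
  proof -
    have "(real ?d - 1) * ?d \<le> real ?d * real ?d" by (intro mult_right_mono) auto
    also have "\<dots> \<le> (2 * real N) * (2 * real N)" using N by (intro mult_mono) auto
    finally have "(real ?d - 1) * ?d \<le> 4 * (real N)\<^sup>2" by (simp add: power2_eq_square)
    then have "(real ?d - 1) / (real N)\<^sup>2 \<le> 4 / ?d" using N by (simp add: field_simps)
    then have "x\<^sup>2 * ((real ?d - 1) / (real N)\<^sup>2) \<le> x\<^sup>2 * (4 / ?d)" by (rule mult_left_mono) simp
    then show ?thesis by (simp add: \<tau>_def power_mult_distrib power_divide \<alpha>(2) mult.commute)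
  qed
  then have "\<tau>\<^sup>2 * r\<^sup>2 / 2 \<le> (4 * x\<^sup>2 / ?d) * r\<^sup>2 / 2"
    by (intro divide_right_mono mult_right_mono) auto
  then have "exp (\<tau>\<^sup>2 * r\<^sup>2 / 2) \<le> exp (2 * x\<^sup>2 * r\<^sup>2 / ?d)" by (simp add: mult.commute)
  then have "mgf a \<le> exp (2 * x\<^sup>2 * r\<^sup>2 / ?d)" using 1 2 by linarith
  then show ?thesis by (simp add: mgf_def entry_sum_def)
qed

end

section \<open>From the path of frames to its first step\<close>

lemma exp_mean_le_mean_exp:
  fixes y :: "nat \<Rightarrow> real"
  assumes "N > 0"
  shows "exp ((\<Sum>l<N. y l) / N) \<le> (\<Sum>l<N. exp (y l)) / N"
proof -
  define A where "A = (\<Sum>l<N. y l) / N"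
  have "(\<Sum>l<N. exp A * (1 + (y l - A))) \<le> (\<Sum>l<N. exp A * exp (y l - A))"
    by (intro sum_mono mult_left_mono exp_ge_add_one_self) simp
  also have "\<dots> = (\<Sum>l<N. exp (y l))" by (simp add: exp_diff)
  also have "(\<Sum>l<N. exp A * (1 + (y l - A))) = exp A * (real N + ((\<Sum>l<N. y l) - real N * A))"
    by (simp add: sum_distrib_left[symmetric] sum.distrib sum_subtractf)
  also have "real N * A = (\<Sum>l<N. y l)" using assms by (simp add: A_def)
  finally show ?thesis using assms by (simp add: A_def field_simps)
qed

lemma one_minus_cos_le: "1 - cos x \<le> x\<^sup>2 / 2" for x :: real
proof -
  have "cos x = 1 - 2 * (sin (x / 2))\<^sup>2" using cos_double_sin[of "x / 2"] by simp
  moreover have "(sin (x / 2))\<^sup>2 \<le> (x / 2)\<^sup>2"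
    using abs_sin_x_le_abs_x[of "x / 2"] by (simp only: abs_le_square_iff)
  ultimately show ?thesis by (simp add: power_divide)
qed

text \<open>
  For p a gradient of an O(k)-invariant function, the matrix in question is the gradient at the random
  frame, seen from the standard frame. The factor U is there because a measurable choice of p need not be
  equivariant under O(k).
\<close>

lemma frame_invariant_matrix_haar_average:
  fixes \<iota> \<rho> :: "'k::finite \<Rightarrow> 'd::finite" and p :: "real^'d^'k \<Rightarrow> real^'d^'k"
  assumes \<iota>: "inj \<iota>" and \<rho>: "inj_on \<rho> J" "\<rho> ` J \<inter> range \<iota> = {}"
    and J: "card J = min CARD('k) (CARD('d) - CARD('k))"
    and A: "prob_space A" "sets A = sets borel" "AE U in A. orthogonal_matrix (U :: real^'k^'k)"
      "\<And>S. orthogonal_matrix S \<Longrightarrow> distr A borel (\<lambda>U. U ** S) = A"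
    and B: "prob_space B" "sets B = sets borel" "AE Q in B. orthogonal_matrix (Q :: real^'d^'d)"
      "\<And>R. orthogonal_matrix R \<Longrightarrow> distr B borel (\<lambda>Q. R ** Q) = B"
    and p: "p \<in> borel_measurable borel" "\<And>x. norm (p x) \<le> r"
  shows "frame_invariant_matrix (distr (A \<Otimes>\<^sub>M B) borel
      (\<lambda>(U, Q). transpose U ** p (U ** coordinate_frame \<iota> ** Q) ** transpose Q)) \<iota> J \<rho> r"
proof -
  interpret A: prob_space A by fact
  interpret B: prob_space B by fact
  interpret AB: pair_prob_space A B ..
  note [measurable] = p(1)
  note [measurable_cong] = A(2) B(2)
  let ?f = "\<lambda>(U, Q). transpose U ** p (U ** coordinate_frame \<iota> ** Q) ** transpose Q"
  have fm [measurable]: "?f \<in> borel_measurable (borel \<Otimes>\<^sub>M borel)" by measurable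
  have fm' [measurable]: "?f \<in> borel_measurable (A \<Otimes>\<^sub>M B)" by measurable
  interpret P: prob_space "distr (A \<Otimes>\<^sub>M B) borel ?f" by (rule AB.prob_space_distr) (rule fm')
  show ?thesis
  proof
    show "inj \<iota>" "inj_on \<rho> J" "\<rho> ` J \<inter> range \<iota> = {}" "card J = min CARD('k) (CARD('d) - CARD('k))" by fact+
    show "sets (distr (A \<Otimes>\<^sub>M B) borel ?f) = sets borel" by simp
    have "closed {U :: real^'k^'k. orthogonal_matrix U}" "closed {Q :: real^'d^'d. orthogonal_matrix Q}"
      unfolding orthogonal_matrix_iff_rows
      by (intro closed_Collect_all closed_Collect_eq continuous_intros)+
    then have "{z \<in> space (A \<Otimes>\<^sub>M B). orthogonal_matrix (fst z)} \<in> sets (A \<Otimes>\<^sub>M B)"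
      "{z \<in> space (A \<Otimes>\<^sub>M B). orthogonal_matrix (snd z)} \<in> sets (A \<Otimes>\<^sub>M B)"
      using measurable_sets[OF measurable_fst, of "{U. orthogonal_matrix U}" A B]
        measurable_sets[OF measurable_snd, of "{U. orthogonal_matrix U}" B A]
      by (auto simp: A(2) B(2) vimage_def Int_def conj_commute)
    then have "AE z in A \<Otimes>\<^sub>M B. orthogonal_matrix (fst z)" "AE z in A \<Otimes>\<^sub>M B. orthogonal_matrix (snd z)"
      using A(3) B(3) by (auto intro!: AB.AE_pair_measure)
    then have "AE z in A \<Otimes>\<^sub>M B. norm (?f z) \<le> r"
    proof eventually_elim
      case (elim z)
      then show ?case
        using p(2) by (auto simp: case_prod_beta norm_mult_orthogonal_left norm_mult_orthogonal_right)
    qed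
    then show "AE Y in distr (A \<Otimes>\<^sub>M B) borel ?f. norm Y \<le> r"
      by (subst AE_distr_iff) simp_all
    fix S :: "real^'k^'k" and R :: "real^'d^'d"
    assume S: "orthogonal_matrix S" and R: "orthogonal_matrix R"
      and SR: "S ** coordinate_frame \<iota> = coordinate_frame \<iota> ** R"
    have eq: "?f (U ** S, transpose R ** Q) = transpose S ** ?f (U, Q) ** R" for U Q
    proof -
      have "U ** S ** coordinate_frame \<iota> ** (transpose R ** Q) = U ** (S ** coordinate_frame \<iota>) ** transpose R ** Q"
        by (simp add: matrix_mul_assoc)
      also have "\<dots> = U ** coordinate_frame \<iota> ** Q"
        unfolding SR by (simp add: matrix_mul_assoc orthogonal_matrix_cancel R)
      finally show ?thesis by (simp add: matrix_transpose_mul matrix_mul_assoc)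
    qed
    have "A \<Otimes>\<^sub>M B = distr A borel (\<lambda>U. U ** S) \<Otimes>\<^sub>M distr B borel (\<lambda>Q. transpose R ** Q)"
      by (simp add: A(4) B(4) S R)
    also have "\<dots> = distr (A \<Otimes>\<^sub>M B) (borel \<Otimes>\<^sub>M borel) (\<lambda>(U, Q). (U ** S, transpose R ** Q))"
      by (rule pair_measure_distr) (auto simp: B(4) R B.sigma_finite_measure_axioms)
    finally have "distr (A \<Otimes>\<^sub>M B) borel ?f
        = distr (distr (A \<Otimes>\<^sub>M B) (borel \<Otimes>\<^sub>M borel) (\<lambda>(U, Q). (U ** S, transpose R ** Q))) borel ?f"
      by simp
    also have "\<dots> = distr (A \<Otimes>\<^sub>M B) borel (\<lambda>z. transpose S ** ?f z ** R)"
      by (subst distr_distr) (auto simp: comp_def case_prod_beta eq[unfolded case_prod_beta fst_conv snd_conv])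
    also have "\<dots> = distr (distr (A \<Otimes>\<^sub>M B) borel ?f) borel (\<lambda>Y. transpose S ** Y ** R)"
      by (subst distr_distr) (auto simp: comp_def)
    finally show "distr (distr (A \<Otimes>\<^sub>M B) borel ?f) borel (\<lambda>Y. transpose S ** Y ** R) = distr (A \<Otimes>\<^sub>M B) borel ?f"
      by simp
  qed
qed

text \<open>
  The first step of the path differs from the linear displacement by the cosine terms only, which are of
  order N to the power -2; the sine terms are kept exactly, as they are bounded by the angles.
\<close>

lemma rotated_frame_step_bounds:
  fixes \<iota> \<rho> :: "'k::finite \<Rightarrow> 'd::finite" and r :: real
  assumes \<iota>\<rho>: "\<And>i. i \<in> J \<Longrightarrow> \<rho> i \<noteq> \<iota> i"
    and \<phi>: "\<And>i. 0 \<le> \<phi> i" "\<And>i. \<phi> i \<le> pi / 2" "\<And>i. i \<notin> J \<Longrightarrow> \<phi> i = 0"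
    and N: "N > (0::nat)"
  defines "\<Delta> \<equiv> rotated_frame \<iota> \<rho> (\<lambda>i. \<phi> i / N) - coordinate_frame \<iota>"
  shows "(norm \<Delta>)\<^sup>2 \<le> 4 * real CARD('k) / N\<^sup>2"
    "norm Y \<le> r \<Longrightarrow> real N * (Y \<bullet> \<Delta>) \<le> 2 * r * CARD('k) / N + (\<Sum>i\<in>J. real N * sin (\<phi> i / N) * Y $ i $ \<rho> i)"
proof -
  have sq: "(\<phi> i)\<^sup>2 \<le> 4" for i
  proof -
    have "\<phi> i \<le> 2" using \<phi>(2)[of i] pi_less_4 by simp
    then have "(\<phi> i)\<^sup>2 \<le> 2\<^sup>2" using \<phi>(1)[of i] by (intro power_mono) auto
    then show ?thesis by simp
  qed
  have c: "1 - cos (\<phi> i / N) \<le> 2 / N\<^sup>2" for i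
  proof -
    have "1 - cos (\<phi> i / N) \<le> (\<phi> i)\<^sup>2 / (2 * N\<^sup>2)"
      using one_minus_cos_le[of "\<phi> i / N"] by (simp add: power_divide)
    also have "\<dots> \<le> 4 / (2 * N\<^sup>2)" using sq by (intro divide_right_mono) auto
    finally show ?thesis by simp
  qed
  have \<Delta>: "\<Delta> $ i = (cos (\<phi> i / N) - 1) *\<^sub>R axis (\<iota> i) 1 + sin (\<phi> i / N) *\<^sub>R axis (\<rho> i) 1" for i
    by (simp add: \<Delta>_def rotated_frame_def coordinate_frame_def algebra_simps)
  have "\<Delta> $ i \<bullet> \<Delta> $ i \<le> 4 / N\<^sup>2" for i
  proof -
    have "\<Delta> $ i \<bullet> \<Delta> $ i = 2 * (1 - cos (\<phi> i / N))"
    proof (cases "i \<in> J")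
      case True
      then show ?thesis
        using \<iota>\<rho>[OF True] sin_cos_squared_add3[of "\<phi> i / N"]
        by (simp add: \<Delta> inner_add_left inner_add_right inner_axis_axis algebra_simps)
    next
      case False
      then show ?thesis using \<phi>(3)[OF False] by (simp add: \<Delta>)
    qed
    then show ?thesis using c[of i] by simp
  qed
  then have "(\<Sum>i\<in>UNIV. \<Delta> $ i \<bullet> \<Delta> $ i) \<le> (\<Sum>i\<in>(UNIV :: 'k set). 4 / N\<^sup>2)" by (rule sum_mono)
  then show "(norm \<Delta>)\<^sup>2 \<le> 4 * real CARD('k) / N\<^sup>2"
    by (simp add: power2_norm_eq_inner inner_vec_def[of \<Delta>] mult.commute)
  assume Y: "norm Y \<le> r"
  have "Y \<bullet> \<Delta> = (\<Sum>i\<in>UNIV. (cos (\<phi> i / N) - 1) * Y $ i $ \<iota> i) + (\<Sum>i\<in>UNIV. sin (\<phi> i / N) * Y $ i $ \<rho> i)"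
    by (simp add: inner_vec_def[of Y] \<Delta> inner_add_right inner_axis sum.distrib)
  moreover have "(\<Sum>i\<in>UNIV. sin (\<phi> i / N) * Y $ i $ \<rho> i) = (\<Sum>i\<in>J. sin (\<phi> i / N) * Y $ i $ \<rho> i)"
    using \<phi>(3) by (intro sum.mono_neutral_right) auto
  moreover have "(\<Sum>i\<in>UNIV. (cos (\<phi> i / N) - 1) * Y $ i $ \<iota> i) \<le> (\<Sum>i\<in>(UNIV::'k set). 2 / N\<^sup>2 * r)"
  proof (rule sum_mono)
    fix i
    have "\<bar>Y $ i $ \<iota> i\<bar> \<le> r"
      using abs_matrix_entry_le_norm[of Y i "\<iota> i"] Y by linarith
    moreover have "\<bar>cos (\<phi> i / N) - 1\<bar> \<le> 2 / N\<^sup>2" using c[of i] cos_le_one[of "\<phi> i / N"] by linarith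
    ultimately have "\<bar>(cos (\<phi> i / N) - 1) * Y $ i $ \<iota> i\<bar> \<le> 2 / N\<^sup>2 * r"
      unfolding abs_mult by (intro mult_mono) auto
    then show "(cos (\<phi> i / N) - 1) * Y $ i $ \<iota> i \<le> 2 / N\<^sup>2 * r" by linarith
  qed
  ultimately have "Y \<bullet> \<Delta> \<le> CARD('k) * (2 / N\<^sup>2 * r) + (\<Sum>i\<in>J. sin (\<phi> i / N) * Y $ i $ \<rho> i)" by simp
  then have "real N * (Y \<bullet> \<Delta>) \<le> real N * (CARD('k) * (2 / N\<^sup>2 * r) + (\<Sum>i\<in>J. sin (\<phi> i / N) * Y $ i $ \<rho> i))"
    by (rule mult_left_mono) simp
  also have "\<dots> = 2 * r * CARD('k) / N + (\<Sum>i\<in>J. real N * sin (\<phi> i / N) * Y $ i $ \<rho> i)"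
    using N by (simp add: distrib_left sum_distrib_left mult.assoc power2_eq_square)
  finally show "real N * (Y \<bullet> \<Delta>) \<le> 2 * r * CARD('k) / N + (\<Sum>i\<in>J. real N * sin (\<phi> i / N) * Y $ i $ \<rho> i)" .
qed

text \<open>
  The core of the argument: the increment over the whole path is the mean of N rescaled increments over
  congruent steps, and on the first step the supergradient inequality reduces to a linear functional of an
  invariant random matrix.
\<close>

lemma semiconcave_increment_bound:
  fixes \<iota> \<rho> :: "'k::finite \<Rightarrow> 'd::finite" and p :: "real^'d^'k \<Rightarrow> real^'d^'k" and \<Phi> :: "real^'d^'k \<Rightarrow> real"
    and r c \<delta> t :: real
  assumes \<iota>: "inj \<iota>" and \<rho>: "inj_on \<rho> J" "\<rho> ` J \<inter> range \<iota> = {}"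
    and J: "card J = min CARD('k) (CARD('d) - CARD('k))"
    and \<phi>: "\<And>i. 0 \<le> \<phi> i" "\<And>i. \<phi> i \<le> pi / 2" "\<And>i. i \<notin> J \<Longrightarrow> \<phi> i = 0"
    and B: "prob_space B" "sets B = sets borel" "AE Q in B. orthogonal_matrix (Q :: real^'d^'d)"
      "\<And>R. orthogonal_matrix R \<Longrightarrow> distr B borel (\<lambda>Q. R ** Q) = B"
    and p: "p \<in> borel_measurable borel" "\<And>x. norm (p x) \<le> r"
    and \<Phi>m: "\<Phi> \<in> borel_measurable borel"
    and inv: "\<And>U x. orthogonal_matrix U \<Longrightarrow> \<Phi> (U ** x) = \<Phi> x"
    and super: "\<And>x y. \<Phi> y \<le> \<Phi> x + p x \<bullet> (y - x) + c * (norm (y - x))\<^sup>2 + \<delta>"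
    and c: "c \<ge> 0" and N: "N > (0::nat)" and lam: "t \<ge> 0"
  shows "(\<integral>\<^sup>+Q. ennreal (exp (t * (\<Phi> (rotated_frame \<iota> \<rho> \<phi> ** Q) - \<Phi> (coordinate_frame \<iota> ** Q)))) \<partial>B)
    \<le> ennreal (exp (t * ((2 * r + 4 * c) * real CARD('k) / real N + N * \<delta>) + pi\<^sup>2 * t\<^sup>2 * r\<^sup>2 / (2 * real CARD('d))))"
proof -
  let ?E = "coordinate_frame \<iota> :: real^'d^'k" and ?k = "CARD('k)"
  interpret B: prob_space B by fact
  note [measurable] = p(1) \<Phi>m
  note [measurable_cong] = B(2)
  define \<Theta> where "\<Theta> l = rotated_frame \<iota> \<rho> (\<lambda>i. real l * (\<phi> i / N))" for l :: nat
  have \<Theta>0: "\<Theta> 0 = ?E" by (simp add: \<Theta>_def rotated_frame_0)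
  have \<Theta>1: "\<Theta> 1 = rotated_frame \<iota> \<rho> (\<lambda>i. \<phi> i / N)" by (simp add: \<Theta>_def)
  have \<Theta>N: "\<Theta> N = rotated_frame \<iota> \<rho> \<phi>" using N by (simp add: \<Theta>_def)
  have step: "\<exists>R. orthogonal_matrix R \<and> \<Theta> l = ?E ** R \<and> \<Theta> (Suc l) = \<Theta> 1 ** R" for l
  proof -
    obtain R where R: "orthogonal_matrix R" "\<And>\<phi>'. (\<And>i. i \<notin> J \<Longrightarrow> \<phi>' i = 0) \<Longrightarrow>
        rotated_frame \<iota> \<rho> \<phi>' ** R = rotated_frame \<iota> \<rho> (\<lambda>i. \<phi>' i + real l * (\<phi> i / N))"
      using rotated_frame_rotate[OF \<iota> \<rho>, of "\<lambda>i. real l * (\<phi> i / N)"] \<phi>(3) by auto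
    have "?E ** R = \<Theta> l"
      using R(2)[of "\<lambda>_. 0"] by (simp add: rotated_frame_0 \<Theta>_def)
    moreover have "\<Theta> 1 ** R = \<Theta> (Suc l)"
      using R(2)[of "\<lambda>i. \<phi> i / N"] \<phi>(3) by (simp add: \<Theta>_def distrib_right add_divide_distrib)
    ultimately show ?thesis using R(1) by metis
  qed
  have shift: "(\<integral>\<^sup>+Q. g (R ** Q) \<partial>B) = (\<integral>\<^sup>+Q. g Q \<partial>B)"
    if "orthogonal_matrix R" and [measurable]: "g \<in> borel_measurable borel" for R and g :: "real^'d^'d \<Rightarrow> ennreal"
  proof -
    have "(\<integral>\<^sup>+Q. g Q \<partial>B) = (\<integral>\<^sup>+Q. g Q \<partial>distr B borel (\<lambda>Q. R ** Q))" by (simp add: B(4) that(1))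
    also have "\<dots> = (\<integral>\<^sup>+Q. g (R ** Q) \<partial>B)" by (subst nn_integral_distr) simp_all
    finally show ?thesis by simp
  qed
  define I where "I = (\<integral>\<^sup>+Q. ennreal (exp (t * N * (\<Phi> (\<Theta> 1 ** Q) - \<Phi> (?E ** Q)))) \<partial>B)"
  have Il: "(\<integral>\<^sup>+Q. ennreal (exp (t * N * (\<Phi> (\<Theta> (Suc l) ** Q) - \<Phi> (\<Theta> l ** Q)))) \<partial>B) = I" for l
  proof -
    obtain R where R: "orthogonal_matrix R" "\<Theta> l = ?E ** R" "\<Theta> (Suc l) = \<Theta> 1 ** R" using step by blast
    then show ?thesis
      using shift[OF R(1), of "\<lambda>Q. ennreal (exp (t * N * (\<Phi> (\<Theta> 1 ** Q) - \<Phi> (?E ** Q))))"]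
      by (simp add: I_def matrix_mul_assoc)
  qed
  have "(\<integral>\<^sup>+Q. ennreal (exp (t * (\<Phi> (rotated_frame \<iota> \<rho> \<phi> ** Q) - \<Phi> (?E ** Q)))) \<partial>B)
      \<le> (\<integral>\<^sup>+Q. ennreal (1 / N) * (\<Sum>l<N. ennreal (exp (t * N * (\<Phi> (\<Theta> (Suc l) ** Q) - \<Phi> (\<Theta> l ** Q))))) \<partial>B)"
  proof (rule nn_integral_mono)
    fix Q
    let ?y = "\<lambda>l. t * N * (\<Phi> (\<Theta> (Suc l) ** Q) - \<Phi> (\<Theta> l ** Q))"
    have "(\<Sum>l<N. \<Phi> (\<Theta> (Suc l) ** Q) - \<Phi> (\<Theta> l ** Q)) = \<Phi> (\<Theta> N ** Q) - \<Phi> (\<Theta> 0 ** Q)"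
      by (rule sum_lessThan_telescope)
    then have "t * (\<Phi> (rotated_frame \<iota> \<rho> \<phi> ** Q) - \<Phi> (?E ** Q)) = (\<Sum>l<N. ?y l) / N"
      using N by (simp add: sum_distrib_left[symmetric] \<Theta>N \<Theta>0)
    then have "exp (t * (\<Phi> (rotated_frame \<iota> \<rho> \<phi> ** Q) - \<Phi> (?E ** Q))) \<le> 1 / N * (\<Sum>l<N. exp (?y l))"
      using exp_mean_le_mean_exp[OF N, of ?y] by simp
    then have "ennreal (exp (t * (\<Phi> (rotated_frame \<iota> \<rho> \<phi> ** Q) - \<Phi> (?E ** Q)))) \<le> ennreal (1 / N * (\<Sum>l<N. exp (?y l)))"
      by (rule ennreal_leI)
    also have "\<dots> = ennreal (1 / N) * (\<Sum>l<N. ennreal (exp (?y l)))"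
      by (subst sum_ennreal, simp) (rule ennreal_mult; simp add: sum_nonneg)
    finally show "ennreal (exp (t * (\<Phi> (rotated_frame \<iota> \<rho> \<phi> ** Q) - \<Phi> (?E ** Q))))
        \<le> ennreal (1 / N) * (\<Sum>l<N. ennreal (exp (?y l)))" .
  qed
  also have "\<dots> = ennreal (1 / N) * (\<Sum>l<N. I)"
    by (subst nn_integral_cmult, measurable, subst nn_integral_sum, measurable) (simp only: Il)
  also have "\<dots> = I"
    using N by (simp add: mult.assoc[symmetric] ennreal_of_nat_eq_real_of_nat ennreal_mult[symmetric])
  also have "I \<le> ennreal (exp (t * ((2 * r + 4 * c) * real ?k / real N + N * \<delta>) + pi\<^sup>2 * t\<^sup>2 * r\<^sup>2 / (2 * real CARD('d))))"
  proof -
    obtain A :: "(real^'k^'k) measure" where A: "prob_space A" "sets A = sets borel"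
      "AE U in A. orthogonal_matrix U" "\<And>S. orthogonal_matrix S \<Longrightarrow> distr A borel (\<lambda>U. U ** S) = A"
      using exists_right_invariant_orthogonal by blast
    interpret A: prob_space A by fact
    interpret AB: pair_prob_space A B ..
    note [measurable_cong] = A(2)
    define f where "f = (\<lambda>(U, Q). transpose U ** p (U ** ?E ** Q) ** transpose Q)"
    interpret P: frame_invariant_matrix "distr (A \<Otimes>\<^sub>M B) borel f" \<iota> J \<rho> r
      unfolding f_def by (rule frame_invariant_matrix_haar_average[OF \<iota> \<rho> J A B p])
    have fm [measurable]: "f \<in> borel_measurable (A \<Otimes>\<^sub>M B)" unfolding f_def by measurable
    define a where "a i = t * (real N * sin (\<phi> i / N))" for i
    have a: "0 \<le> a i" "a i \<le> t * (pi / 2)" for i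
    proof -
      have 1: "0 \<le> \<phi> i / N" "\<phi> i / N \<le> pi"
      proof -
        show "0 \<le> \<phi> i / N" using \<phi>(1) by simp
        have "\<phi> i / N \<le> \<phi> i" using N \<phi>(1)[of i] by (simp add: divide_le_eq mult_le_cancel_left1)
        also have "\<dots> \<le> pi" using \<phi>(2)[of i] pi_ge_zero by linarith
        finally show "\<phi> i / N \<le> pi" .
      qed
      then show "0 \<le> a i" using lam by (simp add: a_def sin_ge_zero)
      have "real N * sin (\<phi> i / N) \<le> real N * (\<phi> i / N)"
        using 1 by (intro mult_left_mono sin_x_le_x) auto
      also have "\<dots> \<le> pi / 2" using N \<phi>(2) by simp
      finally show "a i \<le> t * (pi / 2)" unfolding a_def using lam by (rule mult_left_mono)
    qed
    let ?s = "\<lambda>Y :: real^'d^'k. \<Sum>i\<in>J. a i * Y $ i $ \<rho> i"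
    let ?K = "t * ((2 * r + 4 * c) * real ?k / real N + N * \<delta>)"
    have \<iota>\<rho>: "\<rho> i \<noteq> \<iota> i" if "i \<in> J" for i using \<rho>(2) that by blast
    have bounds: "(norm (\<Theta> 1 - ?E))\<^sup>2 \<le> 4 * real ?k / N\<^sup>2"
      "norm Y \<le> r \<Longrightarrow> real N * (Y \<bullet> (\<Theta> 1 - ?E))
        \<le> 2 * r * ?k / N + (\<Sum>i\<in>J. real N * sin (\<phi> i / N) * Y $ i $ \<rho> i)" for Y
      unfolding \<Theta>1 by (rule rotated_frame_step_bounds[where J = J, OF \<iota>\<rho> \<phi> N]; assumption)+
    have pt: "t * N * (\<Phi> (\<Theta> 1 ** Q) - \<Phi> (?E ** Q)) \<le> ?K + ?s (f (U, Q))"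
      if U: "orthogonal_matrix U" and Q: "orthogonal_matrix Q" for U Q
    proof -
      let ?x = "U ** ?E ** Q" and ?y = "U ** \<Theta> 1 ** Q" and ?\<Delta> = "\<Theta> 1 - ?E"
      have yx: "?y - ?x = U ** ?\<Delta> ** Q"
        by (simp add: linear_diff[OF linear_matrix_mult_right] linear_diff[OF linear_matrix_mult_left])
      have n: "norm (?y - ?x) = norm ?\<Delta>"
        unfolding yx using U Q by (simp add: norm_mult_orthogonal_left norm_mult_orthogonal_right)
      have ip: "p ?x \<bullet> (?y - ?x) = f (U, Q) \<bullet> ?\<Delta>"
      proof -
        have "p ?x \<bullet> (U ** ?\<Delta> ** Q) = (p ?x ** transpose Q) \<bullet> (U ** ?\<Delta>)"
          by (rule inner_matrix_mult_right)
        also have "\<dots> = (transpose U ** (p ?x ** transpose Q)) \<bullet> ?\<Delta>"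
          by (rule inner_matrix_mult_left)
        finally show ?thesis unfolding yx by (simp add: f_def matrix_mul_assoc)
      qed
      have nf: "norm (f (U, Q)) \<le> r"
        using U Q p(2) by (simp add: f_def norm_mult_orthogonal_left norm_mult_orthogonal_right)
      have "\<Phi> (\<Theta> 1 ** Q) = \<Phi> ?y" "\<Phi> (?E ** Q) = \<Phi> ?x"
        using inv[OF U, of "\<Theta> 1 ** Q"] inv[OF U, of "?E ** Q"] by (simp_all add: matrix_mul_assoc)
      then have "\<Phi> (\<Theta> 1 ** Q) - \<Phi> (?E ** Q) \<le> f (U, Q) \<bullet> ?\<Delta> + c * (norm ?\<Delta>)\<^sup>2 + \<delta>"
        using super[of ?y ?x] unfolding n ip by linarith
      also have "c * (norm ?\<Delta>)\<^sup>2 \<le> c * (4 * real ?k / N\<^sup>2)"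
        by (rule mult_left_mono[OF bounds(1) c])
      finally have "real N * (\<Phi> (\<Theta> 1 ** Q) - \<Phi> (?E ** Q))
          \<le> real N * (f (U, Q) \<bullet> ?\<Delta> + c * (4 * real ?k / N\<^sup>2) + \<delta>)"
        by (intro mult_left_mono) auto
      also have "\<dots> = real N * (f (U, Q) \<bullet> ?\<Delta>) + 4 * c * ?k / N + N * \<delta>"
        using N by (simp add: distrib_left power2_eq_square)
      also have "\<dots> \<le> 2 * r * ?k / N + (\<Sum>i\<in>J. real N * sin (\<phi> i / N) * f (U, Q) $ i $ \<rho> i) + 4 * c * ?k / N + N * \<delta>"
        using bounds(2)[OF nf] by simp
      also have "\<dots> = (2 * r + 4 * c) * real ?k / real N + N * \<delta> + (\<Sum>i\<in>J. real N * sin (\<phi> i / N) * f (U, Q) $ i $ \<rho> i)"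
        by (simp add: distrib_right add_divide_distrib)
      finally have "t * (real N * (\<Phi> (\<Theta> 1 ** Q) - \<Phi> (?E ** Q)))
          \<le> t * ((2 * r + 4 * c) * real ?k / real N + N * \<delta> + (\<Sum>i\<in>J. real N * sin (\<phi> i / N) * f (U, Q) $ i $ \<rho> i))"
        using lam by (rule mult_left_mono)
      then show ?thesis by (simp add: distrib_left sum_distrib_left a_def mult.assoc)
    qed
    have "I = (\<integral>\<^sup>+U. I \<partial>A)" by (simp add: A.emeasure_space_1)
    also have "\<dots> \<le> (\<integral>\<^sup>+U. (\<integral>\<^sup>+Q. ennreal (exp ?K) * ennreal (exp (?s (f (U, Q)))) \<partial>B) \<partial>A)"
    proof (rule nn_integral_mono_AE, use A(3) in eventually_elim)
      case (elim U)
      show ?case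
        unfolding I_def
      proof (rule nn_integral_mono_AE, use B(3) in eventually_elim)
        case (elim Q)
        have "exp (t * N * (\<Phi> (\<Theta> 1 ** Q) - \<Phi> (?E ** Q))) \<le> exp ?K * exp (?s (f (U, Q)))"
          using pt[OF \<open>orthogonal_matrix U\<close> elim] unfolding exp_add[symmetric] by (rule iffD2[OF exp_le_cancel_iff])
        then show ?case by (simp add: ennreal_mult[symmetric] ennreal_leI)
      qed
    qed
    also have "\<dots> = (\<integral>\<^sup>+z. ennreal (exp ?K) * ennreal (exp (?s (f z))) \<partial>(A \<Otimes>\<^sub>M B))"
      by (rule B.nn_integral_fst) measurable
    also have "\<dots> = ennreal (exp ?K) * (\<integral>\<^sup>+Y. ennreal (exp (?s Y)) \<partial>distr (A \<Otimes>\<^sub>M B) borel f)"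
      by (subst nn_integral_cmult, measurable, subst nn_integral_distr) simp_all
    also have "(\<integral>\<^sup>+Y. ennreal (exp (?s Y)) \<partial>distr (A \<Otimes>\<^sub>M B) borel f)
        = ennreal (\<integral>Y. exp (?s Y) \<partial>distr (A \<Otimes>\<^sub>M B) borel f)"
      using P.integrable_exp_entry_sum[of a] unfolding P.entry_sum_def by (intro nn_integral_eq_integral) auto
    also have "ennreal (exp ?K) * \<dots> \<le> ennreal (exp ?K) * ennreal (exp (2 * (t * (pi / 2))\<^sup>2 * r\<^sup>2 / CARD('d)))"
      using a lam by (intro mult_left_mono ennreal_leI P.mgf_bound) auto
    also have "\<dots> = ennreal (exp (?K + pi\<^sup>2 * t\<^sup>2 * r\<^sup>2 / (2 * real CARD('d))))"
      by (simp add: ennreal_mult[symmetric] exp_add power_mult_distrib power_divide mult_ac)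
    finally show ?thesis .
  qed
  finally show ?thesis .
qed

text \<open>
  The passage from Lipschitz to semiconcave functions. The error terms vanish in the limit, so the constant is
  that of a differentiable function with gradient bounded by L.
\<close>

lemma frame_increment_bound:
  fixes F :: "real^'d::finite^'k::finite \<Rightarrow> real" and L t :: real
  assumes kd: "CARD('k) \<le> CARD('d)"
    and \<theta>: "\<theta>0 \<in> stiefel" "\<theta>1 \<in> stiefel"
    and L: "L \<ge> 0" and lip: "\<And>x y. \<bar>F x - F y\<bar> \<le> L * norm (x - y)"
    and inv: "\<And>U x. orthogonal_matrix U \<Longrightarrow> F (U ** x) = F x"
    and B: "prob_space B" "sets B = sets borel" "AE Q in B. orthogonal_matrix (Q :: real^'d^'d)"
      "\<And>R. orthogonal_matrix R \<Longrightarrow> distr B borel (\<lambda>Q. R ** Q) = B"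
    and t: "t \<ge> 0"
  shows "(\<integral>\<^sup>+Q. ennreal (exp (t * (F (\<theta>1 ** Q) - F (\<theta>0 ** Q)))) \<partial>B)
    \<le> ennreal (exp (pi\<^sup>2 * t\<^sup>2 * L\<^sup>2 / (2 * real CARD('d))))"
proof -
  note [measurable_cong] = B(2)
  obtain \<iota> :: "'k \<Rightarrow> 'd" where \<iota>: "inj \<iota>"
    using card_le_inj[of "UNIV :: 'k set" "UNIV :: 'd set"] kd by auto
  obtain S0 S1 R J \<rho> \<phi> where S: "orthogonal_matrix S0" "orthogonal_matrix S1" and R: "orthogonal_matrix R"
    and \<rho>: "inj_on \<rho> J" "\<rho> ` J \<inter> range \<iota> = {}"
    and J: "card J = min CARD('k) (CARD('d) - CARD('k))"
    and \<phi>: "\<And>i. 0 \<le> \<phi> i" "\<And>i. \<phi> i \<le> pi / 2" "\<And>i. i \<notin> J \<Longrightarrow> \<phi> i = 0"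
    and eq: "S0 ** \<theta>0 ** R = coordinate_frame \<iota>" "S1 ** \<theta>1 ** R = rotated_frame \<iota> \<rho> \<phi>"
    by (rule principal_angles[OF \<iota> \<theta>]) (rule that)
  let ?E = "coordinate_frame \<iota> :: real^'d^'k" and ?\<Theta> = "rotated_frame \<iota> \<rho> \<phi> :: real^'d^'k"
  have contF: "continuous_on UNIV F"
  proof -
    have "L-lipschitz_on UNIV F" using L lip by (intro lipschitz_onI) (auto simp: dist_norm)
    then show ?thesis by (rule lipschitz_on_continuous_on)
  qed
  then have [measurable]: "F \<in> borel_measurable borel" by (rule borel_measurable_continuous_onI)
  have "F (\<theta>0 ** Q) = F (?E ** (transpose R ** Q))" "F (\<theta>1 ** Q) = F (?\<Theta> ** (transpose R ** Q))" for Q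
    using inv[OF S(1), of "\<theta>0 ** Q"] inv[OF S(2), of "\<theta>1 ** Q"]
    unfolding eq[symmetric] by (simp_all add: matrix_mul_assoc orthogonal_matrix_cancel R)
  then have "(\<integral>\<^sup>+Q. ennreal (exp (t * (F (\<theta>1 ** Q) - F (\<theta>0 ** Q)))) \<partial>B)
      = (\<integral>\<^sup>+Q. ennreal (exp (t * (F (?\<Theta> ** Q) - F (?E ** Q)))) \<partial>distr B borel (\<lambda>Q. transpose R ** Q))"
    by (subst nn_integral_distr) simp_all
  also have "\<dots> = (\<integral>\<^sup>+Q. ennreal (exp (t * (F (?\<Theta> ** Q) - F (?E ** Q)))) \<partial>B)"
    by (simp add: B(4) R)
  finally have start: "(\<integral>\<^sup>+Q. ennreal (exp (t * (F (\<theta>1 ** Q) - F (\<theta>0 ** Q)))) \<partial>B)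
      = (\<integral>\<^sup>+Q. ennreal (exp (t * (F (?\<Theta> ** Q) - F (?E ** Q)))) \<partial>B)" .
  let ?k = "real CARD('k)" and ?d = "real CARD('d)"
  define u where "u n = t * L\<^sup>2 / (2 * real n) + t * ((2 * (L + 1 / real n ^ 3) + 2 * real n) * ?k / real n ^ 2 + 1 / real n)
      + pi\<^sup>2 * t\<^sup>2 * (L + 1 / real n ^ 3)\<^sup>2 / (2 * ?d)" for n :: nat
  have le: "(\<integral>\<^sup>+Q. ennreal (exp (t * (F (?\<Theta> ** Q) - F (?E ** Q)))) \<partial>B) \<le> ennreal (exp (u n))" if n: "n > 0" for n
  proof -
    \<comment> \<open>With N = n^2 steps, h = 1/n and \<delta> = 1/n^3, every error term is of order 1/n.\<close>
    define h where "h = 1 / real n"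
    define \<delta> where "\<delta> = 1 / real n ^ 3"
    have h: "h > 0" and \<delta>: "\<delta> > 0" using n by (auto simp: h_def \<delta>_def)
    let ?\<Phi> = "inf_convolution h F"
    obtain p where p: "p \<in> borel_measurable borel" "\<And>x. norm (p x) \<le> L + \<delta>"
      "\<And>x y. ?\<Phi> y \<le> ?\<Phi> x + p x \<bullet> (y - x) + (norm (y - x))\<^sup>2 / (2 * h) + \<delta>"
      using inf_convolution_supergradient[OF h L lip \<delta>] by blast
    have \<Phi>m [measurable]: "?\<Phi> \<in> borel_measurable borel"
      by (intro borel_measurable_continuous_onI inf_convolution_continuous[OF h L lip])
    have \<Phi>inv: "?\<Phi> (U ** x) = ?\<Phi> x" if "orthogonal_matrix U" for U x
    proof (rule inf_convolution_invariant[OF h L lip])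
      show "orthogonal_transformation (\<lambda>x :: real^'d^'k. U ** x)"
        unfolding orthogonal_transformation using that
        by (simp add: linear_matrix_mult_left norm_mult_orthogonal_left)
    qed (rule inv[OF that])
    have super: "?\<Phi> y \<le> ?\<Phi> x + p x \<bullet> (y - x) + real n / 2 * (norm (y - x))\<^sup>2 + \<delta>" for x y
      using p(3)[of y x] n by (simp add: h_def mult.commute)
    have N: "n\<^sup>2 > 0" and c: "real n / 2 \<ge> 0" using n by auto
    have "(\<integral>\<^sup>+Q. ennreal (exp (t * (F (?\<Theta> ** Q) - F (?E ** Q)))) \<partial>B)
        \<le> (\<integral>\<^sup>+Q. ennreal (exp (t * L\<^sup>2 / (2 * real n))) * ennreal (exp (t * (?\<Phi> (?\<Theta> ** Q) - ?\<Phi> (?E ** Q)))) \<partial>B)"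
    proof (rule nn_integral_mono)
      fix Q
      have "F (?\<Theta> ** Q) - F (?E ** Q) \<le> L\<^sup>2 * h / 2 + (?\<Phi> (?\<Theta> ** Q) - ?\<Phi> (?E ** Q))"
        using inf_convolution_ge[OF h L lip, of "?\<Theta> ** Q"] inf_convolution_le[OF h L lip, of "?E ** Q"] by linarith
      then have "t * (F (?\<Theta> ** Q) - F (?E ** Q)) \<le> t * (L\<^sup>2 * h / 2 + (?\<Phi> (?\<Theta> ** Q) - ?\<Phi> (?E ** Q)))"
        using t by (rule mult_left_mono)
      also have "\<dots> = t * L\<^sup>2 / (2 * real n) + t * (?\<Phi> (?\<Theta> ** Q) - ?\<Phi> (?E ** Q))"
        by (simp add: h_def distrib_left)
      finally show "ennreal (exp (t * (F (?\<Theta> ** Q) - F (?E ** Q))))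
          \<le> ennreal (exp (t * L\<^sup>2 / (2 * real n))) * ennreal (exp (t * (?\<Phi> (?\<Theta> ** Q) - ?\<Phi> (?E ** Q))))"
        by (simp add: ennreal_mult[symmetric] exp_add[symmetric] ennreal_leI)
    qed
    also have "\<dots> = ennreal (exp (t * L\<^sup>2 / (2 * real n)))
        * (\<integral>\<^sup>+Q. ennreal (exp (t * (?\<Phi> (?\<Theta> ** Q) - ?\<Phi> (?E ** Q)))) \<partial>B)"
      by (rule nn_integral_cmult) measurable
    also have "\<dots> \<le> ennreal (exp (t * L\<^sup>2 / (2 * real n))) * ennreal (exp (t * ((2 * (L + \<delta>) + 4 * (real n / 2)) * ?k / (n\<^sup>2) + (n\<^sup>2) * \<delta>)
        + pi\<^sup>2 * t\<^sup>2 * (L + \<delta>)\<^sup>2 / (2 * ?d)))"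
      by (intro mult_left_mono semiconcave_increment_bound[OF \<iota> \<rho> J \<phi> B p(1,2) \<Phi>m \<Phi>inv super c N t]) auto
    also have "\<dots> = ennreal (exp (u n))"
      using n by (simp add: ennreal_mult[symmetric] exp_add[symmetric] u_def \<delta>_def power2_eq_square power3_eq_cube)
    finally show ?thesis .
  qed
  have "u \<longlonglongrightarrow> pi\<^sup>2 * t\<^sup>2 * L\<^sup>2 / (2 * ?d)"
  proof -
    have "(\<lambda>n. t * L\<^sup>2 / (2 * real n)) \<longlonglongrightarrow> 0" by real_asymp
    moreover have "(\<lambda>n. 1 / real n ^ 3) \<longlonglongrightarrow> 0" by real_asymp
    moreover have "(\<lambda>n. (2 * (L + 1 / real n ^ 3) + 2 * real n) * ?k / real n ^ 2 + 1 / real n) \<longlonglongrightarrow> 0"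
      by real_asymp
    ultimately have "u \<longlonglongrightarrow> 0 + t * 0 + pi\<^sup>2 * t\<^sup>2 * (L + 0)\<^sup>2 / (2 * ?d)"
      unfolding u_def by (intro tendsto_intros) auto
    then show ?thesis by simp
  qed
  then have "(\<lambda>n. ennreal (exp (u n))) \<longlonglongrightarrow> ennreal (exp (pi\<^sup>2 * t\<^sup>2 * L\<^sup>2 / (2 * ?d)))"
    by (intro tendsto_ennrealI tendsto_exp)
  then show ?thesis
    unfolding start by (rule LIMSEQ_le_const) (use le in \<open>auto intro: exI[of _ 1]\<close>)
qed

section \<open>Concentration on the Stiefel manifold\<close>

text \<open>
  An independent copy \<theta>' replaces the mean by Jensen; a common rotation Q of \<theta> and \<theta>' changes nothing
  and, once the integrals are exchanged, reduces the claim to fixed frames.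
\<close>

lemma haar_exp_moment:
  fixes F :: "real^'d::finite^'k::finite \<Rightarrow> real" and L t :: real
  assumes kd: "CARD('k) \<le> CARD('d)"
    and \<mu>: "prob_space \<mu>" "sets \<mu> = sets borel" "AE \<theta> in \<mu>. \<theta> \<in> stiefel"
      "\<And>Q. orthogonal_matrix Q \<Longrightarrow> distr \<mu> borel (\<lambda>\<theta>. \<theta> ** Q) = \<mu>"
    and L: "L \<ge> 0" and lip: "\<And>x y. \<bar>F x - F y\<bar> \<le> L * norm (x - y)"
    and inv: "\<And>U x. orthogonal_matrix U \<Longrightarrow> F (U ** x) = F x"
    and t: "t \<ge> 0"
  shows "(\<integral>\<^sup>+\<theta>. ennreal (exp (t * (F \<theta> - (\<integral>\<theta>'. F \<theta>' \<partial>\<mu>)))) \<partial>\<mu>)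
    \<le> ennreal (exp (pi\<^sup>2 * t\<^sup>2 * L\<^sup>2 / (2 * real CARD('d))))"
proof -
  interpret \<mu>: prob_space \<mu> by fact
  note [measurable_cong] = \<mu>(2)
  obtain B :: "(real^'d^'d) measure" where B: "prob_space B" "sets B = sets borel"
    "AE Q in B. orthogonal_matrix Q" "\<And>R. orthogonal_matrix R \<Longrightarrow> distr B borel (\<lambda>Q. R ** Q) = B"
    using exists_left_invariant_orthogonal by blast
  interpret B: prob_space B by fact
  interpret B\<mu>: pair_prob_space B \<mu> ..
  note [measurable_cong] = B(2)
  have "L-lipschitz_on UNIV F" using L lip by (intro lipschitz_onI) (auto simp: dist_norm)
  then have [measurable]: "F \<in> borel_measurable borel"
    by (intro borel_measurable_continuous_onI lipschitz_on_continuous_on)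
  define b where "b = \<bar>F 0\<bar> + L * sqrt CARD('k)"
  have bF: "\<bar>F \<theta>\<bar> \<le> b" if "\<theta> \<in> stiefel" for \<theta>
  proof -
    have "norm \<theta> = sqrt CARD('k)"
      using that by (simp add: norm_eq_sqrt_inner inner_vec_def[of \<theta>] stiefel_def)
    then show ?thesis using lip[of \<theta> 0] by (simp add: b_def)
  qed
  have intF: "integrable \<mu> F"
    by (rule \<mu>.integrable_const_bound[of _ b]) (use \<mu>(3) bF in auto)
  define m where "m = (\<integral>\<theta>'. F \<theta>' \<partial>\<mu>)"
  define G where "G \<theta> \<theta>' = ennreal (exp (t * (F \<theta> - F \<theta>')))" for \<theta> \<theta>'
  have [measurable]: "(\<lambda>z. G (f z) (g z)) \<in> borel_measurable N"
    if [measurable]: "f \<in> borel_measurable N" "g \<in> borel_measurable N" for f g and N :: "'z measure"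
    unfolding G_def by measurable
  have jensen: "ennreal (exp (t * (F \<theta> - m))) \<le> (\<integral>\<^sup>+\<theta>'. G \<theta> \<theta>' \<partial>\<mu>)" for \<theta>
  proof -
    have int: "integrable \<mu> (\<lambda>\<theta>'. exp (t * (F \<theta> - F \<theta>')))"
    proof (rule \<mu>.integrable_const_bound)
      show "AE \<theta>' in \<mu>. norm (exp (t * (F \<theta> - F \<theta>'))) \<le> exp (t * (F \<theta> + b))"
        using \<mu>(3)
      proof eventually_elim
        case (elim \<theta>')
        then have "F \<theta> - F \<theta>' \<le> F \<theta> + b" using bF[of \<theta>'] by linarith
        then show ?case using t by (simp add: mult_left_mono)
      qed
    qed simp
    have "exp (t * (F \<theta> - m)) = (\<integral>\<theta>'. exp (t * (F \<theta> - m)) * (1 + t * (m - F \<theta>')) \<partial>\<mu>)"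
      using intF by (simp add: m_def \<mu>.prob_space)
    also have "\<dots> \<le> (\<integral>\<theta>'. exp (t * (F \<theta> - F \<theta>')) \<partial>\<mu>)"
    proof (rule integral_mono)
      fix \<theta>'
      have "exp (t * (F \<theta> - m)) * (1 + t * (m - F \<theta>')) \<le> exp (t * (F \<theta> - m)) * exp (t * (m - F \<theta>'))"
        by (intro mult_left_mono exp_ge_add_one_self) simp
      also have "\<dots> = exp (t * (F \<theta> - F \<theta>'))" by (simp add: exp_add[symmetric] algebra_simps)
      finally show "exp (t * (F \<theta> - m)) * (1 + t * (m - F \<theta>')) \<le> exp (t * (F \<theta> - F \<theta>'))" .
    qed (use intF int in auto)
    finally show ?thesis
      using int by (simp add: G_def nn_integral_eq_integral ennreal_leI)
  qed
  have rot: "(\<integral>\<^sup>+\<theta>. g (\<theta> ** Q) \<partial>\<mu>) = (\<integral>\<^sup>+\<theta>. g \<theta> \<partial>\<mu>)"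
    if "orthogonal_matrix Q" and [measurable]: "g \<in> borel_measurable borel" for Q and g :: "real^'d^'k \<Rightarrow> ennreal"
  proof -
    have "(\<integral>\<^sup>+\<theta>. g \<theta> \<partial>\<mu>) = (\<integral>\<^sup>+\<theta>. g \<theta> \<partial>distr \<mu> borel (\<lambda>\<theta>. \<theta> ** Q))" by (simp add: \<mu>(4) that(1))
    also have "\<dots> = (\<integral>\<^sup>+\<theta>. g (\<theta> ** Q) \<partial>\<mu>)" by (subst nn_integral_distr) simp_all
    finally show ?thesis by simp
  qed
  have "(\<integral>\<^sup>+\<theta>. ennreal (exp (t * (F \<theta> - m))) \<partial>\<mu>) \<le> (\<integral>\<^sup>+\<theta>. \<integral>\<^sup>+\<theta>'. G \<theta> \<theta>' \<partial>\<mu> \<partial>\<mu>)"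
    by (intro nn_integral_mono jensen)
  also have "\<dots> = (\<integral>\<^sup>+Q. (\<integral>\<^sup>+\<theta>. \<integral>\<^sup>+\<theta>'. G \<theta> \<theta>' \<partial>\<mu> \<partial>\<mu>) \<partial>B)" by (simp add: B.emeasure_space_1)
  also have "\<dots> = (\<integral>\<^sup>+Q. (\<integral>\<^sup>+\<theta>. \<integral>\<^sup>+\<theta>'. G (\<theta> ** Q) (\<theta>' ** Q) \<partial>\<mu> \<partial>\<mu>) \<partial>B)"
  proof (rule nn_integral_cong_AE, use B(3) in eventually_elim)
    case (elim Q)
    have "(\<integral>\<^sup>+\<theta>. \<integral>\<^sup>+\<theta>'. G (\<theta> ** Q) (\<theta>' ** Q) \<partial>\<mu> \<partial>\<mu>) = (\<integral>\<^sup>+\<theta>. \<integral>\<^sup>+\<theta>'. G (\<theta> ** Q) \<theta>' \<partial>\<mu> \<partial>\<mu>)"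
      by (intro nn_integral_cong rot[OF elim]) measurable
    also have "\<dots> = (\<integral>\<^sup>+\<theta>. \<integral>\<^sup>+\<theta>'. G \<theta> \<theta>' \<partial>\<mu> \<partial>\<mu>)"
      by (rule rot[OF elim, of "\<lambda>\<theta>. \<integral>\<^sup>+\<theta>'. G \<theta> \<theta>' \<partial>\<mu>"]) measurable
    finally show ?case by simp
  qed
  also have "\<dots> = (\<integral>\<^sup>+\<theta>. \<integral>\<^sup>+Q. \<integral>\<^sup>+\<theta>'. G (\<theta> ** Q) (\<theta>' ** Q) \<partial>\<mu> \<partial>B \<partial>\<mu>)"
    by (rule B\<mu>.Fubini'[symmetric]) measurable
  also have "\<dots> = (\<integral>\<^sup>+\<theta>. \<integral>\<^sup>+\<theta>'. \<integral>\<^sup>+Q. G (\<theta> ** Q) (\<theta>' ** Q) \<partial>B \<partial>\<mu> \<partial>\<mu>)"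
    by (intro nn_integral_cong B\<mu>.Fubini'[symmetric]) measurable
  also have "\<dots> \<le> (\<integral>\<^sup>+\<theta>. \<integral>\<^sup>+\<theta>'. ennreal (exp (pi\<^sup>2 * t\<^sup>2 * L\<^sup>2 / (2 * real CARD('d)))) \<partial>\<mu> \<partial>\<mu>)"
  proof (rule nn_integral_mono_AE, use \<mu>(3) in eventually_elim)
    case (elim \<theta>)
    show ?case
    proof (rule nn_integral_mono_AE, use \<mu>(3) in eventually_elim)
      case (elim \<theta>')
      show ?case
        unfolding G_def
        by (rule frame_increment_bound[OF kd elim \<open>\<theta> \<in> stiefel\<close> L lip inv B t])
    qed
  qed
  also have "\<dots> = ennreal (exp (pi\<^sup>2 * t\<^sup>2 * L\<^sup>2 / (2 * real CARD('d))))" by (simp add: \<mu>.emeasure_space_1)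
  finally show ?thesis by (simp add: m_def)
qed

lemma haar_upper_tail:
  fixes F :: "real^'d::finite^'k::finite \<Rightarrow> real" and L \<epsilon> :: real
  assumes kd: "CARD('k) \<le> CARD('d)"
    and \<mu>: "prob_space \<mu>" "sets \<mu> = sets borel" "AE \<theta> in \<mu>. \<theta> \<in> stiefel"
      "\<And>Q. orthogonal_matrix Q \<Longrightarrow> distr \<mu> borel (\<lambda>\<theta>. \<theta> ** Q) = \<mu>"
    and L: "L > 0" and lip: "\<And>x y. \<bar>F x - F y\<bar> \<le> L * norm (x - y)"
    and inv: "\<And>U x. orthogonal_matrix U \<Longrightarrow> F (U ** x) = F x"
    and \<epsilon>: "\<epsilon> > 0"
  shows "measure \<mu> {\<theta> \<in> space \<mu>. F \<theta> - (\<integral>\<theta>'. F \<theta>' \<partial>\<mu>) > \<epsilon>} \<le> exp (- (real CARD('d) * \<epsilon>\<^sup>2 / (2 * pi\<^sup>2 * L\<^sup>2)))"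
proof -
  interpret \<mu>: prob_space \<mu> by fact
  note [measurable_cong] = \<mu>(2)
  have "L-lipschitz_on UNIV F" using L lip by (intro lipschitz_onI) (auto simp: dist_norm)
  then have [measurable]: "F \<in> borel_measurable borel"
    by (intro borel_measurable_continuous_onI lipschitz_on_continuous_on)
  let ?d = "real CARD('d)" and ?m = "\<integral>\<theta>'. F \<theta>' \<partial>\<mu>"
  \<comment> \<open>The minimiser of - t \<epsilon> + \<pi>^2 t^2 L^2 / (2 d).\<close>
  define t where "t = ?d * \<epsilon> / (pi\<^sup>2 * L\<^sup>2)"
  have t: "t \<ge> 0" using \<epsilon> by (simp add: t_def)
  have "emeasure \<mu> {\<theta> \<in> space \<mu>. F \<theta> - ?m > \<epsilon>}
      \<le> emeasure \<mu> {\<theta> \<in> space \<mu>. 1 \<le> ennreal (exp (- (t * \<epsilon>))) * ennreal (exp (t * (F \<theta> - ?m)))}"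
  proof (rule emeasure_mono)
    show "{\<theta> \<in> space \<mu>. F \<theta> - ?m > \<epsilon>} \<subseteq> {\<theta> \<in> space \<mu>. 1 \<le> ennreal (exp (- (t * \<epsilon>))) * ennreal (exp (t * (F \<theta> - ?m)))}"
    proof safe
      fix \<theta> assume "\<epsilon> < F \<theta> - ?m"
      then have "t * \<epsilon> \<le> t * (F \<theta> - ?m)" using t by (intro mult_left_mono) auto
      then have "1 \<le> exp (- (t * \<epsilon>) + t * (F \<theta> - ?m))" by simp
      then show "1 \<le> ennreal (exp (- (t * \<epsilon>))) * ennreal (exp (t * (F \<theta> - ?m)))"
        by (simp add: ennreal_mult[symmetric] exp_add[symmetric])
    qed
  qed measurable
  also have "\<dots> \<le> ennreal (exp (- (t * \<epsilon>))) * (\<integral>\<^sup>+\<theta>. ennreal (exp (t * (F \<theta> - ?m))) * indicator (space \<mu>) \<theta> \<partial>\<mu>)"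
    by (rule nn_integral_Markov_inequality) simp_all
  also have "(\<integral>\<^sup>+\<theta>. ennreal (exp (t * (F \<theta> - ?m))) * indicator (space \<mu>) \<theta> \<partial>\<mu>)
      = (\<integral>\<^sup>+\<theta>. ennreal (exp (t * (F \<theta> - ?m))) \<partial>\<mu>)"
    by (rule nn_integral_cong) simp
  also have "ennreal (exp (- (t * \<epsilon>))) * \<dots> \<le> ennreal (exp (- (t * \<epsilon>))) * ennreal (exp (pi\<^sup>2 * t\<^sup>2 * L\<^sup>2 / (2 * ?d)))"
    by (rule mult_left_mono, rule haar_exp_moment[OF kd \<mu>]) (use L lip inv t in auto)
  also have "\<dots> = ennreal (exp (- (t * \<epsilon>) + pi\<^sup>2 * t\<^sup>2 * L\<^sup>2 / (2 * ?d)))"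
    by (simp add: ennreal_mult[symmetric] exp_add[symmetric])
  also have "- (t * \<epsilon>) + pi\<^sup>2 * t\<^sup>2 * L\<^sup>2 / (2 * ?d) = - (?d * \<epsilon>\<^sup>2 / (2 * pi\<^sup>2 * L\<^sup>2))"
    using L by (simp add: t_def power2_eq_square field_simps)
  finally show ?thesis by (simp add: \<mu>.emeasure_eq_measure)
qed

lemma haar_concentration:
  fixes F :: "real^'d::finite^'k::finite \<Rightarrow> real" and L \<epsilon> :: real
  assumes kd: "CARD('k) \<le> CARD('d)"
    and \<mu>: "prob_space \<mu>" "sets \<mu> = sets borel" "AE \<theta> in \<mu>. \<theta> \<in> stiefel"
      "\<And>Q. orthogonal_matrix Q \<Longrightarrow> distr \<mu> borel (\<lambda>\<theta>. \<theta> ** Q) = \<mu>"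
    and L: "L > 0" and lip: "\<And>x y. \<bar>F x - F y\<bar> \<le> L * norm (x - y)"
    and inv: "\<And>U x. orthogonal_matrix U \<Longrightarrow> F (U ** x) = F x"
    and \<epsilon>: "\<epsilon> > 0"
  shows "measure \<mu> {\<theta> \<in> space \<mu>. \<bar>F \<theta> - (\<integral>\<theta>'. F \<theta>' \<partial>\<mu>)\<bar> > \<epsilon>} \<le> 2 * exp (- (real CARD('d) * \<epsilon>\<^sup>2 / (2 * pi\<^sup>2 * L\<^sup>2)))"
proof -
  interpret \<mu>: prob_space \<mu> by fact
  note [measurable_cong] = \<mu>(2)
  have "L-lipschitz_on UNIV F" using L lip by (intro lipschitz_onI) (auto simp: dist_norm)
  then have [measurable]: "F \<in> borel_measurable borel"
    by (intro borel_measurable_continuous_onI lipschitz_on_continuous_on)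
  let ?A = "\<lambda>F :: real^'d^'k \<Rightarrow> real. {\<theta> \<in> space \<mu>. F \<theta> - (\<integral>\<theta>'. F \<theta>' \<partial>\<mu>) > \<epsilon>}"
  have "\<bar>- F x - - F y\<bar> \<le> L * norm (x - y)" for x y using lip[of y x] by (simp add: norm_minus_commute)
  then have "measure \<mu> (?A (\<lambda>\<theta>. - F \<theta>)) \<le> exp (- (real CARD('d) * \<epsilon>\<^sup>2 / (2 * pi\<^sup>2 * L\<^sup>2)))"
    using inv by (intro haar_upper_tail[OF kd \<mu> L _ _ \<epsilon>]) auto
  moreover have "measure \<mu> (?A F) \<le> exp (- (real CARD('d) * \<epsilon>\<^sup>2 / (2 * pi\<^sup>2 * L\<^sup>2)))"
    by (rule haar_upper_tail[OF kd \<mu> L lip inv \<epsilon>])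
  moreover have eq: "{\<theta> \<in> space \<mu>. \<bar>F \<theta> - (\<integral>\<theta>'. F \<theta>' \<partial>\<mu>)\<bar> > \<epsilon>} = ?A F \<union> ?A (\<lambda>\<theta>. - F \<theta>)"
    by auto
  moreover have "measure \<mu> (?A F \<union> ?A (\<lambda>\<theta>. - F \<theta>)) \<le> measure \<mu> (?A F) + measure \<mu> (?A (\<lambda>\<theta>. - F \<theta>))"
    by (rule measure_Un_le) measurable
  ultimately show ?thesis unfolding eq by linarith
qed

section \<open>Rotation invariance of the normal law\<close>

lemma Basis_vec_real: "(Basis :: (real^'k) set) = range (\<lambda>j. axis j 1)"
  by (auto simp: Basis_vec_def)

lemma prod_Basis_vec: "(\<Prod>b\<in>(Basis :: (real^'k) set). g b) = (\<Prod>j\<in>UNIV. g (axis j 1))"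
  unfolding Basis_vec_real by (subst prod.reindex) (auto simp: inj_on_def axis_eq_axis)

lemma std_normal_vector_measurable:
  assumes "std_normal_vector M Z"
  shows "Z \<in> borel_measurable M"
  using assms
  by (intro borel_measurable_vecI) (auto simp: std_normal_vector_def dest!: distributed_measurable)

text \<open>
  Both measures are products on boxes.
\<close>

lemma std_normal_vector_law:
  fixes Z :: "'a \<Rightarrow> real^'k"
  assumes Z: "std_normal_vector M Z"
  shows "distr M borel Z = density lborel (\<lambda>z. \<Prod>b\<in>Basis. ennreal (std_normal_density (z \<bullet> b)))"
    (is "?L = ?R")
proof (rule measure_eqI_generator_eq)
  interpret M: prob_space M using Z by (simp add: std_normal_vector_def)
  note [measurable] = std_normal_vector_measurable[OF Z]
  have ind: "M.indep_vars (\<lambda>_. borel) (\<lambda>j \<omega>. Z \<omega> $ j) UNIV"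
    and dens: "distributed M lborel (\<lambda>\<omega>. Z \<omega> $ j) std_normal_density" for j
    using Z by (auto simp: std_normal_vector_def)
  let ?E = "range (\<lambda>(a, b). box a b :: (real^'k) set)"
  show "Int_stable ?E"
    by (auto simp: Int_stable_def box_Int_box)
  show "?E \<subseteq> Pow UNIV" "sets ?L = sigma_sets UNIV ?E" "sets ?R = sigma_sets UNIV ?E"
    by (simp_all add: borel_eq_box)
  let ?A = "\<lambda>n::nat. box (- (real n *\<^sub>R One)) (real n *\<^sub>R One) :: (real^'k) set"
  show "range ?A \<subseteq> ?E" "(\<Union>i. ?A i) = UNIV"
    unfolding UN_box_eq_UNIV by auto
  show "emeasure ?L (?A i) \<noteq> \<infinity>" for i
    by (subst emeasure_distr) (auto simp: M.emeasure_eq_measure)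
  fix X assume "X \<in> ?E"
  then obtain l u where X: "X = box l u" by auto
  have "Z -` box l u \<inter> space M = (\<Inter>j\<in>UNIV. (\<lambda>\<omega>. Z \<omega> $ j) -` {l $ j<..<u $ j} \<inter> space M)"
    by (auto simp: mem_box_cart)
  then have "emeasure ?L X = ennreal (M.prob (\<Inter>j\<in>UNIV. (\<lambda>\<omega>. Z \<omega> $ j) -` {l $ j<..<u $ j} \<inter> space M))"
    unfolding X by (subst emeasure_distr) (simp_all add: M.emeasure_eq_measure)
  also have "\<dots> = ennreal (\<Prod>j\<in>UNIV. M.prob ((\<lambda>\<omega>. Z \<omega> $ j) -` {l $ j<..<u $ j} \<inter> space M))"
    by (subst M.indep_varsD_finite[OF ind]) auto
  also have "\<dots> = (\<Prod>j\<in>UNIV. emeasure M ((\<lambda>\<omega>. Z \<omega> $ j) -` {l $ j<..<u $ j} \<inter> space M))"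
    by (simp add: M.emeasure_eq_measure prod_ennreal)
  also have "\<dots> = (\<Prod>j\<in>UNIV. \<integral>\<^sup>+x. ennreal (std_normal_density x) * indicator {l $ j<..<u $ j} x \<partial>lborel)"
    by (intro prod.cong refl distributed_emeasure[OF dens]) simp
  also have "\<dots> = (\<Prod>b\<in>(Basis :: (real^'k) set). \<integral>\<^sup>+x. ennreal (std_normal_density x) * indicator {l \<bullet> b<..<u \<bullet> b} x \<partial>lborel)"
    by (simp add: prod_Basis_vec inner_axis)
  also have "\<dots> = (\<integral>\<^sup>+z. (\<Prod>b\<in>Basis. ennreal (std_normal_density (z \<bullet> b)) * indicator {l \<bullet> b<..<u \<bullet> b} (z \<bullet> b)) \<partial>lborel)"
    by (subst nn_integral_lborel_prod) simp_all
  also have "\<dots> = emeasure ?R X"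
  proof -
    have "(\<Prod>b\<in>Basis. indicator {l \<bullet> b<..<u \<bullet> b} (z \<bullet> b)) = (indicator (box l u) z :: ennreal)" for z :: "real^'k"
      by (auto simp: box_def split: split_indicator)
    then show ?thesis unfolding X by (simp add: emeasure_density prod.distrib)
  qed
  finally show "emeasure ?L X = emeasure ?R X" .
qed

lemma std_normal_vector_rotate:
  fixes Z :: "'a \<Rightarrow> real^'k"
  assumes Z: "std_normal_vector M Z" and U: "orthogonal_matrix U"
  shows "distr M borel (\<lambda>\<omega>. U *v Z \<omega>) = distr M borel Z"
proof -
  have [measurable]: "Z \<in> borel_measurable M" by (rule std_normal_vector_measurable[OF Z])
  have f: "orthogonal_transformation (\<lambda>z. U *v z)"
    using orthogonal_transformation_vector_matrix_mult[of "transpose U"] U by simp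
  have [measurable]: "(\<lambda>z. U *v z) \<in> borel_measurable borel"
    by (intro borel_measurable_continuous_onI linear_continuous_on) simp
  have dens: "(\<Prod>b\<in>Basis. ennreal (std_normal_density (z \<bullet> b)))
      = ennreal ((1 / sqrt (2 * pi)) ^ CARD('k) * exp (- (norm z)\<^sup>2 / 2))" for z :: "real^'k"
  proof -
    have "(\<Prod>b\<in>Basis. std_normal_density (z \<bullet> b)) = (1 / sqrt (2 * pi)) ^ CARD('k) * exp (\<Sum>b\<in>Basis. - (z \<bullet> b)\<^sup>2 / 2)"
      unfolding std_normal_density_def prod.distrib by (simp add: exp_sum)
    also have "(\<Sum>b\<in>Basis. - (z \<bullet> b)\<^sup>2 / 2) = - (norm z)\<^sup>2 / 2"
    proof -
      have "(norm z)\<^sup>2 = (\<Sum>b\<in>Basis. (z \<bullet> b)\<^sup>2)"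
        unfolding power2_norm_eq_inner euclidean_inner[of z z] by (simp add: power2_eq_square)
      then show ?thesis by (simp add: sum_negf sum_divide_distrib)
    qed
    finally show ?thesis by (simp add: prod_ennreal)
  qed
  have "distr M borel (\<lambda>\<omega>. U *v Z \<omega>) = distr (distr M borel Z) borel (\<lambda>z. U *v z)"
    by (subst distr_distr) (simp_all add: comp_def)
  also have "\<dots> = distr M borel Z"
    unfolding std_normal_vector_law[OF Z]
  proof (rule distr_density_lborel_orthogonal[OF f])
    show "(\<Prod>b\<in>Basis. ennreal (std_normal_density ((U *v z) \<bullet> b))) = (\<Prod>b\<in>Basis. ennreal (std_normal_density (z \<bullet> b)))" for z
      using f by (simp add: dens orthogonal_transformation)
  qed simp
  finally show ?thesis .
qed

section \<open>The bounded-Lipschitz distance as a function of the frame\<close>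

lemma bl_norm_le_1_measurable:
  fixes f :: "real^'k \<Rightarrow> real"
  assumes "bl_norm f \<le> 1"
  shows "f \<in> borel_measurable borel"
proof -
  have "1-lipschitz_on UNIV f" using assms by (intro lipschitz_onI) (auto simp: bl_norm_le_1_iff dist_norm)
  then show ?thesis by (intro borel_measurable_continuous_onI lipschitz_on_continuous_on)
qed

lemma frame_coords_mult: "frame_coords (U ** \<theta>) v = U *v frame_coords \<theta> v"
proof (rule iffD2[OF vec_eq_iff], rule allI)
  fix j
  have "frame_coords (U ** \<theta>) v $ j = (U $ j v* \<theta>) \<bullet> v"
    by (simp add: frame_coords_def matrix_mult_row inner_commute)
  also have "\<dots> = U $ j \<bullet> (\<theta> *v v)" by (rule dot_lmul_matrix)
  also have "\<theta> *v v = frame_coords \<theta> v"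
    by (simp add: frame_coords_def matrix_mult_dot inner_commute)
  finally show "frame_coords (U ** \<theta>) v $ j = (U *v frame_coords \<theta> v) $ j"
    by (simp add: matrix_vector_mul_component)
qed

text \<open>
  Precomposition with U maps the test functions onto themselves, and U Z has the law of Z.
\<close>

lemma proj_bl_dist_frame_invariant:
  fixes Z :: "'a \<Rightarrow> real^'k" and \<theta> :: "real^'d^'k"
  assumes n: "n \<ge> 1" and Z: "std_normal_vector M Z" and U: "orthogonal_matrix U"
  shows "proj_bl_dist n x M (\<lambda>w. \<sigma> *\<^sub>R Z w) (U ** \<theta>) = proj_bl_dist n x M (\<lambda>w. \<sigma> *\<^sub>R Z w) \<theta>"
proof -
  have M: "prob_space M" using Z by (simp add: std_normal_vector_def)
  have [measurable]: "Z \<in> borel_measurable M" by (rule std_normal_vector_measurable[OF Z])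
  let ?v = "\<lambda>f \<theta>. \<bar>1 / real n * (\<Sum>i = 1..n. f (frame_coords \<theta> (x i))) - (\<integral>\<omega>. f (\<sigma> *\<^sub>R Z \<omega>) \<partial>M)\<bar>"
  have le: "proj_bl_dist n x M (\<lambda>w. \<sigma> *\<^sub>R Z w) (U ** \<theta>) \<le> proj_bl_dist n x M (\<lambda>w. \<sigma> *\<^sub>R Z w) \<theta>"
    if U: "orthogonal_matrix U" for U and \<theta> :: "real^'d^'k"
    unfolding proj_bl_dist_def
  proof (rule cSUP_mono)
    show "{f :: real^'k \<Rightarrow> real. bl_norm f \<le> 1} \<noteq> {}"
      by (auto simp: bl_norm_le_1_iff intro!: exI[of _ "\<lambda>_. 0"])
    show "bdd_above ((\<lambda>f. ?v f \<theta>) ` {f. bl_norm f \<le> 1})"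
      by (rule proj_bl_dist_bdd_above[OF n M])
    fix f :: "real^'k \<Rightarrow> real" assume f: "f \<in> {f. bl_norm f \<le> 1}"
    have [measurable]: "f \<in> borel_measurable borel" using f bl_norm_le_1_measurable by auto
    have nU: "norm (U *v y - U *v z) = norm (y - z)" for y z
      using orthogonal_transformation_vector_matrix_mult[of "transpose U"] U
      by (simp add: matrix_vector_mult_diff_distrib[symmetric] orthogonal_transformation)
    have [measurable]: "(\<lambda>z. U *v z) \<in> borel_measurable borel"
      by (intro borel_measurable_continuous_onI linear_continuous_on) simp
    have "\<bar>f (U *v y) - f (U *v z)\<bar> \<le> norm (y - z)" for y z
    proof -
      have "\<bar>f (U *v y) - f (U *v z)\<bar> \<le> norm (U *v y - U *v z)"
        using f by (simp add: bl_norm_le_1_iff)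
      then show ?thesis by (simp only: nU)
    qed
    then have g: "(\<lambda>z. f (U *v z)) \<in> {f. bl_norm f \<le> 1}"
      using f by (simp add: bl_norm_le_1_iff)
    have "(\<integral>\<omega>. f (\<sigma> *\<^sub>R Z \<omega>) \<partial>M) = (\<integral>z. f (\<sigma> *\<^sub>R z) \<partial>distr M borel (\<lambda>\<omega>. U *v Z \<omega>))"
      unfolding std_normal_vector_rotate[OF Z U] by (subst integral_distr) simp_all
    also have "\<dots> = (\<integral>\<omega>. f (U *v (\<sigma> *\<^sub>R Z \<omega>)) \<partial>M)"
      by (subst integral_distr) (simp_all add: matrix_vector_mult_scaleR)
    finally have "?v f (U ** \<theta>) = ?v (\<lambda>z. f (U *v z)) \<theta>" by (simp add: frame_coords_mult)
    then show "\<exists>g\<in>{f. bl_norm f \<le> 1}. ?v f (U ** \<theta>) \<le> ?v g \<theta>" using g by force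
  qed
  have "transpose U ** (U ** \<theta>) = \<theta>" using U by (rule orthogonal_matrix_cancel)
  then show ?thesis
    using le[OF U, of \<theta>] le[of "transpose U" "U ** \<theta>"] U by simp
qed

text \<open>
  For a single test function, the change is at most the mean distance between corresponding projected points, hence at most
  their root mean square distance, whose square is the sum over the frame vectors of the second moments in
  the directions by which they move.
\<close>

lemma proj_bl_dist_lipschitz:
  fixes W :: "'a \<Rightarrow> real^'k" and x :: "nat \<Rightarrow> real^'d" and \<theta> \<theta>' :: "real^'d^'k"
  assumes n: "n \<ge> 1" and M: "prob_space M"
    and B: "\<And>v. 1 / real n * (\<Sum>i = 1..n. (v \<bullet> x i)\<^sup>2) \<le> B * (norm v)\<^sup>2"
  shows "\<bar>proj_bl_dist n x M W \<theta> - proj_bl_dist n x M W \<theta>'\<bar> \<le> sqrt B * norm (\<theta> - \<theta>')"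
proof -
  let ?v = "\<lambda>f \<theta>. \<bar>1 / real n * (\<Sum>i = 1..n. f (frame_coords \<theta> (x i))) - (\<integral>\<omega>. f (W \<omega>) \<partial>M)\<bar>"
  have *: "proj_bl_dist n x M W \<theta> \<le> proj_bl_dist n x M W \<theta>' + sqrt B * norm (\<theta> - \<theta>')" for \<theta> \<theta>' :: "real^'d^'k"
    unfolding proj_bl_dist_def[of n x M W \<theta>]
  proof (rule cSUP_least)
    show "{f :: real^'k \<Rightarrow> real. bl_norm f \<le> 1} \<noteq> {}"
      by (auto simp: bl_norm_le_1_iff intro!: exI[of _ "\<lambda>_. 0"])
    fix f :: "real^'k \<Rightarrow> real" assume f: "f \<in> {f. bl_norm f \<le> 1}"
    let ?a = "\<lambda>i. norm (frame_coords \<theta> (x i) - frame_coords \<theta>' (x i))"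
    have "(?a i)\<^sup>2 = (\<Sum>j\<in>UNIV. ((\<theta> - \<theta>') $ j \<bullet> x i)\<^sup>2)" for i
      unfolding power2_norm_eq_inner inner_vec_def[of "frame_coords _ _ - _"]
      by (simp add: frame_coords_def power2_eq_square inner_diff_left inner_diff_right inner_commute)
    then have "1 / real n * (\<Sum>i = 1..n. (?a i)\<^sup>2) = (\<Sum>j\<in>UNIV. 1 / real n * (\<Sum>i = 1..n. ((\<theta> - \<theta>') $ j \<bullet> x i)\<^sup>2))"
      by (simp add: sum_distrib_left sum.swap[of _ "UNIV :: 'k set"])
    also have "\<dots> \<le> (\<Sum>j\<in>UNIV. B * (norm ((\<theta> - \<theta>') $ j))\<^sup>2)" by (intro sum_mono B)
    also have "\<dots> = B * (norm (\<theta> - \<theta>'))\<^sup>2"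
      by (simp add: sum_distrib_left[symmetric] power2_norm_eq_inner inner_vec_def[of "\<theta> - \<theta>'"])
    finally have sq: "1 / real n * (\<Sum>i = 1..n. (?a i)\<^sup>2) \<le> B * (norm (\<theta> - \<theta>'))\<^sup>2" .
    have "(1 / real n * (\<Sum>i = 1..n. ?a i))\<^sup>2 \<le> (1 / real n)\<^sup>2 * ((\<Sum>i = 1..n. (?a i)\<^sup>2) * real n)"
      unfolding power_mult_distrib using sum_squared_le_sum_of_squares[of ?a "{1..n}"]
      by (intro mult_left_mono) simp_all
    also have "\<dots> = 1 / real n * (\<Sum>i = 1..n. (?a i)\<^sup>2)" using n by (simp add: power2_eq_square)
    also note sq
    finally have "sqrt ((1 / real n * (\<Sum>i = 1..n. ?a i))\<^sup>2) \<le> sqrt (B * (norm (\<theta> - \<theta>'))\<^sup>2)"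
      by (rule real_sqrt_le_mono)
    then have mean: "1 / real n * (\<Sum>i = 1..n. ?a i) \<le> sqrt B * norm (\<theta> - \<theta>')"
      by (simp add: real_sqrt_mult sum_nonneg)
    have "\<bar>(\<Sum>i = 1..n. f (frame_coords \<theta> (x i))) - (\<Sum>i = 1..n. f (frame_coords \<theta>' (x i)))\<bar> \<le> (\<Sum>i = 1..n. ?a i)"
      unfolding sum_subtractf[symmetric]
      using f by (intro order_trans[OF sum_abs] sum_mono) (simp add: bl_norm_le_1_iff)
    then have "1 / real n * \<bar>(\<Sum>i = 1..n. f (frame_coords \<theta> (x i))) - (\<Sum>i = 1..n. f (frame_coords \<theta>' (x i)))\<bar>
        \<le> 1 / real n * (\<Sum>i = 1..n. ?a i)"
      by (rule mult_left_mono) simp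
    then have "\<bar>1 / real n * (\<Sum>i = 1..n. f (frame_coords \<theta> (x i))) - 1 / real n * (\<Sum>i = 1..n. f (frame_coords \<theta>' (x i)))\<bar>
        \<le> sqrt B * norm (\<theta> - \<theta>')"
      using mean unfolding right_diff_distrib[symmetric] abs_mult by simp
    moreover have "?v f \<theta>' \<le> proj_bl_dist n x M W \<theta>'"
      unfolding proj_bl_dist_def by (rule cSUP_upper[OF f proj_bl_dist_bdd_above[OF n M]])
    ultimately show "?v f \<theta> \<le> proj_bl_dist n x M W \<theta>' + sqrt B * norm (\<theta> - \<theta>')" by linarith
  qed
  show ?thesis
    using *[of \<theta> \<theta>'] *[of \<theta>' \<theta>] by (simp add: abs_le_iff norm_minus_commute)
qed

lemma directional_second_moment_bound:
  fixes x :: "nat \<Rightarrow> real^'d"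
  assumes B: "B = (SUP \<xi> \<in> sphere 0 1. 1 / real n * (\<Sum>i = 1..n. (\<xi> \<bullet> x i)\<^sup>2))"
  shows "1 / real n * (\<Sum>i = 1..n. (v \<bullet> x i)\<^sup>2) \<le> B * (norm v)\<^sup>2"
proof (cases "v = 0")
  case False
  have bdd: "bdd_above ((\<lambda>\<xi>. 1 / real n * (\<Sum>i = 1..n. (\<xi> \<bullet> x i)\<^sup>2)) ` sphere 0 1)"
  proof (rule bdd_aboveI2)
    fix \<xi> :: "real^'d" assume "\<xi> \<in> sphere 0 1"
    then have "\<bar>\<xi> \<bullet> x i\<bar> \<le> norm (x i)" for i using Cauchy_Schwarz_ineq2[of \<xi> "x i"] by simp
    then show "1 / real n * (\<Sum>i = 1..n. (\<xi> \<bullet> x i)\<^sup>2) \<le> 1 / real n * (\<Sum>i = 1..n. (norm (x i))\<^sup>2)"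
      by (intro mult_left_mono sum_mono) (auto intro: abs_le_square_iff[THEN iffD1])
  qed
  let ?\<xi> = "v /\<^sub>R norm v"
  have "?\<xi> \<in> sphere 0 1" using False by simp
  then have "1 / real n * (\<Sum>i = 1..n. (?\<xi> \<bullet> x i)\<^sup>2) \<le> B"
    unfolding B by (rule cSUP_upper[OF _ bdd])
  then have "(1 / real n * (\<Sum>i = 1..n. (?\<xi> \<bullet> x i)\<^sup>2)) * (norm v)\<^sup>2 \<le> B * (norm v)\<^sup>2"
    by (rule mult_right_mono) simp
  moreover have "(1 / real n * (\<Sum>i = 1..n. (?\<xi> \<bullet> x i)\<^sup>2)) * (norm v)\<^sup>2 = 1 / real n * (\<Sum>i = 1..n. (v \<bullet> x i)\<^sup>2)"
  proof -
    have "(?\<xi> \<bullet> x i)\<^sup>2 = (v \<bullet> x i)\<^sup>2 / (norm v)\<^sup>2" for i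
      by (simp add: power_mult_distrib power_inverse divide_inverse mult.commute)
    then show ?thesis using False by (simp add: sum_divide_distrib[symmetric])
  qed
  ultimately show ?thesis by linarith
qed simp

text \<open>
  The mean of the second moments over the coordinate axes is \<sigma>^2.
\<close>

lemma directional_second_moment_pos:
  fixes x :: "nat \<Rightarrow> real^'d"
  assumes B: "\<And>v. 1 / real n * (\<Sum>i = 1..n. (v \<bullet> x i)\<^sup>2) \<le> B * (norm v)\<^sup>2"
    and \<sigma>: "\<sigma> > 0" and x: "1 / real n * (\<Sum>i = 1..n. (norm (x i))\<^sup>2) = \<sigma>\<^sup>2 * real CARD('d)"
  shows "B > 0"
proof -
  have "(norm (x i))\<^sup>2 = (\<Sum>j\<in>UNIV. (axis j 1 \<bullet> x i)\<^sup>2)" for i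
    unfolding power2_norm_eq_inner inner_vec_def[of "x i"] by (simp add: inner_axis' power2_eq_square)
  then have "\<sigma>\<^sup>2 * real CARD('d) = (\<Sum>j\<in>UNIV. 1 / real n * (\<Sum>i = 1..n. (axis j 1 \<bullet> x i)\<^sup>2))"
    unfolding x[symmetric] by (simp add: sum_distrib_left sum.swap[of _ "UNIV :: 'd set"])
  also have "\<dots> \<le> (\<Sum>j\<in>(UNIV :: 'd set). B)"
    using B[of "axis _ 1"] by (intro sum_mono) (simp add: norm_axis_1)
  finally have "\<sigma>\<^sup>2 * real CARD('d) \<le> real CARD('d) * B" by simp
  then have "\<sigma>\<^sup>2 \<le> B" by (simp add: mult.commute)
  then show ?thesis using \<sigma> by (meson less_le_trans zero_less_power)
qed

section \<open>The tail bound\<close>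

text \<open>
  From sin (\<pi>/6) = 1/2 and the Taylor polynomial of sin at 53/100.
\<close>

lemma pi_upper_bound: "pi \<le> 318 / 100"
proof (rule ccontr)
  assume "\<not> pi \<le> 318 / 100"
  then have "sin (53 / 100 :: real) \<le> sin (pi / 6)"
    by (intro sin_monotone_2pi_le) auto
  then have "sin (53 / 100 :: real) \<le> 1 / 2" by (simp add: sin_30)
  moreover have "(53 / 100 :: real) - (53 / 100) ^ 3 / 6 - (53 / 100) ^ 4 / 24 \<le> sin (53 / 100)"
  proof -
    have "{..<4::nat} = {0, 1, 2, 3}" by auto
    then have "(\<Sum>m<4. sin_coeff m * (53 / 100 :: real) ^ m) = 53 / 100 - (53 / 100) ^ 3 / 6"
      by (simp add: sin_coeff_def fact_numeral)
    then have "\<bar>sin (53 / 100 :: real) - (53 / 100 - (53 / 100) ^ 3 / 6)\<bar> \<le> (53 / 100) ^ 4 / 24"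
      using Maclaurin_sin_bound[of "53 / 100" 4] by (simp add: fact_numeral)
    then show ?thesis by linarith
  qed
  moreover have "(53 / 100 :: real) - (53 / 100) ^ 3 / 6 - (53 / 100) ^ 4 / 24 > 1 / 2"
    by (simp add: eval_nat_numeral)
  ultimately show False by linarith
qed

text \<open>
  The constant 3679/10000 is a lower bound for 1 - \<pi>^2/16; at twice this value the quadratic Taylor
  polynomial of exp already exceeds 2.
\<close>

lemma tail_constants:
  fixes u :: real
  assumes u: "u \<ge> 2"
  shows "2 * exp (- u) \<le> sqrt (pi / 2) * exp (- (u * pi\<^sup>2 / 16))"
proof -
  have "pi\<^sup>2 \<le> (318 / 100)\<^sup>2" using pi_upper_bound by (intro power_mono) auto
  then have "pi\<^sup>2 / 16 \<le> 1 - 3679 / 10000" by (simp add: power2_eq_square)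
  then have "u * (pi\<^sup>2 / 16) \<le> u * (1 - 3679 / 10000)" using u by (intro mult_left_mono) auto
  moreover have "u * (1 - 3679 / 10000) = u - 3679 / 10000 * u" by (simp add: algebra_simps)
  ultimately have e: "7358 / 10000 \<le> u - u * pi\<^sup>2 / 16" using u by linarith
  have "2 \<le> 1 + 7358 / 10000 + (7358 / 10000 :: real)\<^sup>2 / 2" by (simp add: power2_eq_square)
  also have "\<dots> \<le> exp (7358 / 10000)" by (rule exp_lower_Taylor_quadratic) simp
  also have "\<dots> \<le> exp (u - u * pi\<^sup>2 / 16)" using e by simp
  finally have "2 * exp (- u) \<le> exp (u - u * pi\<^sup>2 / 16) * exp (- u)" by (rule mult_right_mono) simp
  also have "\<dots> = 1 * exp (- (u * pi\<^sup>2 / 16))" by (simp add: exp_add[symmetric])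
  also have "\<dots> \<le> sqrt (pi / 2) * exp (- (u * pi\<^sup>2 / 16))"
    using pi_ge_two by (intro mult_right_mono) auto
  finally show ?thesis .
qed

lemma stiefel_mult_right:
  assumes "orthogonal_matrix Q" "\<theta> \<in> stiefel"
  shows "\<theta> ** Q \<in> stiefel"
  using assms by (simp add: stiefel_def matrix_mult_row inner_orthogonal_matrix)

text \<open>
  The identity map transfers the measure from the Stiefel manifold to the whole matrix space, where it can be
  handled with Borel functions; the group then acts by matrix multiplication from the right.
\<close>

lemma stiefel_haar_invariant:
  fixes \<mu> :: "(real^'d^'k) measure"
  assumes \<mu>: "is_stiefel_haar \<mu>" and Q: "orthogonal_matrix Q"
  shows "distr (distr \<mu> borel (\<lambda>\<theta>. \<theta>)) borel (\<lambda>\<theta>. \<theta> ** Q) = distr \<mu> borel (\<lambda>\<theta>. \<theta>)"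
proof -
  have sets: "sets \<mu> = sets (restrict_space borel stiefel)"
    and inv: "\<And>U. orthogonal_transformation U \<Longrightarrow> distr \<mu> \<mu> (rotate_frame U) = \<mu>"
    using \<mu> by (auto simp: is_stiefel_haar_def)
  have id [measurable]: "(\<lambda>\<theta>. \<theta>) \<in> \<mu> \<rightarrow>\<^sub>M borel"
    using measurable_restrict_space1[OF measurable_ident, of borel stiefel] measurable_cong_sets[OF sets refl]
    by (auto simp: id_def)
  have rot: "rotate_frame (\<lambda>v. v v* Q) = (\<lambda>\<theta> :: real^'d^'k. \<theta> ** Q)"
    by (rule ext, rule iffD2[OF vec_eq_iff]) (simp add: rotate_frame_def matrix_mult_row)
  have "(\<lambda>\<theta>. \<theta> ** Q) \<in> restrict_space borel stiefel \<rightarrow>\<^sub>M restrict_space borel (stiefel :: (real^'d^'k) set)"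
    by (rule measurable_restrict_space3) (auto simp: stiefel_mult_right Q)
  then have m: "(\<lambda>\<theta>. \<theta> ** Q) \<in> \<mu> \<rightarrow>\<^sub>M \<mu>"
    using measurable_cong_sets[OF sets sets] by simp
  have "distr (distr \<mu> borel (\<lambda>\<theta>. \<theta>)) borel (\<lambda>\<theta>. \<theta> ** Q) = distr \<mu> borel (\<lambda>\<theta>. \<theta> ** Q)"
    by (subst distr_distr) (auto simp: comp_def)
  also have "\<dots> = distr (distr \<mu> \<mu> (\<lambda>\<theta>. \<theta> ** Q)) borel (\<lambda>\<theta>. \<theta>)"
    by (subst distr_distr[OF id m]) (simp add: comp_def)
  also have "\<dots> = distr \<mu> borel (\<lambda>\<theta>. \<theta>)"
    using inv[OF orthogonal_transformation_vector_matrix_mult[OF Q]] by (simp add: rot)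
  finally show ?thesis .
qed

theorem theorem8:
  fixes x :: "nat \<Rightarrow> real ^ 'd"
    and n :: nat
    and \<sigma> B \<epsilon> :: real
    and M :: "'a measure"
    and Z :: "'a \<Rightarrow> real ^ 'k"
    and P :: "'b measure"
    and \<mu> :: "(real ^ 'd ^ 'k) measure"
    and \<theta> :: "'b \<Rightarrow> real ^ 'd ^ 'k"
  assumes "CARD('k) \<le> CARD('d)"
    and "n \<ge> 1"
    and "\<sigma> > 0"
    and "1 / real n * (\<Sum>i = 1..n. (norm (x i))\<^sup>2) = \<sigma>\<^sup>2 * real CARD('d)"
    and "B = (SUP \<xi> \<in> sphere 0 1. 1 / real n * (\<Sum>i = 1..n. (\<xi> \<bullet> x i)\<^sup>2))"
    and "std_normal_vector M Z"
    and "is_stiefel_haar \<mu>"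
    and "prob_space P"
    and "\<theta> \<in> measurable P \<mu>"
    and "distr P \<mu> \<theta> = \<mu>"
    and "\<epsilon> > 2 * pi * sqrt (B / real CARD('d))"
  shows "\<P>(\<omega> in P. \<bar>proj_bl_dist n x M (\<lambda>w. \<sigma> *\<^sub>R Z w) (\<theta> \<omega>)
                    - (\<integral>\<omega>'. proj_bl_dist n x M (\<lambda>w. \<sigma> *\<^sub>R Z w) (\<theta> \<omega>') \<partial>P)\<bar> > \<epsilon>)
           \<le> sqrt (pi / 2) * exp (- (real CARD('d) * \<epsilon>\<^sup>2 / (32 * B)))"
proof -
  let ?d = "real CARD('d)"
  interpret P: prob_space P by fact
  have M: "prob_space M" using assms(6) by (simp add: std_normal_vector_def)
  define F where "F = proj_bl_dist n x M (\<lambda>w. \<sigma> *\<^sub>R Z w)"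
  note B = directional_second_moment_bound[OF assms(5)]
  have Bpos: "B > 0" by (rule directional_second_moment_pos[OF B assms(3,4)])
  then have L: "sqrt B > 0" by simp
  have lip: "\<bar>F a - F b\<bar> \<le> sqrt B * norm (a - b)" for a b
    unfolding F_def by (rule proj_bl_dist_lipschitz[OF assms(2) M B])
  have inv: "F (U ** a) = F a" if "orthogonal_matrix U" for U a
    unfolding F_def by (rule proj_bl_dist_frame_invariant[OF assms(2,6) that])
  have "(sqrt B)-lipschitz_on UNIV F" using L lip by (intro lipschitz_onI) (auto simp: dist_norm)
  then have Fm [measurable]: "F \<in> borel_measurable borel"
    by (intro borel_measurable_continuous_onI lipschitz_on_continuous_on)
  have sets: "sets \<mu> = sets (restrict_space borel stiefel)"
    using assms(7) by (simp add: is_stiefel_haar_def)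
  have id: "(\<lambda>a. a) \<in> \<mu> \<rightarrow>\<^sub>M borel"
    using measurable_restrict_space1[OF measurable_ident, of borel stiefel] measurable_cong_sets[OF sets refl]
    by (auto simp: id_def)
  have \<theta>m [measurable]: "\<theta> \<in> P \<rightarrow>\<^sub>M borel"
    using measurable_compose[OF assms(9) id] .
  \<comment> \<open>The law of \<theta>, transferred to the space of all matrices.\<close>
  define \<nu> where "\<nu> = distr P borel \<theta>"
  have \<nu>: "\<nu> = distr \<mu> borel (\<lambda>a. a)"
  proof -
    have "distr \<mu> borel (\<lambda>a. a) = distr (distr P \<mu> \<theta>) borel (\<lambda>a. a)" by (simp only: assms(10))
    also have "\<dots> = \<nu>" by (simp add: \<nu>_def distr_distr[OF id assms(9)] comp_def)
    finally show ?thesis by simp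
  qed
  have \<epsilon>0: "\<epsilon> > 0"
  proof -
    have "0 \<le> 2 * pi * sqrt (B / ?d)" using Bpos by simp
    then show ?thesis using assms(11) by linarith
  qed
  have "measure \<nu> {a \<in> space \<nu>. \<bar>F a - (\<integral>a'. F a' \<partial>\<nu>)\<bar> > \<epsilon>} \<le> 2 * exp (- (?d * \<epsilon>\<^sup>2 / (2 * pi\<^sup>2 * (sqrt B)\<^sup>2)))"
  proof (rule haar_concentration[OF assms(1) _ _ _ _ L lip inv \<epsilon>0])
    show "prob_space \<nu>" unfolding \<nu>_def by (rule P.prob_space_distr) simp
    show "sets \<nu> = sets borel" by (simp add: \<nu>_def)
    have "closed (stiefel :: (real^'d^'k) set)"
      unfolding stiefel_def by (intro closed_Collect_all closed_Collect_eq continuous_intros)+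
    then have "{a \<in> space borel. a \<in> (stiefel :: (real^'d^'k) set)} \<in> sets borel" by simp
    moreover have "\<theta> \<omega> \<in> stiefel" if "\<omega> \<in> space P" for \<omega>
      using measurable_space[OF assms(9) that] sets_eq_imp_space_eq[OF sets] by (simp add: space_restrict_space)
    ultimately show "AE a in \<nu>. a \<in> stiefel"
      unfolding \<nu>_def by (subst AE_distr_iff) auto
    show "distr \<nu> borel (\<lambda>a. a ** Q) = \<nu>" if "orthogonal_matrix Q" for Q
      unfolding \<nu> by (rule stiefel_haar_invariant[OF assms(7) that])
  qed
  also have "(sqrt B)\<^sup>2 = B" using Bpos by simp
  also have "measure \<nu> {a \<in> space \<nu>. \<bar>F a - (\<integral>a'. F a' \<partial>\<nu>)\<bar> > \<epsilon>}
      = \<P>(\<omega> in P. \<bar>F (\<theta> \<omega>) - (\<integral>\<omega>'. F (\<theta> \<omega>') \<partial>P)\<bar> > \<epsilon>)"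
  proof -
    have "(\<integral>a'. F a' \<partial>\<nu>) = (\<integral>\<omega>'. F (\<theta> \<omega>') \<partial>P)" unfolding \<nu>_def by (rule integral_distr) simp_all
    then show ?thesis
      unfolding \<nu>_def by (subst measure_distr) (auto intro!: arg_cong[where f = P.prob])
  qed
  also have "2 * exp (- (?d * \<epsilon>\<^sup>2 / (2 * pi\<^sup>2 * B))) \<le> sqrt (pi / 2) * exp (- (?d * \<epsilon>\<^sup>2 / (2 * pi\<^sup>2 * B) * pi\<^sup>2 / 16))"
  proof (rule tail_constants)
    have "(2 * pi * sqrt (B / ?d))\<^sup>2 \<le> \<epsilon>\<^sup>2" using assms(11) Bpos by (intro power_mono) auto
    then have "4 * pi\<^sup>2 * (B / ?d) \<le> \<epsilon>\<^sup>2" using Bpos by (simp add: power_mult_distrib)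
    then show "2 \<le> ?d * \<epsilon>\<^sup>2 / (2 * pi\<^sup>2 * B)" using Bpos by (simp add: field_simps)
  qed
  also have "?d * \<epsilon>\<^sup>2 / (2 * pi\<^sup>2 * B) * pi\<^sup>2 / 16 = ?d * \<epsilon>\<^sup>2 / (32 * B)" by simp
  finally show ?thesis unfolding F_def by simp
qed

end
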